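(* Let $n \geqslant 6$ and let $m \leqslant \binom{n+1}{2}$. Every action of $\mathrm{Out}(F_n)$ on a set of cardinality $m$ factors through $\mathbb{Z}/2\mathbb{Z}$.
   Context: $F_n$ is the free group of rank $n$. An action of a group $G$ on a set $S$ is a homomorphism $G \to \mathrm{Sym}(S)$; it factors through $\mathbb{Z}/2\mathbb{Z}$ if this homomorphism is a composition $G \to \mathbb{Z}/2\mathbb{Z} \to \mathrm{Sym}(S)$ of homomorphisms. *)

theory Defs
  imports "HOL-Algebra.Algebra"
begin

section \<open>Free groups\<close>

text \<open>
  A letter \<open>(a, True)\<close> stands for the generator \<open>a\<close>, and \<open>(a, False)\<close> for its formal inverse.
  The free group on \<open>A\<close> is modelled by the freely reduced words in these letters.
\<close>

type_synonym 'a letter = "'a \<times> bool"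

definition inv_letter :: "'a letter \<Rightarrow> 'a letter"
  where "inv_letter x = (fst x, \<not> snd x)"

definition reduced :: "'a letter list \<Rightarrow> bool"
  where "reduced w \<longleftrightarrow> successively (\<lambda>x y. y \<noteq> inv_letter x) w"

text \<open>The reduced form of \<open>x # w\<close> for a reduced word \<open>w\<close>.\<close>

definition red_Cons :: "'a letter \<Rightarrow> 'a letter list \<Rightarrow> 'a letter list"
  where "red_Cons x w = (if w \<noteq> [] \<and> hd w = inv_letter x then tl w else x # w)"

text \<open>
  The product of \<open>v\<close> and \<open>w\<close> is the reduced form of \<open>v @ w\<close>, obtained by multiplying \<open>w\<close> from the
  left by the letters of \<open>v\<close>, last letter first.
\<close>

definition free_group :: "'a set \<Rightarrow> 'a letter list monoid"
  where "free_group A =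
    \<lparr>carrier = {w. set w \<subseteq> A \<times> UNIV \<and> reduced w}, monoid.mult = foldr red_Cons, one = []\<rparr>"

lemma inv_letter_inv_letter [simp]: "inv_letter (inv_letter x) = x"
  by (simp add: inv_letter_def)

lemma inv_letter_neq [simp]: "inv_letter x \<noteq> x" "x \<noteq> inv_letter x"
  by (auto simp: inv_letter_def prod_eq_iff)

lemma inv_letter_in_iff [simp]: "inv_letter x \<in> A \<times> UNIV \<longleftrightarrow> x \<in> A \<times> UNIV"
  by (cases x) (auto simp: inv_letter_def)

lemma reduced_Nil [simp]: "reduced []"
  by (simp add: reduced_def)

lemma reduced_Cons:
  "reduced (x # w) \<longleftrightarrow> (w = [] \<or> hd w \<noteq> inv_letter x) \<and> reduced w"
  by (auto simp: reduced_def successively_Cons)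

lemma reduced_red_Cons: "reduced w \<Longrightarrow> reduced (red_Cons x w)"
  by (cases w) (auto simp: red_Cons_def reduced_Cons)

lemma set_red_Cons: "set w \<subseteq> A \<times> UNIV \<Longrightarrow> x \<in> A \<times> UNIV \<Longrightarrow> set (red_Cons x w) \<subseteq> A \<times> UNIV"
  by (cases w) (auto simp: red_Cons_def)

lemma red_Cons_cancel: "reduced w \<Longrightarrow> red_Cons x (red_Cons (inv_letter x) w) = w"
  by (cases w) (auto simp: red_Cons_def reduced_Cons)

lemma reduced_foldr: "reduced w \<Longrightarrow> reduced (foldr red_Cons v w)"
  by (induction v) (auto simp: reduced_red_Cons)

lemma set_foldr:
  "set w \<subseteq> A \<times> UNIV \<Longrightarrow> set v \<subseteq> A \<times> UNIV \<Longrightarrow> set (foldr red_Cons v w) \<subseteq> A \<times> UNIV"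
  by (induction v) (simp_all add: set_red_Cons)

lemma foldr_red_Cons:
  assumes "reduced w"
  shows "foldr red_Cons (red_Cons x v) w = red_Cons x (foldr red_Cons v w)"
proof (cases "v \<noteq> [] \<and> hd v = inv_letter x")
  case True
  then obtain v' where "v = inv_letter x # v'"
    by (cases v) auto
  then show ?thesis
    using assms by (simp add: red_Cons_cancel reduced_foldr) (simp add: red_Cons_def)
next
  case False
  then have "red_Cons x v = x # v"
    unfolding red_Cons_def by auto
  then show ?thesis
    by simp
qed

lemma foldr_red_Cons_assoc:
  "reduced w \<Longrightarrow> foldr red_Cons (foldr red_Cons u v) w = foldr red_Cons u (foldr red_Cons v w)"
  by (induction u) (simp_all add: foldr_red_Cons)

lemma foldr_red_Cons_Nil: "reduced w \<Longrightarrow> foldr red_Cons w [] = w"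
  by (induction w) (auto simp: reduced_Cons red_Cons_def)

lemma reduced_inverse: "reduced w \<Longrightarrow> reduced (rev (map inv_letter w))"
  unfolding reduced_def successively_rev successively_map
  by (erule successively_mono) auto

lemma set_inverse: "set w \<subseteq> A \<times> UNIV \<Longrightarrow> set (rev (map inv_letter w)) \<subseteq> A \<times> UNIV"
  by (induction w) simp_all

lemma foldr_red_Cons_inverse: "foldr red_Cons (rev (map inv_letter w)) w = []"
  by (induction w) (simp_all add: red_Cons_def)

theorem group_free_group: "group (free_group A)"
proof (rule groupI)
  fix w assume "w \<in> carrier (free_group A)"
  then show "\<exists>v\<in>carrier (free_group A). v \<otimes>\<^bsub>free_group A\<^esub> w = \<one>\<^bsub>free_group A\<^esub>"
    by (intro bexI [of _ "rev (map inv_letter w)"])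
      (use set_inverse [of w A] in \<open>auto simp: free_group_def foldr_red_Cons_inverse reduced_inverse\<close>)
next
  fix v w assume "v \<in> carrier (free_group A)" "w \<in> carrier (free_group A)"
  then show "v \<otimes>\<^bsub>free_group A\<^esub> w \<in> carrier (free_group A)"
    using set_foldr [of w A v] reduced_foldr [of w v] by (simp add: free_group_def)
qed (auto simp: free_group_def foldr_red_Cons_assoc)

text \<open>The universal property of the free group, with \<open>a \<in> A\<close> included as the word \<open>[(a, True)]\<close>.\<close>

definition eval_letter :: "('g, 'b) monoid_scheme \<Rightarrow> ('a \<Rightarrow> 'g) \<Rightarrow> 'a letter \<Rightarrow> 'g"
  where "eval_letter H f x = (if snd x then f (fst x) else inv\<^bsub>H\<^esub> (f (fst x)))"

definition eval_word :: "('g, 'b) monoid_scheme \<Rightarrow> ('a \<Rightarrow> 'g) \<Rightarrow> 'a letter list \<Rightarrow> 'g"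
  where "eval_word H f w = foldr (\<lambda>x h. eval_letter H f x \<otimes>\<^bsub>H\<^esub> h) w \<one>\<^bsub>H\<^esub>"

context group
begin

lemma eval_letter_closed:
  "f \<in> A \<rightarrow> carrier G \<Longrightarrow> x \<in> A \<times> UNIV \<Longrightarrow> eval_letter G f x \<in> carrier G"
  by (auto simp: eval_letter_def Pi_iff)

lemma eval_letter_inv:
  "f \<in> A \<rightarrow> carrier G \<Longrightarrow> x \<in> A \<times> UNIV \<Longrightarrow> eval_letter G f (inv_letter x) = inv (eval_letter G f x)"
  by (auto simp: eval_letter_def inv_letter_def Pi_iff)

lemma eval_word_closed:
  "f \<in> A \<rightarrow> carrier G \<Longrightarrow> set w \<subseteq> A \<times> UNIV \<Longrightarrow> eval_word G f w \<in> carrier G"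
  by (induction w) (simp_all add: eval_word_def eval_letter_closed)

lemma eval_word_red_Cons:
  assumes f: "f \<in> A \<rightarrow> carrier G" and w: "set w \<subseteq> A \<times> UNIV" and x: "x \<in> A \<times> UNIV"
  shows "eval_word G f (red_Cons x w) = eval_letter G f x \<otimes> eval_word G f w"
proof (cases "w \<noteq> [] \<and> hd w = inv_letter x")
  case True
  then obtain w' where w': "w = inv_letter x # w'"
    by (cases w) auto
  have 1: "eval_word G f w' \<in> carrier G"
    using eval_word_closed [OF f, of w'] w w' by simp
  have 2: "eval_word G f w = inv (eval_letter G f x) \<otimes> eval_word G f w'"
    using eval_letter_inv [OF f x] by (simp add: w' eval_word_def)
  have 3: "red_Cons x w = w'"
    by (simp add: w' red_Cons_def)
  show ?thesis
    unfolding 2 3 using 1 eval_letter_closed [OF f x] by (simp add: m_assoc [symmetric])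
next
  case False
  then have "red_Cons x w = x # w"
    unfolding red_Cons_def by auto
  then show ?thesis
    by (simp add: eval_word_def)
qed

lemma eval_word_hom:
  assumes f: "f \<in> A \<rightarrow> carrier G"
  shows "eval_word G f \<in> hom (free_group A) G"
proof (rule homI)
  fix v w assume vw: "v \<in> carrier (free_group A)" "w \<in> carrier (free_group A)"
  then have w: "set w \<subseteq> A \<times> UNIV" and v: "set v \<subseteq> A \<times> UNIV"
    by (simp_all add: free_group_def)
  have "eval_word G f (foldr red_Cons v w) = eval_word G f v \<otimes> eval_word G f w"
    using v
  proof (induction v)
    case Nil
    then show ?case
      using eval_word_closed [OF f w] by (simp add: eval_word_def)
  next
    case (Cons x v)
    have x: "x \<in> A \<times> UNIV" and v: "set v \<subseteq> A \<times> UNIV"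
      using Cons.prems by simp_all
    have "eval_word G f (x # v) = eval_letter G f x \<otimes> eval_word G f v"
      by (simp add: eval_word_def)
    then show ?case
      using eval_word_red_Cons [OF f set_foldr [OF w v] x] Cons.IH [OF v]
        eval_word_closed [OF f v] eval_word_closed [OF f w] eval_letter_closed [OF f x]
      by (simp add: m_assoc)
  qed
  then show "eval_word G f (v \<otimes>\<^bsub>free_group A\<^esub> w) = eval_word G f v \<otimes> eval_word G f w"
    by (simp add: free_group_def)
qed (simp add: free_group_def eval_word_closed [OF f])

theorem free_group_universal:
  assumes f: "f \<in> A \<rightarrow> carrier G"
  shows "\<exists>!h. h \<in> hom (free_group A) G \<and> h \<in> extensional (carrier (free_group A))
    \<and> (\<forall>a\<in>A. h [(a, True)] = f a)"
proof (rule ex_ex1I)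
  let ?F = "free_group A"
  have "\<forall>a\<in>A. [(a, True)] \<in> carrier ?F \<and> eval_word G f [(a, True)] = f a"
    using f by (auto simp: free_group_def reduced_Cons eval_word_def eval_letter_def Pi_iff)
  then show "\<exists>h. h \<in> hom ?F G \<and> h \<in> extensional (carrier ?F) \<and> (\<forall>a\<in>A. h [(a, True)] = f a)"
    using group.hom_restrict [OF group_free_group eval_word_hom [OF f]]
    by (intro exI [of _ "restrict (eval_word G f) (carrier ?F)"]) simp
next
  let ?F = "free_group A"
  fix h k
  assume h: "h \<in> hom ?F G \<and> h \<in> extensional (carrier ?F) \<and> (\<forall>a\<in>A. h [(a, True)] = f a)"
    and k: "k \<in> hom ?F G \<and> k \<in> extensional (carrier ?F) \<and> (\<forall>a\<in>A. k [(a, True)] = f a)"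
  have eval: "g w = eval_word G f w"
    if g: "g \<in> hom ?F G" "\<forall>a\<in>A. g [(a, True)] = f a" and w: "w \<in> carrier ?F" for g w
  proof -
    interpret g: group_hom ?F G g
      using g(1) group_free_group by (simp add: group_hom_def group_hom_axioms_def is_group)
    have letter: "g [x] = eval_letter G f x" if x: "x \<in> A \<times> UNIV" for x
    proof (cases "snd x")
      case True
      then have "x = (fst x, True)"
        by (simp add: prod_eq_iff)
      then show ?thesis
        using x g(2) True by (metis eval_letter_def mem_Times_iff)
    next
      case False
      then have eq: "x = inv_letter (fst x, True)"
        by (simp add: prod_eq_iff inv_letter_def)
      have mem: "[(fst x, True)] \<in> carrier ?F" "[x] \<in> carrier ?F"
        using x by (auto simp: free_group_def reduced_Cons)
      have "[x] \<otimes>\<^bsub>?F\<^esub> [(fst x, True)] = \<one>\<^bsub>?F\<^esub>"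
        using False by (simp add: free_group_def red_Cons_def inv_letter_def)
      then have "[x] = inv\<^bsub>?F\<^esub> [(fst x, True)]"
        using g.G.inv_equality mem by metis
      then show ?thesis
        using g.hom_inv [OF mem(1)] g(2) x False by (auto simp: eval_letter_def)
    qed
    have "set w \<subseteq> A \<times> UNIV" "reduced w"
      using w by (simp_all add: free_group_def)
    then show ?thesis
    proof (induction w)
      case Nil
      then show ?case
        using g.hom_one by (simp add: free_group_def eval_word_def)
    next
      case (Cons x w)
      then have mem: "[x] \<in> carrier ?F" "w \<in> carrier ?F"
        by (auto simp: free_group_def reduced_Cons)
      have "[x] \<otimes>\<^bsub>?F\<^esub> w = x # w"
        using Cons.prems(2) by (auto simp: free_group_def red_Cons_def reduced_Cons)
      then show ?case
        using g.hom_mult [OF mem] Cons letter [of x] by (simp add: eval_word_def reduced_Cons)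
    qed
  qed
  show "h = k"
    by (rule extensionalityI [where A = "carrier ?F"]) (use h k eval [of h] eval [of k] in auto)
qed

end


section \<open>Outer automorphism groups\<close>

definition inner_auto :: "('a, 'b) monoid_scheme \<Rightarrow> 'a \<Rightarrow> 'a \<Rightarrow> 'a"
  where "inner_auto G g = (\<lambda>x\<in>carrier G. g \<otimes>\<^bsub>G\<^esub> x \<otimes>\<^bsub>G\<^esub> inv\<^bsub>G\<^esub> g)"

definition Inn :: "('a, 'b) monoid_scheme \<Rightarrow> ('a \<Rightarrow> 'a) set"
  where "Inn G = inner_auto G ` carrier G"

definition Out :: "('a, 'b) monoid_scheme \<Rightarrow> ('a \<Rightarrow> 'a) set monoid"
  where "Out G = AutoGroup G Mod Inn G"

context group
begin

lemma inner_auto_auto: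
  assumes g: "g \<in> carrier G"
  shows "inner_auto G g \<in> auto G"
proof -
  have inv_cancel: "inv g \<otimes> (g \<otimes> x) = x" "g \<otimes> (inv g \<otimes> x) = x" if "x \<in> carrier G" for x
    using g that by (simp_all add: m_assoc [symmetric])
  have "bij_betw (inner_auto G g) (carrier G) (carrier G)"
    by (rule bij_betwI [where g = "\<lambda>x. inv g \<otimes> x \<otimes> g"])
      (use g in \<open>auto simp: inner_auto_def m_assoc inv_cancel\<close>)
  moreover have "inner_auto G g \<in> hom G G"
    by (rule homI) (use g in \<open>auto simp: inner_auto_def m_assoc inv_cancel\<close>)
  ultimately show ?thesis
    by (simp add: auto_def Bij_def inner_auto_def)
qed

lemma carrier_AutoGroup: "carrier (AutoGroup G) = auto G"
  by (simp add: AutoGroup_def)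

lemma mult_AutoGroup:
  "f \<in> auto G \<Longrightarrow> h \<in> auto G \<Longrightarrow> f \<otimes>\<^bsub>AutoGroup G\<^esub> h = compose (carrier G) f h"
  by (simp add: AutoGroup_def BijGroup_def auto_def)

lemma inner_auto_hom: "inner_auto G \<in> hom G (AutoGroup G)"
proof (rule homI)
  fix g h assume gh: "g \<in> carrier G" "h \<in> carrier G"
  then show "inner_auto G (g \<otimes> h) = inner_auto G g \<otimes>\<^bsub>AutoGroup G\<^esub> inner_auto G h"
    by (simp add: mult_AutoGroup inner_auto_auto)
      (auto simp: inner_auto_def compose_def m_assoc inv_mult_group fun_eq_iff)
qed (simp add: inner_auto_auto AutoGroup_def)

lemma Inn_normal: "Inn G \<lhd> AutoGroup G"
proof -
  interpret A: group "AutoGroup G"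
    by (rule AutoGroup)
  interpret group_hom G "AutoGroup G" "inner_auto G"
    by unfold_locales (rule inner_auto_hom)
  have conj: "f \<otimes>\<^bsub>AutoGroup G\<^esub> inner_auto G g = inner_auto G (f g) \<otimes>\<^bsub>AutoGroup G\<^esub> f"
    if f: "f \<in> auto G" and g: "g \<in> carrier G" for f g
  proof -
    interpret f: group_hom G G f
      using f by unfold_locales (simp add: auto_def)
    show ?thesis
      using f g by (simp add: mult_AutoGroup inner_auto_auto)
        (auto simp: inner_auto_def compose_def fun_eq_iff)
  qed
  show ?thesis
    unfolding A.normal_inv_iff
  proof (intro conjI ballI)
    show "subgroup (Inn G) (AutoGroup G)"
      unfolding Inn_def by (rule img_is_subgroup)
  next
    fix f i assume f: "f \<in> carrier (AutoGroup G)" and "i \<in> Inn G"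
    then obtain g where g: "g \<in> carrier G" "i = inner_auto G g"
      by (auto simp: Inn_def)
    have fg: "f g \<in> carrier G"
      using f g by (auto simp: AutoGroup_def auto_def hom_def)
    then have "f \<otimes>\<^bsub>AutoGroup G\<^esub> i \<otimes>\<^bsub>AutoGroup G\<^esub> inv\<^bsub>AutoGroup G\<^esub> f = inner_auto G (f g)"
      using conj [of f g] f g A.m_assoc [OF hom_closed [OF fg] f A.inv_closed [OF f]] A.r_inv [OF f]
      by (simp add: carrier_AutoGroup [symmetric])
    then show "f \<otimes>\<^bsub>AutoGroup G\<^esub> i \<otimes>\<^bsub>AutoGroup G\<^esub> inv\<^bsub>AutoGroup G\<^esub> f \<in> Inn G"
      using fg by (simp add: Inn_def)
  qed
qed

theorem group_Out: "group (Out G)"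
  unfolding Out_def by (rule normal.factorgroup_is_group [OF Inn_normal])

end


section \<open>Actions factoring through a group of order two\<close>

definition factors_through_Z2 :: "('g, 'b) monoid_scheme \<Rightarrow> 's set \<Rightarrow> ('g \<Rightarrow> 's \<Rightarrow> 's) \<Rightarrow> bool"
  where "factors_through_Z2 G S \<phi> \<longleftrightarrow>
    (\<exists>\<alpha> \<in> hom G (integer_mod_group 2). \<exists>\<beta> \<in> hom (integer_mod_group 2) (BijGroup S).
      \<forall>g \<in> carrier G. \<phi> g = \<beta> (\<alpha> g))"

end

theory Submission
  imports Defs "HOL-Library.Countable_Set"
begin

text \<open>
  Write \<open>N\<close> for the cardinality of the set, so \<open>N \<le> n (n + 1) / 2\<close>. Already every action of
  \<open>Aut(F\<^sub>n)\<close> on such a set has image of order at most two, and an action of \<open>Out(F\<^sub>n)\<close> is an action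
  of \<open>Aut(F\<^sub>n)\<close>. Letters are generators or inverses of generators. For letters \<open>x\<close>, \<open>y\<close> of
  different generators the transvection \<open>T x y\<close> sends \<open>x\<close> to \<open>x y\<close> and fixes the other
  generators; this covers left and right multiplication and their inverses. By Nielsen's method
  (\<open>nielsen_induct\<close>) the transvections and the signed permutations of the letters generate
  \<open>Aut(F\<^sub>n)\<close>. Once all transvections act trivially, the relation expressing a signed swap of two
  letters by transvections makes all swaps and all sign changes act by one and the same involution, and
  this involution generates the image. So the task is to show that transvections act trivially.

  The sign changes \<open>e j\<close> of the generators are commuting involutions. An orbit of the group that
  they generate is a quotient of the power set of the generators, and the characters
  which occur on the orbit form the annihilator of a point stabilizer; they are encoded as sets of
  generators, the weights. An orbit has as many points as weights, so counting
  pairs of an orbit and a weight counts \<open>N\<close>. The symmetric group permutes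
  these pairs, and a weight of size between \<open>2\<close> and \<open>n - 2\<close> has too many conjugates
  (\<open>involution_dichotomy\<close>). Hence the set splits into a part on which all products \<open>e j e k\<close> act
  trivially and parts, one for each generator \<open>i\<close>, on which \<open>e j e k\<close> moves every point exactly
  if \<open>i\<close> is one of \<open>j\<close>, \<open>k\<close>.

  Conjugation by \<open>e j e k\<close> inverts a transvection or exchanges left and right multiplication. So
  where these products act trivially the transvections satisfy the relations of the elementary
  matrices over the field with two elements. Those of the first row generate an elementary abelian
  group of rank \<open>n - 1\<close> whose nontrivial characters are all conjugate, so a nontrivial action needs
  \<open>2 ^ (n - 1)\<close> points (\<open>steinberg_mod2_trivial\<close>). For the group of rank \<open>n - 1\<close>
  which omits the generator \<open>i\<close>, this shows that its transvections act trivially on the \<open>i\<close>-th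
  part, since this part has no more than \<open>n + 1\<close> points.
  The commutator relation then excludes that a transvection moves points between the \<open>i\<close>-th and the
  \<open>j\<close>-th part. If one moved a point from such a part into the first part, then every pair of
  generators would mark a point of the first part, and distinct pairs distinct points; together with the
  points of the other parts these are more than \<open>N\<close> (\<open>too_many_pairs\<close>). So transvections act trivially on the parts
  labelled by generators; but they generate the products \<open>e j e k\<close>, which act there without fixing
  points. These parts are therefore empty, and the bound \<open>2 ^ (n - 1) > N\<close> applies to the
  whole set (\<open>transvection_trivial\<close>).
\<close>

section \<open>Cancellation in reduced words\<close>

definition word_inv :: "'a letter list \<Rightarrow> 'a letter list"
  where "word_inv w = rev (map inv_letter w)"

lemma length_word_inv [simp]: "length (word_inv w) = length w"
  by (simp add: word_inv_def)

lemma word_inv_word_inv [simp]: "word_inv (word_inv w) = w"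
  by (simp add: word_inv_def rev_map comp_def)

lemma word_inv_append: "word_inv (v @ w) = word_inv w @ word_inv v"
  by (simp add: word_inv_def)

lemma word_inv_Nil [simp]: "word_inv [] = []"
  by (simp add: word_inv_def)

lemma word_inv_singleton [simp]: "word_inv [x] = [inv_letter x]"
  by (simp add: word_inv_def)

lemma foldr_red_Cons_reduced: "reduced (v @ w) \<Longrightarrow> foldr red_Cons v w = v @ w"
  by (induction v) (auto simp: reduced_Cons red_Cons_def)

lemma reduced_snoc_Cons:
  "reduced (v @ x # y # w) \<longleftrightarrow> reduced (v @ [x]) \<and> reduced (y # w) \<and> y \<noteq> inv_letter x"
  unfolding reduced_def successively_append_iff
  by (auto simp: successively_Cons)

text \<open>
  The length of the longest common prefix.
\<close>
fun agree :: "'b list \<Rightarrow> 'b list \<Rightarrow> nat" where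
  "agree (x # v) (y # w) = (if x = y then Suc (agree v w) else 0)"
| "agree v w = 0"

text \<open>
  The number of letters at the end of \<open>v\<close> that cancel against the beginning of \<open>w\<close> in the product.
\<close>
definition cancel :: "'a letter list \<Rightarrow> 'a letter list \<Rightarrow> nat"
  where "cancel v w = agree (word_inv v) w"

lemma agree_le: "agree v w \<le> length v" "agree v w \<le> length w"
  by (induction v w rule: agree.induct) auto

lemma take_agree: "take (agree v w) v = take (agree v w) w"
  by (induction v w rule: agree.induct) auto

lemma agree_sym: "agree v w = agree w v"
  by (induction v w rule: agree.induct) auto

text \<open>
  The number of agreeing letters is determined by one letter more than those that agree. In the length
  estimate for products this allows the second factor to be replaced by a longer word with the same
  beginning.
\<close>
lemma agree_cong:
  "agree v w < k \<Longrightarrow> k \<le> length w \<Longrightarrow> take k w' = take k w \<Longrightarrow> agree v w' = agree v w"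
proof (induction v w arbitrary: k w' rule: agree.induct)
  case (1 x v y w)
  obtain k' where k: "k = Suc k'" using 1 by (cases k) auto
  obtain y' w'' where w': "w' = y' # w''" using 1 k by (cases w') auto
  show ?case using "1.IH" [of k' w''] "1.prems" k w' by (auto split: if_splits)
qed auto

lemma mult_cancel:
  assumes "reduced v" "reduced w"
  shows "foldr red_Cons v w = take (length v - cancel v w) v @ drop (cancel v w) w"
  using assms
proof (induction v arbitrary: w rule: rev_induct)
  case Nil
  then show ?case by (simp add: cancel_def foldr_red_Cons_reduced)
next
  case (snoc x v)
  show ?case
  proof (cases w)
    case Nil
    then show ?thesis using snoc.prems by (simp add: cancel_def foldr_red_Cons_Nil agree_sym flip: foldr_append)
  next
    case (Cons y w')
    show ?thesis
    proof (cases "y = inv_letter x")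
      case True
      have "reduced v" "reduced w'"
        using snoc.prems Cons by (auto simp: reduced_def successively_append_iff successively_Cons)
      moreover have "cancel (v @ [x]) w = Suc (cancel v w')"
        using True by (simp add: Cons cancel_def word_inv_append)
      moreover have "foldr red_Cons (v @ [x]) w = foldr red_Cons v w'"
        using True by (simp add: Cons red_Cons_def)
      ultimately show ?thesis
        using snoc.IH Cons agree_le(1)[of "word_inv v" w'] by (simp add: cancel_def)
    next
      case False
      have "cancel (v @ [x]) w = 0"
        using False by (auto simp: Cons cancel_def word_inv_append)
      moreover have "reduced ((v @ [x]) @ w)"
        using snoc.prems False Cons by (simp add: reduced_snoc_Cons)
      ultimately show ?thesis
        by (simp add: foldr_red_Cons_reduced del: foldr_append append_assoc)
    qed
  qed
qed

lemma length_mult_cancel: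
  assumes "reduced v" "reduced w"
  shows "length (foldr red_Cons v w) + 2 * cancel v w = length v + length w"
  using mult_cancel [OF assms] agree_le [of "word_inv v" w] by (simp add: cancel_def)

lemma cancel_le: "cancel v w \<le> length v" "cancel v w \<le> length w"
  using agree_le [of "word_inv v" w] by (simp_all add: cancel_def)

lemma take_cancel: "take (cancel v w) w = take (cancel v w) (word_inv v)"
  by (simp add: cancel_def take_agree)

lemma word_inv_drop: "word_inv (drop k w) = take (length w - k) (word_inv w)"
  by (cases "k \<le> length w") (simp_all add: word_inv_def take_rev drop_map)

lemma word_inv_nth: "i < length w \<Longrightarrow> word_inv w ! i = inv_letter (w ! (length w - 1 - i))"
  by (simp add: word_inv_def rev_nth)

lemma reduced_nth: "reduced w \<Longrightarrow> Suc i < length w \<Longrightarrow> w ! Suc i \<noteq> inv_letter (w ! i)"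
  by (auto simp: reduced_def successively_conv_nth)

text \<open>
  If half of \<open>w\<close> cancelled in \<open>w w\<close>, the middle letter of \<open>w\<close> would be its own inverse, or the
  two middle letters would be inverse to each other.
\<close>
lemma cancel_self:
  assumes "reduced w" "w \<noteq> []"
  shows "2 * cancel w w < length w"
proof (rule ccontr)
  assume *: "\<not> ?thesis"
  have eq: "w ! i = inv_letter (w ! (length w - 1 - i))" if "i < cancel w w" for i
  proof -
    have "i < length w" using that cancel_le(1) [of w w] by simp
    moreover have "take (cancel w w) w ! i = take (cancel w w) (word_inv w) ! i"
      by (simp add: take_cancel)
    ultimately show ?thesis using that by (simp add: word_inv_nth)
  qed
  show False
  proof (cases "even (length w)")
    case True
    then obtain h where h: "length w = 2 * h" by blast
    with assms obtain h' where h': "h = Suc h'" by (cases h) auto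
    have "w ! h' = inv_letter (w ! Suc h')" using eq [of h'] * h h' by simp
    then show False using reduced_nth [OF assms(1), of h'] h h' by simp
  next
    case False
    then obtain h where "length w = 2 * h + 1" by (auto elim: oddE)
    then show False using eq [of h] * by simp
  qed
qed

section \<open>Transvections and signed permutations\<close>
locale free_automorphisms =
  fixes A :: "'a set"
begin

abbreviation F where "F \<equiv> free_group A"
abbreviation L :: "'a letter set" where "L \<equiv> A \<times> UNIV"
abbreviation AF where "AF \<equiv> AutoGroup F"

sublocale F: group F
  by (rule group_free_group)

sublocale AF: group AF
  by (rule F.AutoGroup)

lemma letter_closed [simp]: "x \<in> L \<Longrightarrow> [x] \<in> carrier F"
  by (simp add: free_group_def reduced_Cons)

lemma mult_F: "v \<otimes>\<^bsub>F\<^esub> w = foldr red_Cons v w"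
  by (simp add: free_group_def)

lemma one_F: "\<one>\<^bsub>F\<^esub> = []"
  by (simp add: free_group_def)

lemma carrier_F: "w \<in> carrier F \<longleftrightarrow> set w \<subseteq> L \<and> reduced w"
  by (simp add: free_group_def)

lemma inv_F: "w \<in> carrier F \<Longrightarrow> inv\<^bsub>F\<^esub> w = word_inv w"
  using set_inverse [of w A] reduced_inverse [of w]
  by (intro F.inv_equality)
    (auto simp: carrier_F mult_F one_F word_inv_def foldr_red_Cons_inverse)

lemma inv_letter_L [simp]: "inv_letter x \<in> L \<longleftrightarrow> x \<in> L"
  by (rule inv_letter_in_iff)

lemma inv_singleton: "x \<in> L \<Longrightarrow> inv\<^bsub>F\<^esub> [x] = [inv_letter x]"
  by (simp add: inv_F)

lemma Cons_mult: "x # w \<in> carrier F \<Longrightarrow> x # w = [x] \<otimes>\<^bsub>F\<^esub> w"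
  by (auto simp: carrier_F mult_F red_Cons_def reduced_Cons)

lemma Cons_closed: "x # w \<in> carrier F \<Longrightarrow> x \<in> L \<and> w \<in> carrier F"
  by (auto simp: carrier_F reduced_Cons)

lemma fst_inv_letter [simp]: "fst (inv_letter x) = fst x"
  by (simp add: inv_letter_def)

lemma fst_eq_cases: "fst x = fst y \<Longrightarrow> x = y \<or> x = inv_letter y"
  by (auto simp: inv_letter_def prod_eq_iff)

lemma ex_letterI: "fst a = i \<Longrightarrow> P [a] \<Longrightarrow> \<exists>b. P [(i, b)]"
  by (metis prod.collapse)

text \<open>
  It suffices to compare two homomorphisms on one letter of each generator, which may be the
  inverse one; for a transvection \<open>T x y\<close> this letter is \<open>x\<close>, whatever its sign.
\<close>
lemma hom_eqI:
  assumes h: "h \<in> hom F F" "h \<in> extensional (carrier F)"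
    and k: "k \<in> hom F F" "k \<in> extensional (carrier F)"
    and eq: "\<And>i. i \<in> A \<Longrightarrow> \<exists>b. h [(i, b)] = k [(i, b)]"
  shows "h = k"
proof -
  interpret h: group_hom F F h using h(1) by unfold_locales
  interpret k: group_hom F F k using k(1) by unfold_locales
  have eq': "h [(i, True)] = k [(i, True)]" if "i \<in> A" for i
  proof -
    have i: "(i, False) \<in> L" "(i, True) \<in> L" using that by auto
    have "[(i, True)] = inv\<^bsub>F\<^esub> [(i, False)]"
      using inv_singleton [OF i(1)] by (simp add: inv_letter_def)
    then have "h [(i, False)] = k [(i, False)] \<Longrightarrow> ?thesis"
      using h.hom_inv k.hom_inv letter_closed [OF i(1)] by metis
    then show ?thesis using eq [OF that] by (metis (full_types))
  qed
  have "(\<lambda>i. h [(i, True)]) \<in> A \<rightarrow> carrier F"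
    by auto
  from F.free_group_universal [OF this] h k eq' show ?thesis
    by (elim ex1E) metis
qed

lemma autoD:
  assumes "\<alpha> \<in> auto F"
  shows "\<alpha> \<in> hom F F" "\<alpha> \<in> extensional (carrier F)" "inj_on \<alpha> (carrier F)" "\<alpha> ` carrier F = carrier F"
  using assms by (auto simp: auto_def Bij_def bij_betw_def)

lemma auto_group_hom: "\<alpha> \<in> auto F \<Longrightarrow> group_hom F F \<alpha>"
  by (simp add: group_hom_def group_hom_axioms_def autoD(1) F.is_group)

lemma AF_eval: "\<alpha> \<in> auto F \<Longrightarrow> \<beta> \<in> auto F \<Longrightarrow> w \<in> carrier F \<Longrightarrow> (\<alpha> \<otimes>\<^bsub>AF\<^esub> \<beta>) w = \<alpha> (\<beta> w)"
  by (simp add: F.mult_AutoGroup compose_def)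

lemma AF_one: "w \<in> carrier F \<Longrightarrow> \<one>\<^bsub>AF\<^esub> w = w"
  by (simp add: AutoGroup_def BijGroup_def)

lemma AF_mult_closed: "\<alpha> \<in> auto F \<Longrightarrow> \<beta> \<in> auto F \<Longrightarrow> \<alpha> \<otimes>\<^bsub>AF\<^esub> \<beta> \<in> auto F"
  using AF.m_closed by (simp add: F.carrier_AutoGroup)

lemma AF_one_closed: "\<one>\<^bsub>AF\<^esub> \<in> auto F"
  using AF.one_closed by (simp add: F.carrier_AutoGroup)

lemma auto_eqI:
  assumes "\<alpha> \<in> auto F" "\<beta> \<in> auto F" "\<And>i. i \<in> A \<Longrightarrow> \<exists>b. \<alpha> [(i, b)] = \<beta> [(i, b)]"
  shows "\<alpha> = \<beta>"
  using hom_eqI autoD assms by metis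

lemma auto_closed: "\<alpha> \<in> auto F \<Longrightarrow> w \<in> carrier F \<Longrightarrow> \<alpha> w \<in> carrier F"
  using autoD(4) by blast

lemma auto_inv: "\<alpha> \<in> auto F \<Longrightarrow> w \<in> carrier F \<Longrightarrow> \<alpha> (inv\<^bsub>F\<^esub> w) = inv\<^bsub>F\<^esub> (\<alpha> w)"
  by (rule group_hom.hom_inv [OF auto_group_hom])

lemma auto_mult:
  "\<alpha> \<in> auto F \<Longrightarrow> v \<in> carrier F \<Longrightarrow> w \<in> carrier F \<Longrightarrow> \<alpha> (v \<otimes>\<^bsub>F\<^esub> w) = \<alpha> v \<otimes>\<^bsub>F\<^esub> \<alpha> w"
  by (rule group_hom.hom_mult [OF auto_group_hom])

lemma hom_inv_pair_auto:
  assumes h: "h \<in> hom F F" "h \<in> extensional (carrier F)"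
    and k: "k \<in> hom F F" "k \<in> extensional (carrier F)"
    and hk: "\<And>i. i \<in> A \<Longrightarrow> \<exists>b. h (k [(i, b)]) = [(i, b)]"
    and kh: "\<And>i. i \<in> A \<Longrightarrow> \<exists>b. k (h [(i, b)]) = [(i, b)]"
  shows "h \<in> auto F"
proof -
  have *: "h (k w) = w" if w: "w \<in> carrier F"
    and h: "h \<in> hom F F" and k: "k \<in> hom F F"
    and hk: "\<And>i. i \<in> A \<Longrightarrow> \<exists>b. h (k [(i, b)]) = [(i, b)]" for h k w
  proof -
    have "compose (carrier F) h k = (\<lambda>w\<in>carrier F. w)"
    proof (rule hom_eqI)
      show "compose (carrier F) h k \<in> hom F F"
        using h k by (intro F.hom_compose)
      show "(\<lambda>w\<in>carrier F. w) \<in> hom F F"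
        by (auto simp: hom_def)
      fix i assume i: "i \<in> A"
      then obtain b where "h (k [(i, b)]) = [(i, b)]" using hk by blast
      then show "\<exists>b. compose (carrier F) h k [(i, b)] = (\<lambda>w\<in>carrier F. w) [(i, b)]"
        using i by (intro exI [of _ b]) (simp add: compose_def)
    qed auto
    then show ?thesis using w by (metis compose_eq restrict_apply')
  qed
  have "bij_betw h (carrier F) (carrier F)"
    by (rule bij_betwI [where g = k])
      (use * [OF _ h(1) k(1) hk] * [OF _ k(1) h(1) kh] h(1) k(1) in \<open>auto simp: hom_def\<close>)
  then show ?thesis using h by (simp add: auto_def Bij_def)
qed

definition subst :: "('a \<Rightarrow> 'a letter list) \<Rightarrow> 'a letter list \<Rightarrow> 'a letter list"
  where "subst f = restrict (eval_word F f) (carrier F)"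

lemma subst_hom:
  assumes "f \<in> A \<rightarrow> carrier F"
  shows "subst f \<in> hom F F" "subst f \<in> extensional (carrier F)"
  using F.hom_restrict [OF F.eval_word_hom [OF assms]] by (auto simp: subst_def)

lemma subst_letter:
  assumes "f \<in> A \<rightarrow> carrier F" "x \<in> L"
  shows "subst f [x] = (if snd x then f (fst x) else inv\<^bsub>F\<^esub> f (fst x))"
  using assms F.eval_letter_closed [OF assms]
  by (auto simp: subst_def eval_word_def) (simp_all add: eval_letter_def)

text \<open>
  The automorphism with \<open>x \<mapsto> x y\<close>. For an inverse letter \<open>x\<close> this multiplies the generator from
  the left by the inverse of \<open>y\<close>.
\<close>
definition transvection :: "'a letter \<Rightarrow> 'a letter \<Rightarrow> 'a letter list \<Rightarrow> 'a letter list"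
  where "transvection x y = subst (\<lambda>i. if i \<noteq> fst x then [(i, True)]
    else if snd x then [x] \<otimes>\<^bsub>F\<^esub> [y] else [inv_letter y] \<otimes>\<^bsub>F\<^esub> [inv_letter x])"

lemma letter_eq: "snd x \<Longrightarrow> (fst x, True) = x" "\<not> snd x \<Longrightarrow> (fst x, True) = inv_letter x"
  by (auto simp: inv_letter_def prod_eq_iff)

lemma
  assumes "x \<in> L" "y \<in> L" "fst x \<noteq> fst y"
  shows transvection_hom: "transvection x y \<in> hom F F"
    and transvection_ext: "transvection x y \<in> extensional (carrier F)"
    and transvection_self: "transvection x y [x] = [x] \<otimes>\<^bsub>F\<^esub> [y]"
    and transvection_other: "z \<in> L \<Longrightarrow> fst z \<noteq> fst x \<Longrightarrow> transvection x y [z] = [z]"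
proof -
  have f: "(\<lambda>i. if i \<noteq> fst x then [(i, True)] else if snd x then [x] \<otimes>\<^bsub>F\<^esub> [y]
     else [inv_letter y] \<otimes>\<^bsub>F\<^esub> [inv_letter x]) \<in> A \<rightarrow> carrier F"
    using assms by (intro Pi_I) (simp_all split: if_splits)
  show "transvection x y \<in> hom F F" "transvection x y \<in> extensional (carrier F)"
    unfolding transvection_def using subst_hom [OF f] by auto
  show "transvection x y [x] = [x] \<otimes>\<^bsub>F\<^esub> [y]"
    unfolding transvection_def subst_letter [OF f assms(1)] using assms
    by (simp add: F.inv_mult_group inv_singleton)
  show "transvection x y [z] = [z]" if "z \<in> L" "fst z \<noteq> fst x"
    unfolding transvection_def subst_letter [OF f that(1)] using that
    by (auto simp: inv_singleton letter_eq)
qed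

lemma transvection_inverse:
  assumes "x \<in> L" "y \<in> L" "fst x \<noteq> fst y" "i \<in> A"
  shows "\<exists>b. transvection x y (transvection x (inv_letter y) [(i, b)]) = [(i, b)]"
proof (cases "i = fst x")
  case True
  interpret h: group_hom F F "transvection x y"
    using transvection_hom [OF assms(1-3)] by unfold_locales
  have "transvection x y (transvection x (inv_letter y) [x]) = [x]"
    using assms
    by (simp add: transvection_self transvection_other F.m_assoc flip: inv_singleton)
  then show ?thesis using True by (metis prod.collapse)
next
  case False
  then show ?thesis using assms by (simp add: transvection_other)
qed

lemma transvection_auto:
  assumes "x \<in> L" "y \<in> L" "fst x \<noteq> fst y"
  shows "transvection x y \<in> auto F"
  using assms transvection_inverse [of x y] transvection_inverse [of x "inv_letter y"]
  by (intro hom_inv_pair_auto [where k = "transvection x (inv_letter y)"] transvection_hom transvection_ext)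
    auto

definition signed_perms :: "('a letter \<Rightarrow> 'a letter) set"
  where "signed_perms = {w. w permutes L \<and> (\<forall>x. w (inv_letter x) = inv_letter (w x))}"

definition relabel :: "('a letter \<Rightarrow> 'a letter) \<Rightarrow> 'a letter list \<Rightarrow> 'a letter list"
  where "relabel w = subst (\<lambda>i. [w (i, True)])"

lemma signed_permsD:
  assumes "w \<in> signed_perms"
  shows "w permutes L" "w (inv_letter x) = inv_letter (w x)" "x \<in> L \<Longrightarrow> w x \<in> L"
    "fst x = fst y \<Longrightarrow> fst (w x) = fst (w y)" "fst (w x) = fst (w y) \<longleftrightarrow> fst x = fst y"
    "w x = w y \<longleftrightarrow> x = y"
proof -
  show *: "w permutes L" "\<And>x. w (inv_letter x) = inv_letter (w x)"
    using assms by (auto simp: signed_perms_def)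
  show "x \<in> L \<Longrightarrow> w x \<in> L" by (rule permutes_in_image [OF *(1), THEN iffD2])
  show **: "w x = w y \<longleftrightarrow> x = y" for x y
    using permutes_inj [OF *(1)] by (simp add: inj_eq)
  show ***: "fst (w x) = fst (w y)" if "fst x = fst y" for x y
    using fst_eq_cases [OF that] *(2) fst_inv_letter by metis
  show "fst (w x) = fst (w y) \<longleftrightarrow> fst x = fst y"
    using fst_eq_cases [of "w x" "w y"] ** *** *(2) fst_inv_letter by metis
qed

lemma
  assumes "w \<in> signed_perms"
  shows relabel_hom: "relabel w \<in> hom F F"
    and relabel_ext: "relabel w \<in> extensional (carrier F)"
    and relabel_letter: "x \<in> L \<Longrightarrow> relabel w [x] = [w x]"
proof -
  have f: "(\<lambda>i. [w (i, True)]) \<in> A \<rightarrow> carrier F"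
    using signed_permsD(3) [OF assms] by (intro Pi_I letter_closed) auto
  show "relabel w \<in> hom F F" "relabel w \<in> extensional (carrier F)"
    unfolding relabel_def using subst_hom [OF f] by auto
  assume x: "x \<in> L"
  show "relabel w [x] = [w x]"
    unfolding relabel_def subst_letter [OF f x]
    using x signed_permsD(2,3) [OF assms] by (auto simp: letter_eq inv_singleton)
qed

lemma signed_perms_comp: "v \<in> signed_perms \<Longrightarrow> w \<in> signed_perms \<Longrightarrow> v \<circ> w \<in> signed_perms"
  by (simp add: signed_perms_def permutes_compose del: split_paired_All)

lemma signed_perms_inv: "w \<in> signed_perms \<Longrightarrow> Hilbert_Choice.inv w \<in> signed_perms"
  unfolding signed_perms_def
proof safe
  fix x assume w: "w permutes L" "\<forall>x. w (inv_letter x) = inv_letter (w x)"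
  show "Hilbert_Choice.inv w permutes L" by (rule permutes_inv [OF w(1)])
  have "w (inv_letter (Hilbert_Choice.inv w x)) = inv_letter x"
    using w(2) permutes_inverses(1) [OF w(1), of x] by metis
  then show "Hilbert_Choice.inv w (inv_letter x) = inv_letter (Hilbert_Choice.inv w x)"
    using permutes_inv_eq [OF w(1)] by metis
qed

lemma relabel_auto:
  assumes w: "w \<in> signed_perms"
  shows "relabel w \<in> auto F"
proof (rule hom_inv_pair_auto)
  show "relabel (Hilbert_Choice.inv w) \<in> hom F F"
    "relabel (Hilbert_Choice.inv w) \<in> extensional (carrier F)"
    using signed_perms_inv [OF w] by (simp_all add: relabel_hom relabel_ext)
  fix i assume "i \<in> A"
  then have i: "(i, True) \<in> L" by simp
  show "\<exists>b. relabel w (relabel (Hilbert_Choice.inv w) [(i, b)]) = [(i, b)]"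
    "\<exists>b. relabel (Hilbert_Choice.inv w) (relabel w [(i, b)]) = [(i, b)]"
    using relabel_letter [OF w] relabel_letter [OF signed_perms_inv [OF w]] i
      signed_permsD(3) [OF w i] signed_permsD(3) [OF signed_perms_inv [OF w] i]
      permutes_inverses [OF signed_permsD(1) [OF w]]
    by (intro exI [of _ True]; simp)+
qed (use w in \<open>simp_all add: relabel_hom relabel_ext\<close>)

section \<open>Relations between the generators\<close>
lemma relabel_comp:
  "v \<in> signed_perms \<Longrightarrow> w \<in> signed_perms \<Longrightarrow> relabel (v \<circ> w) = relabel v \<otimes>\<^bsub>AF\<^esub> relabel w"
  by (rule auto_eqI)
    (auto simp: relabel_auto AF_mult_closed signed_perms_comp AF_eval relabel_letter signed_permsD(3))

lemma transvection_inv_mult: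
  assumes "x \<in> L" "y \<in> L" "fst x \<noteq> fst y"
  shows "transvection x y \<otimes>\<^bsub>AF\<^esub> transvection x (inv_letter y) = \<one>\<^bsub>AF\<^esub>"
  using assms transvection_inverse [OF assms]
  by (intro auto_eqI) (auto simp: transvection_auto AF_mult_closed AF_one_closed AF_eval AF_one)

lemma relabel_transvection:
  assumes w: "w \<in> signed_perms" and xy: "x \<in> L" "y \<in> L" "fst x \<noteq> fst y"
  shows "relabel w \<otimes>\<^bsub>AF\<^esub> transvection x y = transvection (w x) (w y) \<otimes>\<^bsub>AF\<^esub> relabel w"
proof (rule auto_eqI)
  have w': "w x \<in> L" "w y \<in> L" "fst (w x) \<noteq> fst (w y)"
    using assms signed_permsD [OF w] by auto
  show "relabel w \<otimes>\<^bsub>AF\<^esub> transvection x y \<in> auto F"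
    "transvection (w x) (w y) \<otimes>\<^bsub>AF\<^esub> relabel w \<in> auto F"
    using assms w' by (simp_all add: AF_mult_closed transvection_auto relabel_auto)
  fix i assume i: "i \<in> A"
  show "\<exists>b. (relabel w \<otimes>\<^bsub>AF\<^esub> transvection x y) [(i, b)] = (transvection (w x) (w y) \<otimes>\<^bsub>AF\<^esub> relabel w) [(i, b)]"
  proof (cases "i = fst x")
    case True
    have "(relabel w \<otimes>\<^bsub>AF\<^esub> transvection x y) [x] = (transvection (w x) (w y) \<otimes>\<^bsub>AF\<^esub> relabel w) [x]"
      using assms w' by (simp add: AF_eval transvection_auto relabel_auto transvection_self
          relabel_letter auto_mult [OF relabel_auto])
    then show ?thesis using True by (metis prod.collapse)
  next
    case False
    have *: "(i, True) \<in> L" using i by simp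
    moreover have "fst (w (i, True)) \<noteq> fst (w x)"
      using False signed_permsD(5) [OF w, of "(i, True)" x] by simp
    ultimately show ?thesis
      using False assms w' signed_permsD(3) [OF w *]
      by (intro exI [of _ True]) (simp add: AF_eval transvection_auto relabel_auto transvection_other
          relabel_letter)
  qed
qed

text \<open>
  The case \<open>z = inv_letter x\<close> is included: left and right multiplications of the same generator commute.
\<close>
lemma transvection_commute:
  assumes "x \<in> L" "y \<in> L" "z \<in> L" "u \<in> L" "fst x \<noteq> fst y" "fst z \<noteq> fst u"
    and "z \<noteq> x" "fst z \<noteq> fst y" "fst u \<noteq> fst x"
  shows "transvection x y \<otimes>\<^bsub>AF\<^esub> transvection z u = transvection z u \<otimes>\<^bsub>AF\<^esub> transvection x y"
proof (rule auto_eqI)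
  fix i assume i: "i \<in> A"
  have *: "(transvection x y \<otimes>\<^bsub>AF\<^esub> transvection z u) [a] = (transvection z u \<otimes>\<^bsub>AF\<^esub> transvection x y) [a]"
    if a: "a = x \<or> a = z \<or> a \<in> L \<and> fst a \<noteq> fst x \<and> fst a \<noteq> fst z" for a
  proof -
    have inv: "transvection x y [inv_letter x] = [inv_letter y] \<otimes>\<^bsub>F\<^esub> [inv_letter x]"
      using assms auto_inv [OF transvection_auto [of x y], of "[x]"]
      by (simp add: transvection_self F.inv_mult_group inv_singleton)
    have inv': "transvection z u [inv_letter z] = [inv_letter u] \<otimes>\<^bsub>F\<^esub> [inv_letter z]"
      using assms auto_inv [OF transvection_auto [of z u], of "[z]"]
      by (simp add: transvection_self F.inv_mult_group inv_singleton)
    show ?thesis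
    proof (cases "fst x = fst z")
      case True
      then have x: "x = inv_letter z" using fst_eq_cases \<open>z \<noteq> x\<close> by metis
      then have z: "z = inv_letter x" by simp
      have 1: "(transvection x y \<otimes>\<^bsub>AF\<^esub> transvection z u) [x] = (transvection z u \<otimes>\<^bsub>AF\<^esub> transvection x y) [x]"
        using assms inv' unfolding x
        by (auto simp: AF_eval transvection_auto transvection_self transvection_other F.m_assoc
          auto_mult [OF transvection_auto] simp flip: x)
      have 2: "(transvection x y \<otimes>\<^bsub>AF\<^esub> transvection z u) [z] = (transvection z u \<otimes>\<^bsub>AF\<^esub> transvection x y) [z]"
        using assms inv unfolding z
        by (auto simp: AF_eval transvection_auto transvection_self transvection_other F.m_assoc
          auto_mult [OF transvection_auto] simp flip: z)
      have 3: "a \<in> L \<and> fst a \<noteq> fst x \<and> fst a \<noteq> fst z \<Longrightarrow> ?thesis"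
        using assms by (simp add: AF_eval transvection_auto transvection_other)
      show ?thesis using a 1 2 3 by blast
    next
      case False
      then show ?thesis using a assms
        by (auto simp: AF_eval transvection_auto transvection_self transvection_other
          auto_mult [OF transvection_auto])
    qed
  qed
  show "\<exists>b. (transvection x y \<otimes>\<^bsub>AF\<^esub> transvection z u) [(i, b)]
    = (transvection z u \<otimes>\<^bsub>AF\<^esub> transvection x y) [(i, b)]"
    by (rule ex_letterI [of "if i = fst x then x else if i = fst z then z else (i, True)"])
      (use i in \<open>auto intro!: * split: if_splits\<close>)
qed (use assms in \<open>simp_all add: AF_mult_closed transvection_auto\<close>)

text \<open>
  Both sides send \<open>x\<close> to \<open>x y z\<close>. As \<open>T y z\<close> and \<open>T x z\<close> commute, this is the Steinberg relation
  expressing \<open>T x z\<close> as a commutator of \<open>T x y\<close> and \<open>T y z\<close>.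
\<close>
lemma transvection_commutator:
  assumes "x \<in> L" "y \<in> L" "z \<in> L" "fst x \<noteq> fst y" "fst y \<noteq> fst z" "fst x \<noteq> fst z"
  shows "transvection y z \<otimes>\<^bsub>AF\<^esub> transvection x y
    = transvection x y \<otimes>\<^bsub>AF\<^esub> (transvection y z \<otimes>\<^bsub>AF\<^esub> transvection x z)"
proof (rule auto_eqI)
  fix i assume i: "i \<in> A"
  have *: "(transvection y z \<otimes>\<^bsub>AF\<^esub> transvection x y) [a]
    = (transvection x y \<otimes>\<^bsub>AF\<^esub> (transvection y z \<otimes>\<^bsub>AF\<^esub> transvection x z)) [a]"
    if a: "a = x \<or> a = y \<or> a \<in> L \<and> fst a \<noteq> fst x \<and> fst a \<noteq> fst y" for a
    using assms a by (auto simp: AF_eval AF_mult_closed transvection_auto transvection_self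
        transvection_other auto_mult [OF transvection_auto] F.m_assoc)
  show "\<exists>b. (transvection y z \<otimes>\<^bsub>AF\<^esub> transvection x y) [(i, b)]
    = (transvection x y \<otimes>\<^bsub>AF\<^esub> (transvection y z \<otimes>\<^bsub>AF\<^esub> transvection x z)) [(i, b)]"
    by (rule ex_letterI [of "if i = fst x then x else if i = fst y then y else (i, True)"])
      (use i in \<open>auto intro!: * split: if_splits\<close>)
qed (use assms in \<open>simp_all add: AF_mult_closed transvection_auto\<close>)

definition letter_swap :: "'a letter \<Rightarrow> 'a letter \<Rightarrow> 'a letter \<Rightarrow> 'a letter"
  where "letter_swap x y a = (if a = x then y else if a = inv_letter x then inv_letter y
    else if a = y then x else if a = inv_letter y then inv_letter x else a)"

text \<open>
  Exchanging \<open>x\<close> with its own inverse is included as the sign change of a generator.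
\<close>
lemma letter_swap_swap [simp]: "letter_swap x y (letter_swap x y a) = a"
  by (auto simp: letter_swap_def)

lemma letter_swap_inv: "letter_swap x y (inv_letter a) = inv_letter (letter_swap x y a)"
proof -
  have "inv_letter a = inv_letter b \<longleftrightarrow> a = b" "inv_letter a = b \<longleftrightarrow> a = inv_letter b" for b :: "'a letter"
    by (metis inv_letter_inv_letter)+
  then show ?thesis by (simp add: letter_swap_def)
qed

lemma letter_swap_signed:
  assumes "x \<in> L" "y \<in> L"
  shows "letter_swap x y \<in> signed_perms"
proof -
  have "bij (letter_swap x y)"
    by (rule involuntory_imp_bij) simp
  moreover have "letter_swap x y a = a" if "a \<notin> L" for a
    using that assms by (auto simp: letter_swap_def)
  ultimately show ?thesis
    by (simp add: signed_perms_def letter_swap_inv permutes_def bij_iff del: split_paired_All)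
qed

text \<open>
  Both sides send \<open>x\<close> to \<open>y\<close> and \<open>y\<close> to the inverse of \<open>x\<close>. This is how transvections control the
  signed permutations; the square of this automorphism changes the signs of two generators.
\<close>
lemma weyl_relation:
  assumes "x \<in> L" "y \<in> L" "fst x \<noteq> fst y"
  shows "relabel (letter_swap x y \<circ> letter_swap y (inv_letter y))
    = transvection x y \<otimes>\<^bsub>AF\<^esub> (transvection y (inv_letter x) \<otimes>\<^bsub>AF\<^esub> transvection (inv_letter x) (inv_letter y))"
    (is "_ = ?r")
proof -
  define w where "w = letter_swap x y \<circ> letter_swap y (inv_letter y)"
  have w: "w \<in> signed_perms"
    unfolding w_def using assms by (intro signed_perms_comp letter_swap_signed) auto
  have "relabel w = ?r"
  proof (rule auto_eqI)
    show "relabel w \<in> auto F" by (rule relabel_auto [OF w])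
    fix i assume i: "i \<in> A"
    have xy: "x \<noteq> y" "x \<noteq> inv_letter y" "inv_letter x \<noteq> y" "inv_letter x \<noteq> inv_letter y"
      using assms(3) by (metis fst_inv_letter)+
    have 0: "transvection x y [inv_letter x] = [inv_letter y] \<otimes>\<^bsub>F\<^esub> [inv_letter x]"
      using assms auto_inv [OF transvection_auto [of x y], of "[x]"]
        by (simp add: transvection_self F.inv_mult_group inv_singleton)
    have 1: "transvection y (inv_letter x) [inv_letter y] = [x] \<otimes>\<^bsub>F\<^esub> [inv_letter y]"
      using assms auto_inv [OF transvection_auto [of y "inv_letter x"], of "[y]"]
        by (simp add: transvection_self F.inv_mult_group inv_singleton)
    have inv: "[inv_letter x] = inv\<^bsub>F\<^esub> [x]" "[inv_letter y] = inv\<^bsub>F\<^esub> [y]"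
      using assms by (simp_all add: inv_singleton)
    have X1: "relabel w [inv_letter x] = ?r [inv_letter x]"
    proof -
      have "w (inv_letter x) = inv_letter y"
        using xy by (auto simp: w_def letter_swap_def)
      moreover have "?r [inv_letter x] = [inv_letter y]"
      proof -
        have "?r [inv_letter x] = transvection x y ([inv_letter x] \<otimes>\<^bsub>F\<^esub> ([x] \<otimes>\<^bsub>F\<^esub> [inv_letter y]))"
          using assms by (simp add: AF_eval AF_mult_closed transvection_auto transvection_self 1
            transvection_other auto_mult [OF transvection_auto])
        also have "[inv_letter x] \<otimes>\<^bsub>F\<^esub> ([x] \<otimes>\<^bsub>F\<^esub> [inv_letter y]) = [inv_letter y]"
          using assms by (simp add: inv(1) F.m_assoc [symmetric])
        finally show ?thesis using assms by (simp add: transvection_other)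
      qed
      ultimately show ?thesis using assms relabel_letter [OF w] by simp
    qed
    have X2: "relabel w [y] = ?r [y]"
    proof -
      have "w y = inv_letter x"
        using xy by (auto simp: w_def letter_swap_def)
      moreover have "?r [y] = [inv_letter x]"
      proof -
        have "?r [y] = [y] \<otimes>\<^bsub>F\<^esub> ([inv_letter y] \<otimes>\<^bsub>F\<^esub> [inv_letter x])"
          using assms by (simp add: AF_eval AF_mult_closed transvection_auto transvection_self 0
            transvection_other auto_mult [OF transvection_auto])
        also have "\<dots> = [inv_letter x]"
          using assms by (simp add: inv(2) F.m_assoc [symmetric])
        finally show ?thesis .
      qed
      ultimately show ?thesis using assms relabel_letter [OF w] by simp
    qed
    have Z: "relabel w [z] = ?r [z]" if "z \<in> L" "fst z \<noteq> fst x" "fst z \<noteq> fst y" for z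
    proof -
      have "w z = z" using that by (auto simp: w_def letter_swap_def)
      then show ?thesis using assms that relabel_letter [OF w]
        by (simp add: AF_eval AF_mult_closed transvection_auto transvection_other)
    qed
    show "\<exists>b. relabel w [(i, b)] = ?r [(i, b)]"
      by (rule ex_letterI [of "if i = fst x then inv_letter x else if i = fst y then y else (i, True)"])
        (use i X1 X2 Z [of "(i, True)"] in \<open>auto split: if_splits\<close>)
  qed (use assms in \<open>simp_all add: AF_mult_closed transvection_auto\<close>)
  then show ?thesis by (simp only: w_def)
qed

end

section \<open>Generation by transvections and signed permutations\<close>
locale finite_free_automorphisms = free_automorphisms +
  assumes finite_A: "finite A"
begin

text \<open>
  Words are compared as numerals, the first letter being the most significant digit. The base exceeds
  the number of letters by one so that it is positive for an empty generating set too.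
\<close>
definition base :: nat where "base = Suc (card L)"

fun num :: "'a letter list \<Rightarrow> nat" where
  "num [] = 0"
| "num (x # w) = to_nat_on L x * base ^ length w + num w"

lemma num_append: "num (p @ r) = num p * base ^ length r + num r"
  by (induction p) (simp_all add: algebra_simps power_add)

lemma digit_less: "x \<in> L \<Longrightarrow> to_nat_on L x < card L"
  using to_nat_on_finite [of L] finite_A by (auto simp: bij_betw_def)

lemma num_bound: "set w \<subseteq> L \<Longrightarrow> num w < base ^ length w"
proof (induction w)
  case (Cons x w)
  then have "num (x # w) < to_nat_on L x * base ^ length w + base ^ length w" by simp
  also have "\<dots> = (to_nat_on L x + 1) * base ^ length w" by simp
  also have "\<dots> \<le> base * base ^ length w"
    using digit_less [of x] Cons.prems by (intro mult_right_mono) (simp_all add: base_def)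
  finally show ?case by simp
qed simp

lemma num_inj:
  "length v = length w \<Longrightarrow> set v \<subseteq> L \<Longrightarrow> set w \<subseteq> L \<Longrightarrow> num v = num w \<Longrightarrow> v = w"
proof (induction v w rule: list_induct2)
  case (Cons x v y w)
  let ?k = "base ^ length w"
  have "num v < ?k" "num w < ?k"
    using num_bound [of v] num_bound [of w] Cons by auto
  moreover have eq: "to_nat_on L x * ?k + num v = to_nat_on L y * ?k + num w"
    using Cons by simp
  ultimately have "to_nat_on L x = to_nat_on L y"
    by (metis div_mult_self3 div_less add.right_neutral less_nat_zero_code)
  moreover have "inj_on (to_nat_on L) L"
    using to_nat_on_finite [of L] finite_A by (auto simp: bij_betw_def)
  ultimately show ?case using Cons eq by (auto dest: inj_onD)
qed simp

definition half :: "'a letter list \<Rightarrow> 'a letter list"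
  where "half w = take ((length w + 1) div 2) w"

text \<open>
  The tie-breaker in Nielsen's method: at equal length, it decreases when the first half of a
  word or the first half of its inverse is replaced by a smaller one.
\<close>
definition weight :: "'a letter list \<Rightarrow> nat"
  where "weight w = num (half w) + num (half (word_inv w))"

lemma weight_word_inv [simp]: "weight (word_inv w) = weight w"
  by (simp add: weight_def)

text \<open>
  Since \<open>q\<close> is at most half of the word, exchanging it for \<open>p\<close> leaves the first half of the inverse
  word unchanged.
\<close>
lemma weight_less:
  assumes "length p = length q" "2 * length q \<le> length (q @ b)" "num p < num q"
  shows "weight (p @ b) < weight (q @ b)"
proof -
  let ?k = "(length (q @ b) + 1) div 2"
  have "half (r @ b) = r @ take (?k - length q) b" "half (word_inv (r @ b)) = take ?k (word_inv b)"
    if "length r = length q" for r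
    using assms(1,2) that by (auto simp: half_def word_inv_append add.commute)
  then show ?thesis
    using assms(1,3) by (simp add: weight_def num_append base_def)
qed

lemma auto_letter_inv: "\<alpha> \<in> auto F \<Longrightarrow> x \<in> L \<Longrightarrow> \<alpha> [inv_letter x] = word_inv (\<alpha> [x])"
  using auto_inv [of \<alpha> "[x]"] auto_closed [of \<alpha> "[x]"] by (simp add: inv_F)

lemma auto_prod_inv:
  assumes \<alpha>: "\<alpha> \<in> auto F" and xy: "x \<in> L" "y \<in> L"
  shows "\<alpha> [inv_letter y] \<otimes>\<^bsub>F\<^esub> \<alpha> [inv_letter x] = word_inv (\<alpha> [x] \<otimes>\<^bsub>F\<^esub> \<alpha> [y])"
proof -
  have c: "\<alpha> [x] \<in> carrier F" "\<alpha> [y] \<in> carrier F"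
    using assms by (simp_all add: auto_closed)
  have "word_inv (\<alpha> [x] \<otimes>\<^bsub>F\<^esub> \<alpha> [y]) = inv\<^bsub>F\<^esub> (\<alpha> [x] \<otimes>\<^bsub>F\<^esub> \<alpha> [y])"
    using c by (simp add: inv_F)
  also have "\<dots> = inv\<^bsub>F\<^esub> (\<alpha> [y]) \<otimes>\<^bsub>F\<^esub> inv\<^bsub>F\<^esub> (\<alpha> [x])"
    using c by (simp add: F.inv_mult_group)
  finally show ?thesis using c xy by (simp add: inv_F auto_letter_inv [OF \<alpha>])
qed

lemma auto_letter_sym:
  assumes "\<alpha> \<in> auto F" "x \<in> L" "y \<in> L" "fst x = fst y"
  shows "length (\<alpha> [x]) = length (\<alpha> [y])" "weight (\<alpha> [x]) = weight (\<alpha> [y])"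
  using fst_eq_cases [OF assms(4)] assms by (auto simp: auto_letter_inv)

definition cost :: "('a letter list \<Rightarrow> 'a letter list) \<Rightarrow> nat \<times> nat"
  where "cost \<alpha> = (\<Sum>i\<in>A. length (\<alpha> [(i, True)]), \<Sum>i\<in>A. weight (\<alpha> [(i, True)]))"

text \<open>
  Replacing the image of \<open>x\<close> by its product with the image of \<open>y\<close> decreases the cost.
\<close>
definition shortens :: "('a letter list \<Rightarrow> 'a letter list) \<Rightarrow> 'a letter \<Rightarrow> 'a letter \<Rightarrow> bool"
  where "shortens \<alpha> x y \<longleftrightarrow> (let v = \<alpha> [x] \<otimes>\<^bsub>F\<^esub> \<alpha> [y] in length v < length (\<alpha> [x])
    \<or> length v = length (\<alpha> [x]) \<and> weight v < weight (\<alpha> [x]))"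

lemma cost_transvection:
  assumes \<alpha>: "\<alpha> \<in> auto F" and xy: "x \<in> L" "y \<in> L" "fst x \<noteq> fst y" and s: "shortens \<alpha> x y"
  shows "(cost (\<alpha> \<otimes>\<^bsub>AF\<^esub> transvection x y), cost \<alpha>) \<in> less_than <*lex*> less_than"
proof -
  let ?\<beta> = "\<alpha> \<otimes>\<^bsub>AF\<^esub> transvection x y"
  let ?v = "\<alpha> [x] \<otimes>\<^bsub>F\<^esub> \<alpha> [y]"
  let ?i = "fst x"
  have \<beta>: "?\<beta> \<in> auto F" using \<alpha> xy by (simp add: AF_mult_closed transvection_auto)
  have i: "?i \<in> A" "(?i, True) \<in> L" using xy by auto
  have eq: "?\<beta> [(j, True)] = \<alpha> [(j, True)]" if "j \<in> A - {?i}" for j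
    using that \<alpha> xy by (simp add: AF_eval transvection_auto transvection_other)
  have "?\<beta> [x] = ?v"
    using \<alpha> xy by (simp add: AF_eval transvection_auto transvection_self auto_mult)
  then have \<beta>i: "length (?\<beta> [(?i, True)]) = length ?v" "weight (?\<beta> [(?i, True)]) = weight ?v"
    using auto_letter_sym [OF \<beta> i(2) xy(1)] by simp_all
  have \<alpha>i: "length (\<alpha> [(?i, True)]) = length (\<alpha> [x])" "weight (\<alpha> [(?i, True)]) = weight (\<alpha> [x])"
    using auto_letter_sym [OF \<alpha> i(2) xy(1)] by simp_all
  have "(\<Sum>j\<in>A - {?i}. length (?\<beta> [(j, True)])) = (\<Sum>j\<in>A - {?i}. length (\<alpha> [(j, True)]))"
    "(\<Sum>j\<in>A - {?i}. weight (?\<beta> [(j, True)])) = (\<Sum>j\<in>A - {?i}. weight (\<alpha> [(j, True)]))"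
    using eq by (auto intro: sum.cong)
  then show ?thesis
    using s unfolding cost_def shortens_def Let_def sum.remove [OF finite_A i(1)]
    by (auto simp: \<alpha>i \<beta>i)
qed

definition minimal :: "('a letter list \<Rightarrow> 'a letter list) \<Rightarrow> bool"
  where "minimal \<alpha> \<longleftrightarrow> \<alpha> \<in> auto F \<and> (\<forall>x\<in>L. \<forall>y\<in>L. fst x \<noteq> fst y \<longrightarrow> \<not> shortens \<alpha> x y)"

text \<open>
  The second inequality is the first for the inverse letters, as lengths are invariant under inversion.
\<close>
lemma minimal_length:
  assumes "minimal \<alpha>" "x \<in> L" "y \<in> L" "fst x \<noteq> fst y"
  shows "length (\<alpha> [x]) \<le> length (\<alpha> [x] \<otimes>\<^bsub>F\<^esub> \<alpha> [y])"
    "length (\<alpha> [y]) \<le> length (\<alpha> [x] \<otimes>\<^bsub>F\<^esub> \<alpha> [y])"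
proof -
  have *: "length (\<alpha> [x]) \<le> length (\<alpha> [x] \<otimes>\<^bsub>F\<^esub> \<alpha> [y])"
    if "x \<in> L" "y \<in> L" "fst x \<noteq> fst y" for x y
    using assms(1) that unfolding minimal_def shortens_def Let_def by (meson not_le_imp_less)
  show "length (\<alpha> [x]) \<le> length (\<alpha> [x] \<otimes>\<^bsub>F\<^esub> \<alpha> [y])" by (rule * [OF assms(2-4)])
  have \<alpha>: "\<alpha> \<in> auto F" using assms by (simp add: minimal_def)
  show "length (\<alpha> [y]) \<le> length (\<alpha> [x] \<otimes>\<^bsub>F\<^esub> \<alpha> [y])"
    using * [of "inv_letter y" "inv_letter x"] assms
    by (simp add: auto_prod_inv [OF \<alpha>]) (simp add: auto_letter_inv [OF \<alpha>])
qed

lemma auto_letter_reduced: "\<alpha> \<in> auto F \<Longrightarrow> x \<in> L \<Longrightarrow> reduced (\<alpha> [x]) \<and> set (\<alpha> [x]) \<subseteq> L"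
  using auto_closed letter_closed carrier_F by metis

lemma auto_letter_nonempty:
  assumes "\<alpha> \<in> auto F" "x \<in> L"
  shows "\<alpha> [x] \<noteq> []"
proof
  assume "\<alpha> [x] = []"
  then have "\<alpha> [x] = \<alpha> []"
    using group_hom.hom_one [OF auto_group_hom [OF assms(1)]] by (simp add: one_F)
  moreover have "[] \<in> carrier F" by (simp add: carrier_F)
  ultimately show False
    using inj_onD [OF autoD(3) [OF assms(1)]] assms(2) letter_closed by blast
qed

lemma minimal_cancel:
  assumes "minimal \<alpha>" "x \<in> L" "y \<in> L" "y \<noteq> inv_letter x"
  shows "2 * cancel (\<alpha> [x]) (\<alpha> [y]) \<le> length (\<alpha> [x])" "2 * cancel (\<alpha> [x]) (\<alpha> [y]) \<le> length (\<alpha> [y])"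
proof -
  have \<alpha>: "\<alpha> \<in> auto F" using assms by (simp add: minimal_def)
  have "2 * cancel (\<alpha> [x]) (\<alpha> [y]) \<le> length (\<alpha> [x]) \<and> 2 * cancel (\<alpha> [x]) (\<alpha> [y]) \<le> length (\<alpha> [y])"
  proof (cases "fst x = fst y")
    case True
    then have "x = y" using fst_eq_cases assms(4) by (metis inv_letter_inv_letter)
    then show ?thesis
      using cancel_self [of "\<alpha> [x]"] auto_letter_reduced [OF \<alpha>] auto_letter_nonempty [OF \<alpha>] assms
      by (simp add: order_less_imp_le)
  next
    case False
    then show ?thesis
      using minimal_length [OF assms(1-3) False] auto_letter_reduced [OF \<alpha>] assms(2,3)
        length_mult_cancel [of "\<alpha> [x]" "\<alpha> [y]"] by (simp add: mult_F)
  qed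
  then show "2 * cancel (\<alpha> [x]) (\<alpha> [y]) \<le> length (\<alpha> [x])" "2 * cancel (\<alpha> [x]) (\<alpha> [y]) \<le> length (\<alpha> [y])"
    by auto
qed

text \<open>
  If \<open>p\<close> were smaller than \<open>q\<close>, multiplying \<open>q b\<close> from the left by \<open>p\<close> times the inverse of \<open>q\<close> would
  replace its beginning by a smaller one without changing the length.
\<close>
lemma minimal_num_le:
  assumes min: "minimal \<alpha>" and mz: "m \<in> L" "z \<in> L" "fst m \<noteq> fst z"
    and m: "\<alpha> [m] = p @ word_inv q" and z: "\<alpha> [z] = q @ b"
    and pq: "length p = length q" and le: "2 * length q \<le> length (\<alpha> [z])"
  shows "num q \<le> num p"
proof (rule ccontr)
  assume "\<not> ?thesis"
  then have less: "num p < num q" by simp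
  have \<alpha>: "\<alpha> \<in> auto F" using min by (simp add: minimal_def)
  have red: "reduced (\<alpha> [m])" "reduced (\<alpha> [z])" using auto_letter_reduced \<alpha> mz by auto
  have "length q \<le> cancel (\<alpha> [m]) (\<alpha> [z])"
  proof -
    have "k \<le> agree (u @ v) (u @ w)" if "k = length u" for k and u v w :: "'a letter list"
      using that by (induction u arbitrary: k) auto
    then show ?thesis by (simp add: cancel_def m z word_inv_append)
  qed
  moreover have "2 * cancel (\<alpha> [m]) (\<alpha> [z]) \<le> 2 * length q"
    using minimal_cancel(1) [OF min mz(1,2)] mz(3) by (force simp: m pq)
  ultimately have "cancel (\<alpha> [m]) (\<alpha> [z]) = length q" by simp
  then have prod: "\<alpha> [m] \<otimes>\<^bsub>F\<^esub> \<alpha> [z] = p @ b"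
    using mult_cancel [OF red] by (simp add: mult_F m z pq)
  have "\<alpha> [inv_letter z] \<otimes>\<^bsub>F\<^esub> \<alpha> [inv_letter m] = word_inv (p @ b)"
    using auto_prod_inv [OF \<alpha> mz(1,2)] by (simp only: prod)
  moreover have "weight (p @ b) < weight (q @ b)"
    using less le pq z by (intro weight_less) auto
  ultimately have "shortens \<alpha> (inv_letter z) (inv_letter m)"
    using mz by (simp add: shortens_def Let_def auto_letter_inv [OF \<alpha>] z pq del: word_inv_word_inv)
  then show False using min mz unfolding minimal_def
    by (metis fst_inv_letter inv_letter_L)
qed

text \<open>
  No letter image in a minimal automorphism is consumed by cancellation with its two neighbours: at most
  half of it cancels on each side, and if exactly half cancelled on both sides, then the image is
  \<open>p\<close> times the inverse of \<open>q\<close>, where \<open>p\<close> starts the inverse of the left neighbour and \<open>q\<close>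
  the right one, and comparing \<open>p\<close> with \<open>q\<close> both ways by
  \<open>minimal_num_le\<close> gives \<open>p = q\<close>.
\<close>
lemma minimal_middle:
  assumes min: "minimal \<alpha>" and L: "x \<in> L" "m \<in> L" "z \<in> L"
    and xm: "m \<noteq> inv_letter x" and mz: "z \<noteq> inv_letter m"
  shows "cancel (\<alpha> [x]) (\<alpha> [m]) + cancel (\<alpha> [m]) (\<alpha> [z]) < length (\<alpha> [m])"
proof (rule ccontr)
  assume "\<not> ?thesis"
  with minimal_cancel [OF min L(1,2) xm] minimal_cancel [OF min L(2,3) mz]
  have eq: "2 * cancel (\<alpha> [x]) (\<alpha> [m]) = length (\<alpha> [m])" "2 * cancel (\<alpha> [m]) (\<alpha> [z]) = length (\<alpha> [m])"
    by simp_all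
  have \<alpha>: "\<alpha> \<in> auto F" using min by (simp add: minimal_def)
  have red: "reduced (\<alpha> [m])" "\<alpha> [m] \<noteq> []" "set (\<alpha> [m]) \<subseteq> L"
    using auto_letter_reduced auto_letter_nonempty \<alpha> L by auto
  have "x \<noteq> m" "z \<noteq> m" using cancel_self [OF red(1,2)] eq by auto
  then have fst: "fst x \<noteq> fst m" "fst m \<noteq> fst z"
    using fst_eq_cases [of x m] fst_eq_cases [of z m] xm mz by auto
  define h where "h = cancel (\<alpha> [m]) (\<alpha> [z])"
  define p where "p = take h (\<alpha> [m])"
  define q where "q = take h (\<alpha> [z])"
  have h: "length (\<alpha> [m]) = 2 * h" "h > 0" "cancel (\<alpha> [x]) (\<alpha> [m]) = h"
    using eq red(2) length_greater_0_conv [of "\<alpha> [m]"] unfolding h_def by linarith+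
  have le: "2 * h \<le> length (\<alpha> [x])" "2 * h \<le> length (\<alpha> [z])"
    using minimal_cancel(1) [OF min L(1,2) xm] minimal_cancel(2) [OF min L(2,3) mz] h
    by (simp_all add: h_def)
  have "q = take h (word_inv (\<alpha> [m]))"
    using take_cancel [of "\<alpha> [m]" "\<alpha> [z]"] by (simp add: q_def h_def)
  also have "\<dots> = word_inv (drop h (\<alpha> [m]))"
    using h by (simp add: word_inv_drop)
  finally have "drop h (\<alpha> [m]) = word_inv q" by simp
  then have m: "\<alpha> [m] = p @ word_inv q"
    using append_take_drop_id [of h "\<alpha> [m]"] by (simp add: p_def)
  have len: "length p = h" "length q = h" using le h by (simp_all add: p_def q_def)
  have z: "\<alpha> [z] = q @ drop h (\<alpha> [z])" by (simp add: q_def)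
  have "p = take h (\<alpha> [inv_letter x])"
    using take_cancel [of "\<alpha> [x]" "\<alpha> [m]"] h(3) by (simp add: p_def auto_letter_inv [OF \<alpha> L(1)])
  then have x: "\<alpha> [inv_letter x] = p @ drop h (\<alpha> [inv_letter x])" by simp
  have "num q \<le> num p"
    using le fst len by (intro minimal_num_le [OF min L(2,3) _ m z]) auto
  moreover have "num p \<le> num q"
  proof (rule minimal_num_le [OF min _ _ _ _ x])
    show "\<alpha> [inv_letter m] = q @ word_inv p"
      by (simp add: auto_letter_inv [OF \<alpha> L(2)] m word_inv_append)
    show "2 * length p \<le> length (\<alpha> [inv_letter x])"
      using le len by (simp add: auto_letter_inv [OF \<alpha> L(1)])
  qed (use fst L len in auto)
  moreover have "set p \<subseteq> L" "set q \<subseteq> L"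
    using set_take_subset [of h "\<alpha> [m]"] set_take_subset [of h "\<alpha> [z]"] red(3)
      auto_letter_reduced [OF \<alpha> L(3)] unfolding p_def q_def by blast+
  ultimately have "p = q" using num_inj [of p q] len by simp
  then have "p ! (h - 1) = inv_letter ((p @ word_inv q) ! h)"
    using h(2) len by (simp add: nth_append word_inv_nth)
  moreover have "(p @ word_inv q) ! (h - 1) = p ! (h - 1)"
    using h(2) len by (simp add: nth_append)
  ultimately show False
    using reduced_nth [OF red(1), of "h - 1"] h len by (simp add: m)
qed

text \<open>
  Each letter of a reduced word contributes at least one letter to the image under a minimal
  automorphism. The induction also provides a common beginning of this image and the image of the first
  letter that is longer than what any preceding letter can cancel.
\<close>
lemma minimal_growth:
  assumes min: "minimal \<alpha>"
  shows "x # r \<in> carrier F \<Longrightarrow> \<exists>k. take k (\<alpha> (x # r)) = take k (\<alpha> [x]) \<and> k \<le> length (\<alpha> [x])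
    \<and> 0 < k \<and> k + length r \<le> length (\<alpha> (x # r))
    \<and> (\<forall>z\<in>L. z \<noteq> inv_letter x \<longrightarrow> cancel (\<alpha> [z]) (\<alpha> [x]) < k)"
proof (induction r arbitrary: x)
  case Nil
  have \<alpha>: "\<alpha> \<in> auto F" using min by (simp add: minimal_def)
  have x: "x \<in> L" using Cons_closed [OF Nil] by simp
  have "cancel (\<alpha> [z]) (\<alpha> [x]) < length (\<alpha> [x])" if "z \<in> L" "z \<noteq> inv_letter x" for z
  proof -
    have "x \<noteq> inv_letter z" using that(2) by auto
    then show ?thesis
      using minimal_cancel(2) [OF min that(1) x] auto_letter_nonempty [OF \<alpha> x]
        length_greater_0_conv [of "\<alpha> [x]"] by linarith
  qed
  then show ?case
    using auto_letter_nonempty [OF \<alpha> x] by (intro exI [of _ "length (\<alpha> [x])"]) simp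
next
  case (Cons y r)
  have \<alpha>: "\<alpha> \<in> auto F" using min by (simp add: minimal_def)
  have x: "x \<in> L" and yr: "y # r \<in> carrier F" using Cons_closed [OF Cons.prems] by simp_all
  have y: "y \<in> L" using Cons_closed [OF yr] by simp
  have xy: "y \<noteq> inv_letter x" "x \<noteq> inv_letter y"
    using Cons.prems by (auto simp: carrier_F reduced_Cons)
  obtain k where k: "take k (\<alpha> (y # r)) = take k (\<alpha> [y])" "k \<le> length (\<alpha> [y])"
    "k + length r \<le> length (\<alpha> (y # r))"
    "\<forall>z\<in>L. z \<noteq> inv_letter y \<longrightarrow> cancel (\<alpha> [z]) (\<alpha> [y]) < k"
    using Cons.IH [OF yr] by blast
  define c where "c = cancel (\<alpha> [x]) (\<alpha> [y])"
  have ck: "c < k" using k(4) x xy unfolding c_def by blast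
  have c: "cancel (\<alpha> [x]) (\<alpha> (y # r)) = c"
    using agree_cong [of "word_inv (\<alpha> [x])" "\<alpha> [y]" k "\<alpha> (y # r)"] ck k
    by (simp add: c_def cancel_def)
  have "reduced (\<alpha> [x])" "reduced (\<alpha> (y # r))"
    using auto_closed [OF \<alpha>] x yr letter_closed carrier_F by blast+
  moreover have "\<alpha> (x # y # r) = \<alpha> [x] \<otimes>\<^bsub>F\<^esub> \<alpha> (y # r)"
    using Cons_mult [OF Cons.prems] auto_mult [OF \<alpha>] x yr by simp
  ultimately have eq: "\<alpha> (x # y # r) = take (length (\<alpha> [x]) - c) (\<alpha> [x]) @ drop c (\<alpha> (y # r))"
    using mult_cancel [of "\<alpha> [x]" "\<alpha> (y # r)"] by (simp add: mult_F c)
  have mid: "cancel (\<alpha> [z]) (\<alpha> [x]) < length (\<alpha> [x]) - c" if "z \<in> L" "z \<noteq> inv_letter x" for z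
  proof -
    have "x \<noteq> inv_letter z" using that(2) by auto
    from minimal_middle [OF min that(1) x y this xy(1)] show ?thesis by (simp add: c_def)
  qed
  have "c < length (\<alpha> [x])"
    using minimal_cancel(1) [OF min x y xy(1)] auto_letter_nonempty [OF \<alpha> x]
    by (cases c) (auto simp: c_def)
  then show ?case
    using mid k(3) ck by (intro exI [of _ "length (\<alpha> [x]) - c"]) (simp add: eq)
qed

text \<open>
  Every letter is the image of a word, which by \<open>minimal_growth\<close> has only one letter. So a minimal
  automorphism permutes the letters.
\<close>
lemma minimal_relabel:
  assumes min: "minimal \<alpha>"
  shows "\<exists>w\<in>signed_perms. \<alpha> = relabel w"
proof -
  have \<alpha>: "\<alpha> \<in> auto F" using min by (simp add: minimal_def)
  have ex: "\<exists>y\<in>L. \<alpha> [y] = [x]" if x: "x \<in> L" for x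
  proof -
    obtain w where w: "w \<in> carrier F" "\<alpha> w = [x]"
      using autoD(4) [OF \<alpha>] letter_closed [OF x] by (metis imageE)
    have "w \<noteq> []"
      using group_hom.hom_one [OF auto_group_hom [OF \<alpha>]] w by (auto simp: one_F)
    then obtain y r where yr: "w = y # r" by (cases w) auto
    obtain k where "0 < k" "k + length r \<le> 1"
      using minimal_growth [OF min, of y r] w yr by auto
    then have "length r = 0" by linarith
    then have "w = [y]" using yr by simp
    moreover have "y \<in> L" using Cons_closed w yr by simp
    ultimately show ?thesis using w by blast
  qed
  then obtain v where v: "\<And>x. x \<in> L \<Longrightarrow> v x \<in> L \<and> \<alpha> [v x] = [x]" by metis
  define w where "w = (\<lambda>x. if x \<in> L then hd (\<alpha> [x]) else x)"
  have "inj_on v L" using v by (metis inj_onI list.inject)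
  moreover have "finite L" using finite_A by simp
  moreover have "v ` L \<subseteq> L" using v by blast
  ultimately have "v ` L = L" by (simp add: endo_inj_surj)
  then have w: "w x \<in> L \<and> \<alpha> [x] = [w x]" if "x \<in> L" for x
    using that v by (auto simp: w_def) (metis (no_types, lifting) imageE list.sel(1) mem_Sigma_iff v)+
  have "inj_on w L"
  proof (rule inj_onI)
    fix x y assume xy: "x \<in> L" "y \<in> L" "w x = w y"
    then have "\<alpha> [x] = \<alpha> [y]" using w by metis
    then show "x = y" using inj_onD [OF autoD(3) [OF \<alpha>]] xy letter_closed by blast
  qed
  moreover have "w ` L \<subseteq> L" using w by blast
  ultimately have "bij_betw w L L" using \<open>finite L\<close> by (simp add: bij_betw_def endo_inj_surj)
  then have "w permutes L" by (rule bij_imp_permutes) (simp add: w_def)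
  moreover have "w (inv_letter x) = inv_letter (w x)" for x
  proof (cases "x \<in> L")
    case True
    then have "[w (inv_letter x)] = word_inv [w x]"
      using w [of x] w [of "inv_letter x"] auto_letter_inv [OF \<alpha> True] by simp
    then show ?thesis by simp
  next
    case False
    then show ?thesis using inv_letter_L by (simp add: w_def del: mem_Sigma_iff)
  qed
  ultimately have w': "w \<in> signed_perms" by (simp add: signed_perms_def del: split_paired_All)
  moreover have "\<alpha> = relabel w"
    by (rule auto_eqI [OF \<alpha> relabel_auto [OF w']]) (use w relabel_letter [OF w'] in auto)
  ultimately show ?thesis by blast
qed

text \<open>
  Nielsen's theorem as an induction rule: while the automorphism is not minimal, composing it with some
  transvection decreases its cost.
\<close>
theorem nielsen_induct [consumes 1, case_names relabel transvection]:
  assumes "\<alpha> \<in> auto F"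
    and relabel: "\<And>w. w \<in> signed_perms \<Longrightarrow> P (relabel w)"
    and transv: "\<And>\<beta> x y. \<beta> \<in> auto F \<Longrightarrow> x \<in> L \<Longrightarrow> y \<in> L \<Longrightarrow> fst x \<noteq> fst y \<Longrightarrow> P \<beta>
      \<Longrightarrow> P (\<beta> \<otimes>\<^bsub>AF\<^esub> transvection x y)"
  shows "P \<alpha>"
proof -
  have "wf (inv_image (less_than <*lex*> less_than) cost)" by (intro wf_inv_image wf_lex_prod wf_less_than)
  then show ?thesis using assms(1)
  proof (induction \<alpha> rule: wf_induct_rule)
    case (less \<alpha>)
    show ?case
    proof (cases "minimal \<alpha>")
      case True
      then show ?thesis using minimal_relabel relabel by metis
    next
      case False
      then obtain x y where xy: "x \<in> L" "y \<in> L" "fst x \<noteq> fst y" "shortens \<alpha> x y"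
        using less.prems by (auto simp: minimal_def)
      let ?\<beta> = "\<alpha> \<otimes>\<^bsub>AF\<^esub> transvection x y"
      have \<beta>: "?\<beta> \<in> auto F" using less.prems xy by (simp add: AF_mult_closed transvection_auto)
      have "P ?\<beta>"
        using less.IH [OF _ \<beta>] cost_transvection [OF less.prems xy] by simp
      then have "P (?\<beta> \<otimes>\<^bsub>AF\<^esub> transvection x (inv_letter y))"
        using transv [OF \<beta> xy(1), of "inv_letter y"] xy by simp
      moreover have "?\<beta> \<otimes>\<^bsub>AF\<^esub> transvection x (inv_letter y) = \<alpha>"
        using less.prems xy transvection_auto [of x y] transvection_auto [of x "inv_letter y"]
        by (simp add: AF.m_assoc F.carrier_AutoGroup transvection_inv_mult)
      ultimately show ?thesis by simp
    qed
  qed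
qed

end

section \<open>Weights of commuting involutions\<close>
abbreviation (input) symdiff :: "'i set \<Rightarrow> 'i set \<Rightarrow> 'i set" (infixl \<open>\<triangle>\<close> 65)
  where "J \<triangle> K \<equiv> sym_diff J K"

lemma odd_card_symdiff:
  assumes "finite J" "finite K"
  shows "odd (card ((J \<triangle> K) \<inter> L)) \<longleftrightarrow> odd (card (J \<inter> L)) \<noteq> odd (card (K \<inter> L))"
proof -
  have "card (J \<inter> L) = card ((J - K) \<inter> L) + card (J \<inter> K \<inter> L)"
    "card (K \<inter> L) = card ((K - J) \<inter> L) + card (J \<inter> K \<inter> L)"
    "card ((J \<triangle> K) \<inter> L) = card ((J - K) \<inter> L) + card ((K - J) \<inter> L)"
    by (subst card_Un_disjoint [symmetric]; use assms in \<open>auto intro: arg_cong [where f = card]\<close>)+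
  then show ?thesis by auto
qed

lemma even_card_symdiff:
  assumes "finite J" "finite K"
  shows "even (card (L \<inter> (J \<triangle> K))) \<longleftrightarrow> even (card (L \<inter> J)) = even (card (L \<inter> K))"
  using odd_card_symdiff [OF assms, of L] by (simp only: Int_commute [of L]) blast

lemma symdiff_cancel: "K \<triangle> (K \<triangle> J) = J"
  by auto

definition symdiff_subgroup :: "'i set \<Rightarrow> 'i set set \<Rightarrow> bool"
  where "symdiff_subgroup Y H \<longleftrightarrow> H \<subseteq> Pow Y \<and> {} \<in> H \<and> (\<forall>J\<in>H. \<forall>K\<in>H. J \<triangle> K \<in> H)"

text \<open>
  Sets \<open>K\<close> stand for the characters \<open>J \<mapsto> (-1) ^ card (J \<inter> K)\<close> of the power set under symmetric
  difference, so this is the group of characters that are trivial on \<open>H\<close>.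
\<close>
definition ann :: "'i set \<Rightarrow> 'i set set \<Rightarrow> 'i set set"
  where "ann Y H = {K. K \<subseteq> Y \<and> (\<forall>J\<in>H. even (card (J \<inter> K)))}"

text \<open>
  Adding \<open>J0\<close> permutes the terms and changes their signs.
\<close>
lemma sum_sign_zero:
  assumes "finite Y" "H \<subseteq> Pow Y" "\<forall>J\<in>H. J \<triangle> J0 \<in> H" "J0 \<subseteq> Y" "odd (card (J0 \<inter> K))"
  shows "(\<Sum>J\<in>H. (-1) ^ card (J \<inter> K)) = (0::int)"
proof -
  have fin: "finite J" if "J \<in> H" for J using assms that by (meson PowD finite_subset subsetD)
  have "(\<Sum>J\<in>H. (-1) ^ card (J \<inter> K)) = (\<Sum>J\<in>H. - ((-1) ^ card (J \<inter> K)) :: int)"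
  proof (rule sum.reindex_bij_witness [where i = "\<lambda>J. J \<triangle> J0" and j = "\<lambda>J. J \<triangle> J0"])
    fix J assume J: "J \<in> H"
    show "(J \<triangle> J0) \<triangle> J0 = J" "(J \<triangle> J0) \<triangle> J0 = J" by auto
    show "J \<triangle> J0 \<in> H" "J \<triangle> J0 \<in> H" using assms(3) J by auto
    have "odd (card ((J \<triangle> J0) \<inter> K)) \<longleftrightarrow> even (card (J \<inter> K))"
      using odd_card_symdiff [OF fin [OF J] finite_subset [OF assms(4,1)], of K] assms(5) by auto
    then show "- ((-1) ^ card ((J \<triangle> J0) \<inter> K)) = ((-1) ^ card (J \<inter> K) :: int)"
      by (cases "even (card (J \<inter> K))") auto
  qed
  then show ?thesis by (simp add: sum_negf)
qed

text \<open>
  Sum all signs over \<open>J \<in> H\<close> and \<open>K \<subseteq> Y\<close>: for fixed \<open>J\<close> only the empty set contributes, for fixed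
  \<open>K\<close> only the annihilator.
\<close>
lemma card_ann:
  assumes Y: "finite Y" and H: "symdiff_subgroup Y H"
  shows "card H * card (ann Y H) = 2 ^ card Y"
proof -
  have H': "H \<subseteq> Pow Y" "{} \<in> H" "\<And>J K. J \<in> H \<Longrightarrow> K \<in> H \<Longrightarrow> J \<triangle> K \<in> H"
    using H by (auto simp: symdiff_subgroup_def)
  have fin: "finite H" using H' Y by (meson finite_Pow_iff finite_subset)
  let ?\<chi> = "\<lambda>J K. (-1) ^ card (J \<inter> K) :: int"
  have "int (2 ^ card Y) = (\<Sum>J\<in>H. if J = {} then 2 ^ card Y else 0)"
    using fin H'(2) by (simp add: sum.delta')
  also have "\<dots> = (\<Sum>J\<in>H. \<Sum>K\<in>Pow Y. ?\<chi> J K)"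
  proof (rule sum.cong [OF refl])
    fix J assume J: "J \<in> H"
    show "(if J = {} then 2 ^ card Y else 0) = (\<Sum>K\<in>Pow Y. ?\<chi> J K)"
    proof (cases "J = {}")
      case True
      then show ?thesis using Y by (simp add: card_Pow)
    next
      case False
      then obtain j where j: "j \<in> J" by blast
      have "(\<Sum>K\<in>Pow Y. ?\<chi> K J) = 0"
        by (rule sum_sign_zero [OF Y, of _ "{j}"]) (use j J H' in auto)
      then show ?thesis using False by (simp add: Int_commute)
    qed
  qed
  also have "\<dots> = (\<Sum>K\<in>Pow Y. \<Sum>J\<in>H. ?\<chi> J K)"
    by (rule sum.swap)
  also have "\<dots> = (\<Sum>K\<in>Pow Y. if K \<in> ann Y H then int (card H) else 0)"
  proof (rule sum.cong [OF refl])
    fix K assume K: "K \<in> Pow Y"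
    show "(\<Sum>J\<in>H. ?\<chi> J K) = (if K \<in> ann Y H then int (card H) else 0)"
    proof (cases "K \<in> ann Y H")
      case True
      then show ?thesis by (simp add: ann_def)
    next
      case False
      then obtain J0 where "J0 \<in> H" "odd (card (J0 \<inter> K))" using K by (auto simp: ann_def)
      then have "(\<Sum>J\<in>H. ?\<chi> J K) = 0"
        using H' by (intro sum_sign_zero [OF Y]) auto
      then show ?thesis using False by simp
    qed
  qed
  also have "\<dots> = int (card H * card (ann Y H))"
  proof -
    have "{K \<in> Pow Y. K \<in> ann Y H} = ann Y H" by (auto simp: ann_def)
    then show ?thesis using Y by (simp add: sum.If_cases Int_def)
  qed
  finally show ?thesis by (simp only: of_nat_eq_iff)
qed

text \<open>
  A set outside \<open>H\<close> would generate with \<open>H\<close> a subgroup twice as large with the same annihilator,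
  contrary to \<open>card_ann\<close>.
\<close>
lemma ann_ann:
  assumes Y: "finite Y" and H: "symdiff_subgroup Y H" and I: "I \<subseteq> Y"
    and even: "\<And>K. K \<in> ann Y H \<Longrightarrow> even (card (I \<inter> K))"
  shows "I \<in> H"
proof (rule ccontr)
  assume nI: "I \<notin> H"
  have H': "H \<subseteq> Pow Y" "{} \<in> H" "\<And>J K. J \<in> H \<Longrightarrow> K \<in> H \<Longrightarrow> J \<triangle> K \<in> H"
    using H by (auto simp: symdiff_subgroup_def)
  have fin: "finite H" using H' Y by (meson finite_Pow_iff finite_subset)
  have finY: "finite J" if "J \<subseteq> Y" for J using Y that finite_subset by blast
  let ?H = "H \<union> (\<lambda>J. J \<triangle> I) ` H"
  have "symdiff_subgroup Y ?H"
    unfolding symdiff_subgroup_def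
  proof (intro conjI ballI)
    show "?H \<subseteq> Pow Y" using H' I by auto
    fix J K assume JK: "J \<in> ?H" "K \<in> ?H"
    show "J \<triangle> K \<in> ?H"
    proof -
      obtain J' b where J: "J' \<in> H" "J = (if b then J' \<triangle> I else J')"
      proof (cases "J \<in> H")
        case False
        then obtain J' where "J' \<in> H" "J = J' \<triangle> I" using JK(1) by blast
        then show ?thesis using that [of J' True] by simp
      qed (use that [of J False] in simp)
      obtain K' c where K: "K' \<in> H" "K = (if c then K' \<triangle> I else K')"
      proof (cases "K \<in> H")
        case False
        then obtain K' where "K' \<in> H" "K = K' \<triangle> I" using JK(2) by blast
        then show ?thesis using that [of K' True] by simp
      qed (use that [of K False] in simp)
      have "J \<triangle> K = (if b = c then J' \<triangle> K' else (J' \<triangle> K') \<triangle> I)"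
        unfolding J(2) K(2) by (cases b; cases c) (simp add: set_eq_iff; blast)+
      then show ?thesis using H'(3) [OF J(1) K(1)] by (cases "b = c") simp_all
    qed
  qed (use H' in auto)
  moreover have "ann Y ?H = ann Y H"
  proof -
    have "even (card ((J \<triangle> I) \<inter> K))" if "J \<in> H" "K \<in> ann Y H" for J K
      using odd_card_symdiff [of J I K] that even [OF that(2)] H'(1) I finY by (auto simp: ann_def)
    then show ?thesis by (auto simp: ann_def)
  qed
  moreover have "card ?H = 2 * card H"
  proof -
    have "inj_on (\<lambda>J. J \<triangle> I) H" by (rule inj_on_inverseI [where g = "\<lambda>J. J \<triangle> I"]) auto
    moreover have "J \<triangle> I \<notin> H" if "J \<in> H" for J
    proof
      assume "J \<triangle> I \<in> H"
      then have "J \<triangle> (J \<triangle> I) \<in> H" using H'(3) that by blast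
      then show False using nI symdiff_cancel by metis
    qed
    ultimately show ?thesis using fin by (subst card_Un_disjoint) (auto simp: card_image)
  qed
  ultimately have "2 * card H * card (ann Y H) = card H * card (ann Y H)"
    using card_ann [OF Y H] card_ann [OF Y, of ?H] by metis
  then have "card H * card (ann Y H) = 0" by linarith
  then show False using card_ann [OF Y H] by simp
qed

locale commuting_involutions =
  fixes Y :: "'i set" and S :: "'s set" and f :: "'i \<Rightarrow> 's \<Rightarrow> 's"
  assumes finite_Y: "finite Y" and finite_S: "finite S"
    and f_closed: "j \<in> Y \<Longrightarrow> s \<in> S \<Longrightarrow> f j s \<in> S"
    and f_f: "j \<in> Y \<Longrightarrow> f j (f j s) = s"
    and f_commute: "j \<in> Y \<Longrightarrow> k \<in> Y \<Longrightarrow> f j (f k s) = f k (f j s)"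
begin

definition act :: "'i set \<Rightarrow> 's \<Rightarrow> 's"
  where "act J = Finite_Set.fold (\<lambda>j g. f j \<circ> g) id J"

lemma finite_sub: "J \<subseteq> Y \<Longrightarrow> finite J"
  using finite_Y finite_subset by blast

lemma subset_induct [consumes 1, case_names empty insert]:
  assumes "J \<subseteq> Y" "P {}" "\<And>j J. insert j J \<subseteq> Y \<Longrightarrow> j \<notin> J \<Longrightarrow> P J \<Longrightarrow> P (insert j J)"
  shows "P J"
  using finite_sub [OF assms(1)] assms(1) by (induction J) (auto intro: assms(2,3))

lemma act_empty [simp]: "act {} s = s"
  by (simp add: act_def)

lemma act_insert:
  assumes "insert j J \<subseteq> Y" "j \<notin> J"
  shows "act (insert j J) s = f j (act J s)"
proof -
  interpret comp_fun_commute_on Y "\<lambda>j g. f j \<circ> g"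
    by unfold_locales (auto simp: fun_eq_iff f_commute)
  show ?thesis
    using fold_insert [OF assms(1) _ assms(2), of id] finite_sub assms by (simp add: act_def)
qed

lemma act_single: "j \<in> Y \<Longrightarrow> act {j} s = f j s"
  using act_insert [of j "{}"] by simp

lemma act_pair: "j \<in> Y \<Longrightarrow> k \<in> Y \<Longrightarrow> j \<noteq> k \<Longrightarrow> act {j, k} s = f j (f k s)"
  using act_insert [of j "{k}"] by (simp add: act_single)

lemma f_act:
  assumes "j \<in> Y" "J \<subseteq> Y"
  shows "f j (act J s) = act ({j} \<triangle> J) s"
proof (cases "j \<in> J")
  case True
  then have "act J s = f j (act (J - {j}) s)"
    using act_insert [of j "J - {j}"] assms by (simp add: insert_absorb)
  moreover have "{j} \<triangle> J = J - {j}" using True by auto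
  ultimately show ?thesis using assms f_f by simp
next
  case False
  moreover from this have "{j} \<triangle> J = insert j J" by auto
  ultimately show ?thesis using act_insert assms by simp
qed

lemma act_act: "J \<subseteq> Y \<Longrightarrow> K \<subseteq> Y \<Longrightarrow> act J (act K s) = act (J \<triangle> K) s"
proof (induction J rule: subset_induct)
  case (insert j J)
  have "act (insert j J) (act K s) = f j (act (J \<triangle> K) s)"
    using insert by (simp add: act_insert)
  also have "\<dots> = act ({j} \<triangle> (J \<triangle> K)) s"
    using insert by (intro f_act) auto
  also have "{j} \<triangle> (J \<triangle> K) = insert j J \<triangle> K" using insert by auto
  finally show ?case .
qed auto

lemma act_closed: "J \<subseteq> Y \<Longrightarrow> s \<in> S \<Longrightarrow> act J s \<in> S"
proof (induction J rule: subset_induct)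
  case (insert j J)
  then show ?case by (simp add: act_insert f_closed)
qed auto

definition stab :: "'s \<Rightarrow> 'i set set"
  where "stab s = {J. J \<subseteq> Y \<and> act J s = s}"

text \<open>
  The characters that occur in the permutation representation on the orbit of \<open>s\<close>.
\<close>
definition weights :: "'s \<Rightarrow> 'i set set"
  where "weights s = ann Y (stab s)"

definition orb :: "'s \<Rightarrow> 's set"
  where "orb s = (\<lambda>J. act J s) ` Pow Y"

lemma stab_subgroup: "symdiff_subgroup Y (stab s)"
  unfolding symdiff_subgroup_def stab_def by (auto simp flip: act_act)

lemma weights_empty: "{} \<in> weights s"
  by (simp add: weights_def ann_def)

lemma weights_subset: "K \<in> weights s \<Longrightarrow> K \<subseteq> Y"
  by (simp add: weights_def ann_def)

lemma weights_symdiff: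
  assumes "J \<in> weights s" "K \<in> weights s"
  shows "J \<triangle> K \<in> weights s"
  using assms even_card_symdiff [of J K] finite_sub [of J] finite_sub [of K]
  by (auto simp: weights_def ann_def)

lemma weights_even: "K \<in> weights s \<Longrightarrow> J \<subseteq> Y \<Longrightarrow> act J s = s \<Longrightarrow> even (card (J \<inter> K))"
  by (auto simp: weights_def ann_def stab_def)

lemma fixed_by_weights:
  assumes "J \<subseteq> Y" "\<And>K. K \<in> weights s \<Longrightarrow> even (card (J \<inter> K))"
  shows "act J s = s"
  using ann_ann [OF finite_Y stab_subgroup assms(1), of s] assms(2)
  by (auto simp: weights_def stab_def)

lemma act_cancel: "J \<subseteq> Y \<Longrightarrow> act J (act J s) = s"
  by (simp add: act_act)

lemma stab_act:
  assumes "J \<subseteq> Y"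
  shows "stab (act J s) = stab s"
proof -
  have "act I (act J s) = act J (act I s)" if "I \<subseteq> Y" for I
    using assms that by (simp add: act_act Un_commute)
  moreover have "act J a = act J b \<longleftrightarrow> a = b" for a b using act_cancel [OF assms] by metis
  ultimately show ?thesis by (auto simp: stab_def)
qed

lemma orb_act:
  assumes "J \<subseteq> Y"
  shows "orb (act J s) = orb s"
proof -
  have "orb (act J s) \<subseteq> orb s" if "J \<subseteq> Y" for J s
    using that by (auto simp: orb_def act_act)
  from this [OF assms, of s] this [OF assms, of "act J s"] show ?thesis
    by (simp add: act_cancel [OF assms])
qed

lemma mem_orb: "s \<in> orb s"
  by (auto simp: orb_def intro: image_eqI [of _ _ "{}"])

lemma orb_eq_iff: "orb t = orb s \<longleftrightarrow> t \<in> orb s"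
proof
  assume "t \<in> orb s"
  then obtain J where "J \<subseteq> Y" "t = act J s" by (auto simp: orb_def)
  then show "orb t = orb s" by (simp add: orb_act)
qed (use mem_orb [of t] in auto)

lemma orb_eqD: "orb t = orb s \<Longrightarrow> weights t = weights s"
  unfolding orb_eq_iff by (auto simp: orb_def weights_def stab_act)

text \<open>
  Both sides are the index of the stabilizer.
\<close>
lemma card_orb: "card (orb s) = card (weights s)"
proof -
  have fibre: "card {J \<in> Pow Y. act J s = t} = card (stab s)" if t: "t \<in> orb s" for t
  proof -
    obtain J0 where J0: "J0 \<subseteq> Y" "t = act J0 s" using t by (auto simp: orb_def)
    have "{J \<in> Pow Y. act J s = t} = (\<lambda>J. J0 \<triangle> J) ` stab s"
    proof (intro equalityI subsetI)
      fix J assume "J \<in> {J \<in> Pow Y. act J s = t}"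
      then have "J0 \<triangle> J \<in> stab s"
        using J0 act_act [of J0 J s] act_cancel [of J0 s] by (auto simp: stab_def)
      moreover have "J = J0 \<triangle> (J0 \<triangle> J)" by auto
      ultimately show "J \<in> (\<lambda>J. J0 \<triangle> J) ` stab s" by blast
    next
      fix J assume "J \<in> (\<lambda>J. J0 \<triangle> J) ` stab s"
      then obtain J' where "J = J0 \<triangle> J'" "J' \<in> stab s" by blast
      then show "J \<in> {J \<in> Pow Y. act J s = t}"
        using J0 act_act [of J0 J' s] by (auto simp: stab_def)
    qed
    moreover have "inj_on (\<lambda>J. J0 \<triangle> J) (stab s)"
      by (rule inj_on_inverseI [where g = "\<lambda>J. J0 \<triangle> J"]) auto
    ultimately show ?thesis by (simp add: card_image)
  qed
  have "card (Pow Y) = (\<Sum>t\<in>orb s. card {J \<in> Pow Y. act J s = t})"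
    using sum.image_gen [of "Pow Y" "\<lambda>_. 1::nat" "\<lambda>J. act J s"] finite_Y
    by (simp add: orb_def)
  also have "\<dots> = card (orb s) * card (stab s)"
    using fibre by simp
  finally have "card (orb s) * card (stab s) = 2 ^ card Y"
    using finite_Y by (simp add: card_Pow)
  moreover have "card (weights s) * card (stab s) = 2 ^ card Y"
    using card_ann [OF finite_Y stab_subgroup, of s] by (simp add: weights_def mult.commute)
  moreover have "card (stab s) \<noteq> 0"
    by (rule notI) (use calculation in simp)
  ultimately show ?thesis by (metis mult_right_cancel)
qed

text \<open>
  The decomposition of the permutation representation into characters. A weight that occurs on several
  orbits is counted once for each; its cardinality is that of the set.
\<close>
definition spectrum :: "('s set \<times> 'i set) set"
  where "spectrum = {(orb s, K) |s K. s \<in> S \<and> K \<in> weights s}"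

lemma orb_subset: "s \<in> S \<Longrightarrow> orb s \<subseteq> S"
  using act_closed by (auto simp: orb_def)

lemma finite_weights: "finite (weights s)"
  using weights_subset finite_Y by (meson PowI finite_Pow_iff finite_subset subsetI)

lemma spectrum_Sigma: "spectrum = Sigma (orb ` S) (\<lambda>R. weights (SOME s. s \<in> S \<and> orb s = R))"
proof -
  have "weights (SOME s'. s' \<in> S \<and> orb s' = orb s) = weights s" if "s \<in> S" for s
    by (rule orb_eqD) (use someI [of "\<lambda>s'. s' \<in> S \<and> orb s' = orb s" s] that in blast)
  then show ?thesis by (force simp: spectrum_def)
qed

lemma finite_spectrum: "finite spectrum"
  unfolding spectrum_Sigma using finite_S finite_weights by auto

lemma card_spectrum: "card spectrum = card S"
proof -
  have "card spectrum = (\<Sum>R\<in>orb ` S. card (weights (SOME s. s \<in> S \<and> orb s = R)))"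
    unfolding spectrum_Sigma using finite_S finite_weights by (subst card_SigmaI) auto
  also have "\<dots> = (\<Sum>R\<in>orb ` S. card {s \<in> S. orb s = R})"
  proof (rule sum.cong [OF refl])
    fix R assume "R \<in> orb ` S"
    then have *: "\<exists>s. s \<in> S \<and> orb s = R" by blast
    define s where "s = (SOME s. s \<in> S \<and> orb s = R)"
    have s: "s \<in> S" "orb s = R" using someI_ex [OF *] by (auto simp: s_def)
    have "{t \<in> S. orb t = R} = orb s"
      using orb_eq_iff [of _ s] orb_subset [OF s(1)] s(2) by auto
    then show "card (weights (SOME s. s \<in> S \<and> orb s = R)) = card {s \<in> S. orb s = R}"
      using card_orb [of s] by (simp add: s_def)
  qed
  also have "\<dots> = card S"
    using sum.image_gen [OF finite_S, of "\<lambda>_. 1::nat" orb] by simp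
  finally show ?thesis .
qed

lemma card_le_spectrum: "Q \<subseteq> spectrum \<Longrightarrow> card Q \<le> card S"
  using card_mono [OF finite_spectrum] card_spectrum by metis

lemma card_weights_le: "card (\<Union>s\<in>S. weights s) \<le> card S"
proof -
  have "(\<Union>s\<in>S. weights s) = snd ` spectrum"
    by (force simp: spectrum_def)
  then show ?thesis using card_image_le [OF finite_spectrum, of snd] card_spectrum by simp
qed

text \<open>
  A map \<open>g\<close> that normalizes the action carries stabilizers to stabilizers, hence weights to weights for
  the dual action on characters. The last assumption says that \<open>I\<close> acts at \<open>g s\<close> as \<open>J\<close> does at \<open>s\<close>,
  and that the characters \<open>K'\<close> and \<open>K\<close> correspond.
\<close>
lemma weights_transport:
  assumes "s \<in> S" "K \<in> weights s" "inj_on g S" "K' \<subseteq> Y"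
    and "\<And>I. I \<subseteq> Y \<Longrightarrow> \<exists>J\<subseteq>Y. act I (g s) = g (act J s) \<and> even (card (I \<inter> K')) = even (card (J \<inter> K))"
  shows "K' \<in> weights (g s)"
proof -
  have "even (card (I \<inter> K'))" if "I \<in> stab (g s)" for I
  proof -
    have I: "I \<subseteq> Y" "act I (g s) = g s" using that by (auto simp: stab_def)
    obtain J where J: "J \<subseteq> Y" "act I (g s) = g (act J s)" "even (card (I \<inter> K')) = even (card (J \<inter> K))"
      using assms(5) [OF I(1)] by blast
    have "act J s = s"
      using inj_onD [OF assms(3) trans [OF J(2) [symmetric] I(2)] act_closed [OF J(1) assms(1)] assms(1)] .
    then show "even (card (I \<inter> K'))" using weights_even [OF assms(2) J(1)] unfolding J(3) by blast
  qed
  then show ?thesis using assms(4) by (simp add: weights_def ann_def)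
qed

end

section \<open>Elementary matrices over the field with two elements\<close>
text \<open>
  The row \<open>x i j\<close>, for fixed \<open>i\<close>, consists of commuting involutions. Conjugation by \<open>x l k\<close> maps
  \<open>x i l\<close> to \<open>x i l\<close> times \<open>x i k\<close>, so on weights it toggles \<open>l\<close> in those which contain \<open>k\<close>. From a nonempty
  weight all subsets arise in this way. If \<open>x i j\<close> moves a point there is such a weight, and then there are
  at least \<open>2 ^ (card A - 1)\<close> points.
\<close>
theorem steinberg_mod2_trivial:
  fixes x :: "'i \<Rightarrow> 'i \<Rightarrow> 's \<Rightarrow> 's"
  assumes fin: "finite A" "finite S" and small: "card S < 2 ^ (card A - 1)"
    and closed: "\<And>i j s. i \<in> A \<Longrightarrow> j \<in> A \<Longrightarrow> i \<noteq> j \<Longrightarrow> s \<in> S \<Longrightarrow> x i j s \<in> S"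
    and invol: "\<And>i j s. i \<in> A \<Longrightarrow> j \<in> A \<Longrightarrow> i \<noteq> j \<Longrightarrow> s \<in> S \<Longrightarrow> x i j (x i j s) = s"
    and comm: "\<And>i j k l s. i \<in> A \<Longrightarrow> j \<in> A \<Longrightarrow> k \<in> A \<Longrightarrow> l \<in> A \<Longrightarrow> i \<noteq> j \<Longrightarrow> k \<noteq> l \<Longrightarrow> i \<noteq> l \<Longrightarrow> j \<noteq> k
      \<Longrightarrow> s \<in> S \<Longrightarrow> x i j (x k l s) = x k l (x i j s)"
    and commutator: "\<And>i j k s. i \<in> A \<Longrightarrow> j \<in> A \<Longrightarrow> k \<in> A \<Longrightarrow> i \<noteq> j \<Longrightarrow> j \<noteq> k \<Longrightarrow> i \<noteq> k
      \<Longrightarrow> s \<in> S \<Longrightarrow> x j k (x i j s) = x i j (x j k (x i k s))"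
    and ij: "i \<in> A" "j \<in> A" "i \<noteq> j" and s: "s \<in> S"
  shows "x i j s = s"
proof (rule ccontr)
  assume moved: "x i j s \<noteq> s"
  define Y where "Y = A - {i}"
  define f where "f = (\<lambda>j s. if s \<in> S then x i j s else s)"
  interpret commuting_involutions Y S f
    by unfold_locales (auto simp: f_def Y_def fin closed invol comm ij)
  define U where "U = (\<Union>s\<in>S. weights s)"
  have toggle: "K \<triangle> {l} \<in> U" if K: "K \<in> U" and k: "k \<in> K" and l: "l \<in> Y" "l \<noteq> k" for K k l
  proof -
    obtain t where t: "t \<in> S" "K \<in> weights t" using K by (auto simp: U_def)
    have kY: "k \<in> Y" using weights_subset [OF t(2)] k by auto
    define g where "g = x l k"
    have l': "l \<in> A" "l \<noteq> i" "k \<in> A" "k \<noteq> i" using l kY by (auto simp: Y_def)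
    have g_closed: "g u \<in> S" if "u \<in> S" for u using that l' l by (simp add: g_def closed)
    have gf: "g (f m u) = f m (g u)" if "m \<in> Y" "m \<noteq> l" "u \<in> S" for m u
      using that l' l comm [of l k i m u] ij g_closed closed by (auto simp: g_def f_def Y_def)
    have gfl: "g (f l u) = f l (f k (g u))" if "u \<in> S" for u
      using that l' l commutator [of i l k u] comm [of l k i k u] ij g_closed closed
      by (auto simp: g_def f_def Y_def)
    have g_act: "g (act J t) = act J (g t)" if "J \<subseteq> Y" "l \<notin> J" for J
      using that
    proof (induction J rule: subset_induct)
      case (insert m J)
      then show ?case using gf [of m "act J t"] act_closed t by (auto simp: act_insert)
    qed simp_all
    have "K \<triangle> {l} \<in> weights (g t)"
    proof (rule weights_transport [OF t])
      show "inj_on g S"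
        by (rule inj_on_inverseI [where g = g]) (use l' l in \<open>simp add: g_def invol\<close>)
      show "K \<triangle> {l} \<subseteq> Y" using weights_subset [OF t(2)] l by auto
      fix I assume I: "I \<subseteq> Y"
      show "\<exists>J\<subseteq>Y. act I (g t) = g (act J t) \<and> even (card (I \<inter> (K \<triangle> {l}))) = even (card (J \<inter> K))"
      proof (cases "l \<in> I")
        case False
        then have "I \<inter> (K \<triangle> {l}) = I \<inter> K" by auto
        then show ?thesis using g_act [OF I False] I by auto
      next
        case True
        \<comment> \<open>Conjugation by \<open>g\<close> turns \<open>f l\<close> into the product of \<open>f l\<close> and \<open>f k\<close>.\<close>
        define J where "J = I \<triangle> {k}"
        define J' where "J' = J - {l}"
        have J: "J \<subseteq> Y" "J' \<subseteq> Y" "l \<notin> J'" "J = insert l J'" "insert l J' \<subseteq> Y"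
          using I kY l True by (auto simp: J_def J'_def)
        have "g (act J t) = f l (f k (act J' (g t)))"
          using gfl [OF act_closed [OF J(2) t(1)]] g_act [OF J(2,3)] J(3,5)
          by (simp add: act_insert J(4))
        also have "\<dots> = act ({l} \<triangle> ({k} \<triangle> J')) (g t)"
        proof -
          have "{k} \<triangle> J' \<subseteq> Y" using J kY by auto
          then show ?thesis by (simp only: f_act [OF kY J(2)] f_act [OF l(1)])
        qed
        also have "{l} \<triangle> ({k} \<triangle> J') = I"
          using True l by (auto simp: J_def J'_def)
        finally have "act I (g t) = g (act J t)" by simp
        moreover have "even (card (I \<inter> (K \<triangle> {l}))) = even (card (J \<inter> K))"
        proof -
          have K': "finite K" "finite I" using weights_subset [OF t(2)] I finite_sub by auto
          have "even (card (I \<inter> (K \<triangle> {l}))) \<longleftrightarrow> odd (card (I \<inter> K))"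
            using even_card_symdiff [OF K'(1), of "{l}" I] True by simp
          moreover have "odd (card ((I \<triangle> {k}) \<inter> K)) \<longleftrightarrow> even (card (I \<inter> K))"
            using odd_card_symdiff [OF K'(2), of "{k}" K] k by simp
          ultimately show ?thesis unfolding J_def by blast
        qed
        ultimately show ?thesis using J(1) by blast
      qed
    qed
    then show ?thesis using g_closed [OF t(1)] by (auto simp: U_def)
  qed
  have reach: "K' \<in> U" if K: "K \<in> U" "k \<in> K" and K': "K' \<subseteq> Y" "k \<in> K'" for K K' k
  proof -
    have KY: "K \<subseteq> Y" using K weights_subset by (auto simp: U_def)
    have D: "D \<subseteq> Y \<Longrightarrow> k \<notin> D \<Longrightarrow> K \<triangle> D \<in> U" for D
    proof (induction D rule: subset_induct)
      case (insert d D)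
      then have "(K \<triangle> D) \<triangle> {d} \<in> U" using K by (intro toggle [where k = k]) auto
      moreover have "(K \<triangle> D) \<triangle> {d} = K \<triangle> insert d D" using insert by auto
      ultimately show ?case by simp
    qed (use K in auto)
    have "K \<triangle> (K \<triangle> K') \<in> U" by (rule D) (use KY K K' in auto)
    moreover have "K \<triangle> (K \<triangle> K') = K'" by auto
    ultimately show ?thesis by simp
  qed
  have "\<exists>K\<in>weights s. j \<in> K"
  proof (rule ccontr)
    assume "\<not> ?thesis"
    then have "act {j} s = s" using ij by (intro fixed_by_weights) (auto simp: Y_def)
    moreover have "act {j} s = f j s" using ij by (intro act_single) (auto simp: Y_def)
    moreover have "f j s = x i j s" using s by (simp add: f_def)
    ultimately show False using moved by simp
  qed
  then obtain K where K: "K \<in> U" "j \<in> K" using s by (auto simp: U_def)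
  have "Pow Y \<subseteq> U"
  proof
    fix K' assume "K' \<in> Pow Y"
    show "K' \<in> U"
    proof (cases "K' = {}")
      case True
      then show ?thesis using weights_empty s by (auto simp: U_def)
    next
      case False
      then obtain k where k: "k \<in> K'" by blast
      have "{j, k} \<subseteq> Y" "K' \<subseteq> Y" using k \<open>K' \<in> Pow Y\<close> ij by (auto simp: Y_def)
      then have "{j, k} \<in> U" by (intro reach [OF K]) simp_all
      then show ?thesis by (rule reach) (use k \<open>K' \<subseteq> Y\<close> in simp_all)
    qed
  qed
  then have "card (Pow Y) \<le> card U"
    using finite_weights finite_S by (intro card_mono) (auto simp: U_def)
  also have "\<dots> \<le> card S" unfolding U_def by (rule card_weights_le)
  finally show False using small fin ij by (simp add: card_Pow Y_def)
qed

section \<open>Involutions permuted by the symmetric group\<close>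
lemma choose_Suc_two: "Suc n choose 2 = (n choose 2) + n"
  by (simp add: numeral_2_eq_2)

lemma less_choose_two: "6 \<le> n \<Longrightarrow> n < n choose 2"
  by (induction n rule: dec_induct) (simp_all add: choose_Suc_two numeral_eq_Suc)

text \<open>
  For \<open>n = 6\<close> the two sides are \<open>21\<close> and \<open>22\<close>.
\<close>
lemma choose_Suc_two_less_choose_three: "6 \<le> n \<Longrightarrow> Suc n choose 2 < (n choose 3) + 2"
proof (induction n rule: dec_induct)
  case base
  then show ?case by (simp add: numeral_eq_Suc)
next
  case (step n)
  have "Suc n choose 3 = (n choose 2) + (n choose 3)"
    by (simp add: numeral_eq_Suc)
  then show ?case using step less_choose_two [of n] choose_Suc_two [of "Suc n"] by simp
qed

lemma choose_three_le:
  assumes "3 \<le> k" "k + 3 \<le> n"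
  shows "n choose 3 \<le> n choose k"
proof (cases "2 * k \<le> n")
  case True
  then show ?thesis using assms by (intro binomial_mono) auto
next
  case False
  then have "n choose 3 \<le> n choose (n - k)" using assms by (intro binomial_mono) auto
  then show ?thesis using assms binomial_symmetric [of k n] by simp
qed

lemma le_choose_four: "6 \<le> n \<Longrightarrow> n \<le> n choose 4"
proof (induction n rule: dec_induct)
  case (step n)
  have "n choose 3 > 0" using step by (simp add: zero_less_binomial)
  moreover have "Suc n choose 4 = (n choose 3) + (n choose 4)" by (simp add: numeral_eq_Suc)
  ultimately show ?case using step by linarith
qed (simp add: numeral_eq_Suc)

lemma permutation_extending:
  assumes "finite Y" "B \<subseteq> Y" "inj_on p B" "p ` B \<subseteq> Y"
  obtains \<pi> where "\<pi> permutes Y" "\<And>b. b \<in> B \<Longrightarrow> \<pi> b = p b"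
proof -
  have "card (Y - B) = card (Y - p ` B)"
    using assms by (simp add: card_Diff_subset card_image finite_subset)
  then obtain q where q: "bij_betw q (Y - B) (Y - p ` B)"
    using finite_same_card_bij [of "Y - B" "Y - p ` B"] assms(1) finite_Diff by metis
  \<comment> \<open>The complements of \<open>B\<close> and of its image have the same size, so any bijection between them will do.\<close>
  define \<pi> where "\<pi> x = (if x \<in> B then p x else if x \<in> Y then q x else x)" for x
  have "bij_betw \<pi> B (p ` B)"
    using assms(3) by (auto simp: bij_betw_def \<pi>_def inj_on_def)
  moreover have "bij_betw \<pi> (Y - B) (Y - p ` B)"
    using q bij_betw_cong [of "Y - B" q \<pi>] by (simp add: \<pi>_def)
  ultimately have "bij_betw \<pi> (B \<union> (Y - B)) (p ` B \<union> (Y - p ` B))"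
    by (rule bij_betw_combine) auto
  moreover have "B \<union> (Y - B) = Y" "p ` B \<union> (Y - p ` B) = Y" using assms by auto
  ultimately have "\<pi> permutes Y" using assms(2) by (intro bij_imp_permutes) (auto simp: \<pi>_def)
  then show ?thesis using that [of \<pi>] by (simp add: \<pi>_def)
qed

lemma permutation_of_sets:
  assumes "finite Y" "J \<subseteq> Y" "K \<subseteq> Y" "card J = card K"
  obtains \<pi> where "\<pi> permutes Y" "\<pi> ` J = K"
proof -
  obtain p where p: "bij_betw p J K"
    using finite_same_card_bij [of J K] assms finite_subset by metis
  obtain \<pi> where \<pi>: "\<pi> permutes Y" "\<And>b. b \<in> J \<Longrightarrow> \<pi> b = p b"
    using permutation_extending [OF assms(1,2), of p] p assms(3) by (auto simp: bij_betw_def)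
  have "\<pi> ` J = K" using \<pi>(2) p by (auto simp: bij_betw_def)
  then show ?thesis using that \<pi>(1) by blast
qed

locale symmetric_involutions = commuting_involutions +
  assumes permuted: "\<pi> permutes Y \<Longrightarrow>
    \<exists>g. inj_on g S \<and> g ` S \<subseteq> S \<and> (\<forall>j\<in>Y. \<forall>s\<in>S. g (f j s) = f (\<pi> j) (g s))"
begin

lemma permute_spectrum:
  assumes \<pi>: "\<pi> permutes Y"
  obtains g where "\<And>s. s \<in> S \<Longrightarrow> g s \<in> S"
    "\<And>s K. s \<in> S \<Longrightarrow> K \<in> weights s \<Longrightarrow> \<pi> ` K \<in> weights (g s)"
    "\<And>s t. s \<in> S \<Longrightarrow> t \<in> S \<Longrightarrow> orb (g s) = orb (g t) \<longleftrightarrow> orb s = orb t"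
proof -
  obtain g where g: "inj_on g S" "g ` S \<subseteq> S" "\<And>j s. j \<in> Y \<Longrightarrow> s \<in> S \<Longrightarrow> g (f j s) = f (\<pi> j) (g s)"
    using permuted [OF \<pi>] by blast
  have closed: "g s \<in> S" if "s \<in> S" for s using g(2) that by blast
  have \<pi>Y: "\<pi> j \<in> Y \<longleftrightarrow> j \<in> Y" for j using permutes_in_image [OF \<pi>] .
  have \<pi>inj: "inj \<pi>" using permutes_inj [OF \<pi>] .
  have act: "g (act J s) = act (\<pi> ` J) (g s)" if "J \<subseteq> Y" "s \<in> S" for J s
    using that(1)
  proof (induction J rule: subset_induct)
    case (insert j J)
    have "insert (\<pi> j) (\<pi> ` J) \<subseteq> Y" "\<pi> j \<notin> \<pi> ` J"
      using insert \<pi>Y inj_image_mem_iff [OF \<pi>inj] by auto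
    then show ?case using insert act_closed [of J s] that(2)
      by (simp add: act_insert g(3))
  qed simp
  have img: "\<pi> ` (Hilbert_Choice.inv \<pi> ` I) = I" for I
    using permutes_surj [OF \<pi>] by (simp add: image_f_inv_f)
  have sub: "Hilbert_Choice.inv \<pi> ` I \<subseteq> Y" if "I \<subseteq> Y" for I
    using that permutes_in_image [OF permutes_inv [OF \<pi>]] by blast
  have w: "\<pi> ` K \<in> weights (g s)" if "s \<in> S" "K \<in> weights s" for s K
  proof (rule weights_transport [OF that g(1)])
    show "\<pi> ` K \<subseteq> Y" using weights_subset [OF that(2)] \<pi>Y by blast
    fix I assume I: "I \<subseteq> Y"
    have "card (I \<inter> \<pi> ` K) = card (\<pi> ` (Hilbert_Choice.inv \<pi> ` I \<inter> K))"
      by (simp add: image_Int [OF \<pi>inj] img)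
    also have "\<dots> = card (Hilbert_Choice.inv \<pi> ` I \<inter> K)"
      by (rule card_image) (use \<pi>inj in \<open>auto intro: inj_on_subset\<close>)
    finally show "\<exists>J\<subseteq>Y. act I (g s) = g (act J s) \<and> even (card (I \<inter> \<pi> ` K)) = even (card (J \<inter> K))"
      using act [OF sub [OF I] that(1)] sub [OF I] by (intro exI [of _ "Hilbert_Choice.inv \<pi> ` I"]) (simp add: img)
  qed
  have orb: "orb (g s) = g ` orb s" if "s \<in> S" for s
  proof -
    have "Pow Y = (\<lambda>J. \<pi> ` J) ` Pow Y"
      using img sub \<pi>Y by (auto simp: image_iff) (metis PowI)
    then have "orb (g s) = (\<lambda>J. act J (g s)) ` (\<lambda>J. \<pi> ` J) ` Pow Y"
      unfolding orb_def by (rule arg_cong)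
    also have "\<dots> = (\<lambda>J. g (act J s)) ` Pow Y"
      unfolding image_image using act that by (intro image_cong) auto
    finally show ?thesis by (simp only: orb_def image_image)
  qed
  have "orb (g s) = orb (g t) \<longleftrightarrow> orb s = orb t" if "s \<in> S" "t \<in> S" for s t
    using that inj_on_image_eq_iff [OF g(1) orb_subset orb_subset] by (simp add: orb)
  then show ?thesis using that closed w by metis
qed

lemma weights_of_same_size:
  assumes "s \<in> S" "K \<in> weights s" "K' \<subseteq> Y" "card K' = card K"
  shows "\<exists>s'\<in>S. K' \<in> weights s'"
proof -
  obtain \<pi> where \<pi>: "\<pi> permutes Y" "\<pi> ` K = K'"
    using permutation_of_sets [OF finite_Y weights_subset [OF assms(2)] assms(3)] assms(4) by metis
  show ?thesis using permute_spectrum [OF \<pi>(1)] assms(1,2) \<pi>(2) by metis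
qed

lemma card_subsets: "card {J. J \<subseteq> Y \<and> card J = k} = card Y choose k"
  by (rule n_subsets [OF finite_Y])

lemma finite_subsets: "finite {J. J \<subseteq> Y \<and> P J}"
  using finite_Y by simp

text \<open>
  All sets of the size of \<open>K\<close> are weights, and so is the empty set, which gives more than
  \<open>card Y choose 3\<close> elements of the spectrum. For six involutions the bound \<open>21\<close> still allows this, and
  a second additional element is needed: exchange one element of \<open>K\<close>. If the new set is a weight on
  another orbit, that orbit has the empty weight too; otherwise the difference of the two sets is a
  weight with two elements.
\<close>
lemma middle_weights_large:
  assumes n: "6 \<le> card Y" and S: "card S \<le> Suc (card Y) choose 2"
    and s: "s \<in> S" and K: "K \<in> weights s"
  shows "\<not> (3 \<le> card K \<and> card K + 3 \<le> card Y)"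
proof
  assume k: "3 \<le> card K \<and> card K + 3 \<le> card Y"
  define k where "k = card K"
  let ?C = "{J. J \<subseteq> Y \<and> card J = k}"
  have KY: "K \<subseteq> Y" "finite K" using weights_subset [OF K] finite_sub by auto
  have "\<forall>J\<in>?C. \<exists>s'\<in>S. J \<in> weights s'"
    using weights_of_same_size [OF s K] by (simp add: k_def)
  then obtain \<sigma> where \<sigma>: "\<And>J. J \<in> ?C \<Longrightarrow> \<sigma> J \<in> S \<and> J \<in> weights (\<sigma> J)" by metis
  \<comment> \<open>One element of the spectrum for each set of size \<open>k\<close>.\<close>
  define Q where "Q = (\<lambda>J. (orb (\<sigma> J), J)) ` ?C"
  have Q: "Q \<subseteq> spectrum" "card Q = card Y choose k" "finite Q"
  proof -
    show "Q \<subseteq> spectrum" using \<sigma> by (auto simp: Q_def spectrum_def)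
    have "inj_on (\<lambda>J. (orb (\<sigma> J), J)) ?C" by (auto simp: inj_on_def)
    then show "card Q = card Y choose k" using card_subsets by (simp add: Q_def card_image)
    show "finite Q" using finite_subsets by (simp add: Q_def)
  qed
  obtain a where a: "a \<in> K" using k by fastforce
  have "card (Y - K) > 0" using k KY by (simp add: card_Diff_subset)
  then obtain c where c: "c \<in> Y" "c \<notin> K" by (metis DiffE card_gt_0_iff ex_in_conv)
  define K' where "K' = insert c (K - {a})"
  have "card K' = card K" using KY a c card_Suc_Diff1 [OF KY(2) a] by (simp add: K'_def)
  then have K': "K' \<in> ?C" using KY a c by (auto simp: K'_def k_def)
  have diff: "K \<triangle> K' = {a, c}" using a c by (auto simp: K'_def)
  have "a \<noteq> c" using a c by blast
  then have ac: "card {a, c} = 2" by simp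
  obtain p where p: "p \<in> spectrum" "p \<notin> Q" "p \<noteq> (orb s, {})"
  proof (cases "orb (\<sigma> K') = orb s")
    case True
    then have "K' \<in> weights s" using \<sigma> [OF K'] orb_eqD by metis
    then have "{a, c} \<in> weights s" using weights_symdiff [OF K, of K'] by (simp only: diff)
    then have "(orb s, {a, c}) \<in> spectrum" using s by (auto simp: spectrum_def)
    moreover have "(orb s, {a, c}) \<notin> Q" using k ac by (auto simp: Q_def k_def)
    ultimately show ?thesis using that [of "(orb s, {a, c})"] by simp
  next
    case False
    moreover have "(orb (\<sigma> K'), {}) \<in> spectrum" using \<sigma> [OF K'] weights_empty by (auto simp: spectrum_def)
    moreover have "(orb (\<sigma> K'), {}) \<notin> Q" using k by (auto simp: Q_def k_def)
    ultimately show ?thesis using that [of "(orb (\<sigma> K'), {})"] by simp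
  qed
  have "(orb s, {}) \<in> spectrum" using s weights_empty by (auto simp: spectrum_def)
  moreover have "(orb s, {}) \<notin> Q" using k by (auto simp: Q_def k_def)
  ultimately have "card (insert p (insert (orb s, {}) Q)) = (card Y choose k) + 2"
    "insert p (insert (orb s, {}) Q) \<subseteq> spectrum"
    using p Q by simp_all
  then have "(card Y choose k) + 2 \<le> card S" using card_le_spectrum by metis
  then show False
    using S choose_Suc_two_less_choose_three [OF n] choose_three_le [of k "card Y"] k
    by (simp add: k_def)
qed

text \<open>
  Each pair \<open>q\<close> or each complement of a pair, \<open>c q\<close>, is a weight. It occurs on one orbit only, as
  otherwise all of them occur on two and there are \<open>2 * (card Y choose 2)\<close> elements in the
  spectrum. If two pairs had
  the same orbit, moving them around by permutations shows that all pairs do; that orbit has all sets of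
  size two or four as weights, which is again too much. So the orbits of the pairs are
  distinct, and as each has the empty weight as well, there are once more \<open>2 * (card Y choose 2)\<close> elements.
\<close>
lemma pair_weights_large:
  assumes n: "6 \<le> card Y" and S: "card S \<le> Suc (card Y) choose 2"
    and s0: "s0 \<in> S" and K0: "K0 \<in> weights s0"
  shows "\<not> (card K0 = 2 \<or> card K0 + 2 = card Y)"
proof
  assume k0: "card K0 = 2 \<or> card K0 + 2 = card Y"
  define c where "c q = (if card K0 = 2 then q else Y - q)" for q
  let ?C = "{q. q \<subseteq> Y \<and> card q = 2}"
  have S': "card S \<le> (card Y choose 2) + card Y" "card Y < card Y choose 2"
    using S choose_Suc_two less_choose_two [OF n] by auto
  have finC: "finite ?C" "card ?C = card Y choose 2" using finite_subsets card_subsets by auto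
  have c: "c q \<subseteq> Y" "card (c q) = card K0" if "q \<in> ?C" for q
    using that k0 finite_sub [of q] by (auto simp: c_def card_Diff_subset)
  have c_inj: "q = q'" if "c q = c q'" "q \<in> ?C" "q' \<in> ?C" for q q'
    using that by (auto simp: c_def split: if_splits)
  have c_diff: "c q \<triangle> c q' = q \<triangle> q'" if "q \<in> ?C" "q' \<in> ?C" for q q'
    using that by (auto simp: c_def)
  have c_perm: "\<pi> ` c q = c (\<pi> ` q)" if "\<pi> permutes Y" for \<pi> q
    using permutes_image [OF that] image_set_diff [OF permutes_inj [OF that]] by (simp add: c_def)
  have "\<forall>q\<in>?C. \<exists>s\<in>S. c q \<in> weights s"
    using weights_of_same_size [OF s0 K0] c by blast
  then obtain \<sigma> where \<sigma>: "\<And>q. q \<in> ?C \<Longrightarrow> \<sigma> q \<in> S \<and> c q \<in> weights (\<sigma> q)" by metis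
  have unique: "orb s = orb t" if st: "s \<in> S" "t \<in> S" "c q \<in> weights s" "c q \<in> weights t" and q: "q \<in> ?C" for s t q
  proof (rule ccontr)
    assume ne: "orb s \<noteq> orb t"
    have "\<forall>q'\<in>?C. \<exists>p. fst p \<in> S \<and> snd p \<in> S \<and> c q' \<in> weights (fst p)
      \<and> c q' \<in> weights (snd p) \<and> orb (fst p) \<noteq> orb (snd p)"
    proof
      fix q' assume q': "q' \<in> ?C"
      obtain \<pi> where \<pi>: "\<pi> permutes Y" "\<pi> ` q = q'"
        using permutation_of_sets [OF finite_Y, of q q'] q q' by auto
      obtain g where g: "\<And>s. s \<in> S \<Longrightarrow> g s \<in> S"
        "\<And>s K. s \<in> S \<Longrightarrow> K \<in> weights s \<Longrightarrow> \<pi> ` K \<in> weights (g s)"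
        "\<And>s t. s \<in> S \<Longrightarrow> t \<in> S \<Longrightarrow> orb (g s) = orb (g t) \<longleftrightarrow> orb s = orb t"
        using permute_spectrum [OF \<pi>(1)] by metis
      have "c q' \<in> weights (g s)" "c q' \<in> weights (g t)" "orb (g s) \<noteq> orb (g t)"
        using g(2) [OF st(1,3)] g(2) [OF st(2,4)] g(3) [OF st(1,2)] ne
        by (simp_all add: c_perm [OF \<pi>(1)] \<pi>(2))
      then show "\<exists>p. fst p \<in> S \<and> snd p \<in> S \<and> c q' \<in> weights (fst p)
        \<and> c q' \<in> weights (snd p) \<and> orb (fst p) \<noteq> orb (snd p)"
        using g(1) st(1,2) by (intro exI [of _ "(g s, g t)"]) simp
    qed
    from bchoice [OF this] obtain \<tau> where \<tau>: "\<forall>q\<in>?C. fst (\<tau> q) \<in> S \<and> snd (\<tau> q) \<in> S \<and> c q \<in> weights (fst (\<tau> q))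
      \<and> c q \<in> weights (snd (\<tau> q)) \<and> orb (fst (\<tau> q)) \<noteq> orb (snd (\<tau> q))" ..
    define \<sigma>1 \<sigma>2 where "\<sigma>1 q = fst (\<tau> q)" and "\<sigma>2 q = snd (\<tau> q)" for q
    have \<sigma>12: "\<sigma>1 q \<in> S \<and> \<sigma>2 q \<in> S \<and> c q \<in> weights (\<sigma>1 q)
      \<and> c q \<in> weights (\<sigma>2 q) \<and> orb (\<sigma>1 q) \<noteq> orb (\<sigma>2 q)" if "q \<in> ?C" for q
      using \<tau> that by (simp add: \<sigma>1_def \<sigma>2_def)
    let ?Q = "\<lambda>\<sigma>. (\<lambda>q. (orb (\<sigma> q), c q)) ` ?C"
    have "inj_on (\<lambda>q. (orb (\<sigma> q), c q)) ?C" for \<sigma> :: "'a set \<Rightarrow> 'b"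
      by (rule inj_onI) (use c_inj in auto)
    then have card: "card (?Q \<sigma>) = card Y choose 2" for \<sigma> :: "'a set \<Rightarrow> 'b"
      using finC by (simp add: card_image)
    have "?Q \<sigma>1 \<inter> ?Q \<sigma>2 = {}" using \<sigma>12 c_inj by auto
    then have "card (?Q \<sigma>1 \<union> ?Q \<sigma>2) = 2 * (card Y choose 2)"
      using finC(1) card by (simp add: card_Un_disjoint)
    moreover have "?Q \<sigma>1 \<subseteq> spectrum" "?Q \<sigma>2 \<subseteq> spectrum"
      by (rule image_subsetI; use \<sigma>12 in \<open>unfold spectrum_def, blast\<close>)+
    then have "card (?Q \<sigma>1 \<union> ?Q \<sigma>2) \<le> card S" by (intro card_le_spectrum Un_least)
    ultimately show False using S' by linarith
  qed
  define \<rho> where "\<rho> q = orb (\<sigma> q)" for q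
  have move: "\<rho> (\<pi> ` q) = \<rho> (\<pi> ` q')" if eq: "\<rho> q = \<rho> q'" and q: "q \<in> ?C" "q' \<in> ?C" and \<pi>: "\<pi> permutes Y" for \<pi> q q'
  proof -
    obtain g where g: "\<And>s. s \<in> S \<Longrightarrow> g s \<in> S"
      "\<And>s K. s \<in> S \<Longrightarrow> K \<in> weights s \<Longrightarrow> \<pi> ` K \<in> weights (g s)"
      "\<And>s t. s \<in> S \<Longrightarrow> t \<in> S \<Longrightarrow> orb (g s) = orb (g t) \<longleftrightarrow> orb s = orb t"
      using permute_spectrum [OF \<pi>] by metis
    have "\<rho> (\<pi> ` q) = orb (g (\<sigma> q))" if "q \<in> ?C" for q
    proof -
      have "\<pi> ` q \<in> ?C"
        using that permutes_image [OF \<pi>] card_image [OF inj_on_subset [OF permutes_inj [OF \<pi>] subset_UNIV], of q] by auto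
      moreover from this have "\<sigma> (\<pi> ` q) \<in> S" "c (\<pi> ` q) \<in> weights (\<sigma> (\<pi> ` q))"
        using \<sigma> by blast+
      moreover have "g (\<sigma> q) \<in> S" "c (\<pi> ` q) \<in> weights (g (\<sigma> q))"
        using g(1,2) \<sigma> [OF that] by (auto simp flip: c_perm [OF \<pi>])
      ultimately show ?thesis unfolding \<rho>_def by (intro unique)
    qed
    then show ?thesis using q eq g(3) \<sigma> by (simp add: \<rho>_def)
  qed
  have pair: "{a, b} \<in> ?C" if "a \<in> Y" "b \<in> Y" "a \<noteq> b" for a b
    using that by simp
  have adjacent: "\<rho> {a, b} \<noteq> \<rho> {a, d}" if abd: "a \<in> Y" "b \<in> Y" "d \<in> Y" "a \<noteq> b" "a \<noteq> d" "b \<noteq> d" for a b d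
  proof
    assume eq: "\<rho> {a, b} = \<rho> {a, d}"
    have adj: "\<rho> {x, y} = \<rho> {x, z}" if xyz: "x \<in> Y" "y \<in> Y" "z \<in> Y" "x \<noteq> y" "x \<noteq> z" for x y z
    proof (cases "y = z")
      case False
      \<comment> \<open>A permutation sending \<open>a\<close>, \<open>b\<close>, \<open>d\<close> to \<open>x\<close>, \<open>y\<close>, \<open>z\<close>.\<close>
      let ?p = "(\<lambda>_. x)(b := y, d := z)"
      have "inj_on ?p {a, b, d}" "?p ` {a, b, d} \<subseteq> Y"
        using abd xyz False by (auto simp: inj_on_def)
      then obtain \<pi> where \<pi>: "\<pi> permutes Y" "\<And>u. u \<in> {a, b, d} \<Longrightarrow> \<pi> u = ?p u"
        using permutation_extending [OF finite_Y, of "{a, b, d}"] abd by (metis empty_subsetI insert_subset)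
      then have "\<pi> ` {a, b} = {x, y}" "\<pi> ` {a, d} = {x, z}" using abd by auto
      then show ?thesis using move [OF eq pair pair \<pi>(1)] abd by simp
    qed simp
    define R where "R = \<rho> {a, b}"
    have all: "\<rho> q = R" if q: "q \<in> ?C" for q
    proof -
      obtain u v where uv: "q = {u, v}" "u \<noteq> v" "u \<in> Y" "v \<in> Y"
        using q by (auto simp: card_2_iff)
      show ?thesis
      proof (cases "u = a")
        case True
        then show ?thesis using adj [of a v b] uv abd by (simp add: R_def)
      next
        case False
        then have "\<rho> {u, v} = \<rho> {a, u}" using adj [of u v a] uv abd by (simp add: insert_commute)
        also have "\<dots> = R" using adj [of a u b] False uv abd by (simp add: R_def)
        finally show ?thesis by (simp add: uv)
      qed
    qed
    define s where "s = \<sigma> {a, b}"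
    have sS: "s \<in> S" "orb s = R" using \<sigma> [OF pair] abd by (auto simp: s_def R_def \<rho>_def)
    have cs: "c q \<in> weights s" if "q \<in> ?C" for q
      using \<sigma> [OF that] all [OF that] orb_eqD [of "\<sigma> q" s] sS by (auto simp: \<rho>_def)
    have sd: "q \<triangle> q' \<in> weights s" if "q \<in> ?C" "q' \<in> ?C" for q q'
      using weights_symdiff [OF cs [OF that(1)] cs [OF that(2)]] by (simp only: c_diff [OF that])
    have two: "q \<in> weights s" if q: "q \<in> ?C" for q
    proof -
      obtain u v where uv: "q = {u, v}" "u \<noteq> v" "u \<in> Y" "v \<in> Y"
        using q by (auto simp: card_2_iff)
      have "card (Y - q) > 0" using n q finite_sub [of q] by (simp add: card_Diff_subset)
      then obtain x where x: "x \<in> Y" "x \<notin> q" by (metis DiffE card_gt_0_iff ex_in_conv)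
      have "{x, u} \<triangle> {x, v} \<in> weights s"
        by (rule sd [OF pair pair]) (use uv x in auto)
      moreover have "{x, u} \<triangle> {x, v} = q" using uv x by auto
      ultimately show ?thesis by (simp only:)
    qed
    have four: "q \<in> weights s" if q: "q \<subseteq> Y" "card q = 4" for q
    proof -
      have "2 \<le> card q" using q by simp
      then obtain q1 where q1: "q1 \<subseteq> q" "card q1 = 2"
        by (rule obtain_subset_with_card_n)
      have "finite q1" using q1 finite_sub [OF q(1)] finite_subset by blast
      then have "card (q - q1) = 2" using q1 q by (simp add: card_Diff_subset)
      then have "q - q1 \<in> ?C" "q1 \<in> ?C" using q1 q by auto
      then have "q1 \<triangle> (q - q1) \<in> weights s" by (intro sd)
      moreover have "q1 \<triangle> (q - q1) = q" using q1 by auto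
      ultimately show ?thesis by (simp only:)
    qed
    let ?D = "{J. J \<subseteq> Y \<and> card J = 4}"
    have "?C \<subseteq> weights s" "?D \<subseteq> weights s" "{{}} \<subseteq> weights s"
      using two four weights_empty [of s] by blast+
    then have "{{}} \<union> (?C \<union> ?D) \<subseteq> weights s" by (intro Un_least)
    then have "{orb s} \<times> ({{}} \<union> (?C \<union> ?D)) \<subseteq> spectrum"
      using sS(1) unfolding spectrum_def by blast
    then have "card ({orb s} \<times> ({{}} \<union> (?C \<union> ?D))) \<le> card S" by (rule card_le_spectrum)
    then have "card ({{}} \<union> (?C \<union> ?D)) \<le> card S" by (simp only: card_cartesian_product_singleton)
    moreover have "card ({{}} \<union> (?C \<union> ?D)) = Suc ((card Y choose 2) + (card Y choose 4))"
    proof -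
      have "card (?C \<union> ?D) = (card Y choose 2) + (card Y choose 4)"
      proof -
        have "?C \<inter> ?D = {}" by auto
        then have "card (?C \<union> ?D) = card ?C + card ?D"
          by (rule card_Un_disjoint [OF finite_subsets finite_subsets])
        then show ?thesis by (simp only: card_subsets)
      qed
      moreover have "finite (?C \<union> ?D)" by (intro finite_UnI finite_subsets)
      moreover have "{} \<notin> ?C \<union> ?D" by simp
      ultimately have "card (insert {} (?C \<union> ?D)) = Suc ((card Y choose 2) + (card Y choose 4))"
        by (subst card_insert_disjoint) simp_all
      then show ?thesis by (simp only: insert_is_Un [symmetric])
    qed
    ultimately show False using S' le_choose_four [OF n] by linarith
  qed
  have inj: "\<rho> q \<noteq> \<rho> q'" if q: "q \<in> ?C" "q' \<in> ?C" "q \<noteq> q'" for q q'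
  proof
    assume eq: "\<rho> q = \<rho> q'"
    obtain a b where ab: "q = {a, b}" "a \<noteq> b" "a \<in> Y" "b \<in> Y" using q(1) by (auto simp: card_2_iff)
    obtain u v where uv: "q' = {u, v}" "u \<noteq> v" "u \<in> Y" "v \<in> Y" using q(2) by (auto simp: card_2_iff)
    show False
    proof (cases "q \<inter> q' = {}")
      case False
      then obtain x y z where "q = {x, y}" "q' = {x, z}" using ab uv by (auto simp: doubleton_eq_iff)
      then show False using adjacent [of x y z] q eq by (auto simp: card_insert_if split: if_splits)
    next
      case True
      have dist: "a \<noteq> u" "a \<noteq> v" "b \<noteq> u" "b \<noteq> v" using True ab uv by auto
      have "card {a, b, u, v} \<le> 4" using card_insert_le_m1 by (simp add: card_insert_if)
      then have "card (Y - {a, b, u, v}) > 0"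
        using n ab uv by (subst card_Diff_subset) auto
      then obtain w where w: "w \<in> Y" "w \<notin> {a, b, u, v}" by (metis DiffE card_gt_0_iff ex_in_conv)
      have move': "\<rho> {v, w} = \<rho> {x, y}" if xy: "x \<in> Y" "y \<in> Y" "x \<noteq> y" "x \<notin> {v, w}" "y \<notin> {v, w}" for x y
      proof -
        \<comment> \<open>It moves \<open>q\<close> to \<open>{x, y}\<close> and \<open>q'\<close> to \<open>{v, w}\<close>.\<close>
        let ?p = "(\<lambda>_. w)(a := x, b := y, u := v)"
        have "inj_on ?p {a, b, u, v}" "?p ` {a, b, u, v} \<subseteq> Y"
          using ab uv w xy dist by (auto simp: inj_on_def)
        then obtain \<pi> where \<pi>: "\<pi> permutes Y" "\<And>z. z \<in> {a, b, u, v} \<Longrightarrow> \<pi> z = ?p z"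
          using permutation_extending [OF finite_Y, of "{a, b, u, v}"] ab uv by (metis empty_subsetI insert_subset)
        then have "\<pi> ` q = {x, y}" "\<pi> ` q' = {v, w}" using ab uv dist by auto
        then show ?thesis using move [OF eq q(1,2) \<pi>(1)] by simp
      qed
      \<comment> \<open>Both pairs are disjoint from \<open>{v, w}\<close>, but they share \<open>a\<close>.\<close>
      have "\<rho> {a, b} = \<rho> {a, u}" using move' [of a b] move' [of a u] ab uv w dist by auto
      then show False using adjacent [of a b u] ab uv dist by simp
    qed
  qed
  let ?Q1 = "(\<lambda>q. (\<rho> q, {} :: 'a set)) ` ?C" and ?Q2 = "(\<lambda>q. (\<rho> q, c q)) ` ?C"
  have "inj_on (\<lambda>q. (\<rho> q, {} :: 'a set)) ?C" "inj_on (\<lambda>q. (\<rho> q, c q)) ?C"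
    by (rule inj_onI; use inj in blast)+
  then have "card ?Q1 = card Y choose 2" "card ?Q2 = card Y choose 2"
    using finC by (simp_all add: card_image)
  moreover have "?Q1 \<inter> ?Q2 = {}"
  proof -
    have "c q \<noteq> {}" if "q \<in> ?C" for q using c(2) [OF that] k0 n by auto
    then show ?thesis by blast
  qed
  ultimately have "card (?Q1 \<union> ?Q2) = 2 * (card Y choose 2)"
    using finC(1) by (simp add: card_Un_disjoint)
  moreover have "?Q1 \<subseteq> spectrum" "?Q2 \<subseteq> spectrum"
    by (rule image_subsetI; use \<sigma> weights_empty in \<open>unfold spectrum_def \<rho>_def, blast\<close>)+
  then have "card (?Q1 \<union> ?Q2) \<le> card S" by (intro card_le_spectrum Un_least)
  ultimately show False using S' by linarith
qed

text \<open>
  Only the weights \<open>{}\<close>, \<open>Y\<close>, \<open>{i}\<close> and \<open>Y - {i}\<close> are left, and at one point only one \<open>i\<close> can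
  occur, because the symmetric difference for two of them has size \<open>2\<close> or \<open>card Y - 2\<close>. The product of
  \<open>f j\<close> and \<open>f k\<close> fixes \<open>s\<close> exactly if no weight separates \<open>j\<close> from \<open>k\<close>.
\<close>
theorem involution_dichotomy:
  assumes n: "6 \<le> card Y" and S: "card S \<le> Suc (card Y) choose 2" and s: "s \<in> S"
  shows "(\<forall>j\<in>Y. \<forall>k\<in>Y. j \<noteq> k \<longrightarrow> f j (f k s) = s)
    \<or> (\<exists>i\<in>Y. \<forall>j\<in>Y. \<forall>k\<in>Y. j \<noteq> k \<longrightarrow> (f j (f k s) = s \<longleftrightarrow> i \<notin> {j, k}))"
proof -
  have small: "card K \<le> 1 \<or> card Y \<le> card K + 1" if "K \<in> weights s" for K
    using middle_weights_large [OF n S s that] pair_weights_large [OF n S s that] by linarith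
  have shape: "K = {} \<or> K = Y \<or> (\<exists>i\<in>Y. K = {i} \<or> K = Y - {i})" if K: "K \<in> weights s" for K
  proof -
    have KY: "K \<subseteq> Y" "finite K" using weights_subset [OF K] finite_sub by auto
    have "card (Y - K) = card Y - card K" using KY by (simp add: card_Diff_subset)
    with small [OF K] have "card K = 0 \<or> card K = 1 \<or> card (Y - K) = 0 \<or> card (Y - K) = 1" by linarith
    moreover have "card K = 0 \<Longrightarrow> K = {}" using KY by simp
    moreover have "card K = 1 \<Longrightarrow> \<exists>i\<in>Y. K = {i}" using KY by (auto simp: card_1_singleton_iff)
    moreover have "card (Y - K) = 0 \<Longrightarrow> K = Y" using KY finite_Y by auto
    moreover have "\<exists>i\<in>Y. K = Y - {i}" if "card (Y - K) = 1"
    proof -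
      obtain i where "Y - K = {i}" using \<open>card (Y - K) = 1\<close> by (auto simp: card_1_singleton_iff)
      then have "i \<in> Y" "K = Y - {i}" using KY by auto
      then show ?thesis by blast
    qed
    ultimately show ?thesis by blast
  qed
  have fixed: "f j (f k s) = s" if jk: "j \<in> Y" "k \<in> Y" "j \<noteq> k"
    and even: "\<And>K. K \<in> weights s \<Longrightarrow> j \<in> K \<longleftrightarrow> k \<in> K" for j k
  proof -
    have "act {j, k} s = s"
    proof (rule fixed_by_weights)
      fix K assume K: "K \<in> weights s"
      have "{j, k} \<inter> K = (if j \<in> K then {j, k} else {})" using even [OF K] by auto
      then show "even (card ({j, k} \<inter> K))" using jk by simp
    qed (use jk in simp)
    then show ?thesis using jk by (simp add: act_pair)
  qed
  have moved: "f j (f k s) \<noteq> s" if jk: "j \<in> Y" "k \<in> Y" "j \<noteq> k" and K: "K \<in> weights s" "(j \<in> K) \<noteq> (k \<in> K)" for j k K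
  proof
    assume "f j (f k s) = s"
    then have "even (card ({j, k} \<inter> K))" using weights_even [OF K(1), of "{j, k}"] jk by (simp add: act_pair)
    moreover have "{j, k} \<inter> K = (if j \<in> K then {j} else {k})" using K(2) by auto
    ultimately show False by (simp split: if_splits)
  qed
  show ?thesis
  proof (cases "\<exists>K\<in>weights s. K \<noteq> {} \<and> K \<noteq> Y")
    case False
    then show ?thesis using fixed by (intro disjI1 ballI impI) blast
  next
    case True
    then obtain K i where K: "K \<in> weights s" "i \<in> Y" "K = {i} \<or> K = Y - {i}" using shape by blast
    have same: "j \<in> K' \<longleftrightarrow> k \<in> K'" if jk: "j \<in> Y" "k \<in> Y" "i \<notin> {j, k}" and K': "K' \<in> weights s" for j k K'
    proof (rule ccontr)
      assume odd: "(j \<in> K') \<noteq> (k \<in> K')"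
      then have "K' \<noteq> {}" "K' \<noteq> Y" using jk by auto
      then obtain i' where i': "i' \<in> Y" "K' = {i'} \<or> K' = Y - {i'}" using shape [OF K'] by blast
      have "i \<noteq> i'" using odd i' jk by auto
      have "K \<triangle> K' = {i, i'} \<or> K \<triangle> K' = Y - {i, i'}"
        using K(2,3) i' \<open>i \<noteq> i'\<close> by auto
      moreover have "K \<triangle> K' \<in> weights s" by (rule weights_symdiff [OF K(1) K'])
      moreover have "card {i, i'} = 2" using \<open>i \<noteq> i'\<close> by simp
      moreover have "card (Y - {i, i'}) = card Y - 2" using \<open>i \<noteq> i'\<close> i' K(2) by (subst card_Diff_subset) auto
      ultimately have c2: "K \<triangle> K' = {i, i'} \<or> K \<triangle> K' = Y - {i, i'}" "K \<triangle> K' \<in> weights s"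
        "card {i, i'} = 2" "card (Y - {i, i'}) = card Y - 2" by blast+
      from c2(1) show False
      proof
        assume "K \<triangle> K' = {i, i'}"
        then have "{i, i'} \<in> weights s" using c2(2) by (simp only:)
        then show False using small [of "{i, i'}"] c2(3) n by linarith
      next
        assume "K \<triangle> K' = Y - {i, i'}"
        then have "Y - {i, i'} \<in> weights s" using c2(2) by (simp only:)
        then show False using small [of "Y - {i, i'}"] c2(4) n by linarith
      qed
    qed
    have "f j (f k s) = s" if "j \<in> Y" "k \<in> Y" "j \<noteq> k" "i \<notin> {j, k}" for j k
      using same [OF that(1,2,4)] by (rule fixed [OF that(1-3)])
    moreover have "f j (f k s) \<noteq> s" if "j \<in> Y" "k \<in> Y" "j \<noteq> k" "i \<in> {j, k}" for j k
    proof (rule moved [OF that(1-3) K(1)])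
      show "(j \<in> K) \<noteq> (k \<in> K)" using K(3) that by blast
    qed
    ultimately show ?thesis using K(2) by meson
  qed
qed

end

section \<open>Decomposition under sign changes\<close>
lemma choose_two_less_power: "6 \<le> n \<Longrightarrow> Suc n choose 2 < 2 ^ (n - 1)"
proof (induction n rule: dec_induct)
  case base
  then show ?case by (simp add: numeral_eq_Suc)
next
  case (step n)
  have "Suc (Suc n) choose 2 = (Suc n choose 2) + Suc n" by (rule choose_Suc_two)
  moreover have "Suc n \<le> Suc n choose 2" using step choose_Suc_two [of n] less_choose_two [of n] by linarith
  moreover have "(2::nat) ^ (Suc n - 1) = 2 * 2 ^ (n - 1)" using step by (cases n) auto
  ultimately show ?case using step by linarith
qed

lemma Suc_less_power: "6 \<le> n \<Longrightarrow> n + 1 < 2 ^ (n - 2)"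
proof (induction n rule: dec_induct)
  case (step n)
  have "(2::nat) ^ (Suc n - 2) = 2 * 2 ^ (n - 2)" using step by (cases n; cases "n - 1") auto
  then show ?case using step by linarith
qed simp

text \<open>
  The combinatorial core of the final count, used twice in dual situations. Read \<open>M i j\<close> as: the
  transvection of the pair takes a given point out of the trivial part; and \<open>Fx i j\<close> as: it fixes
  that point. The assumption \<open>comp\<close> comes from the commutator relation.
\<close>
lemma same_pair:
  fixes Fx M :: "'i \<Rightarrow> 'i \<Rightarrow> bool"
  assumes ne: "\<And>i j. M i j \<Longrightarrow> i \<noteq> j \<and> i \<in> A \<and> j \<in> A"
    and moved: "\<And>i j. M i j \<Longrightarrow> \<not> Fx i j"
    and comp: "\<And>i k j. i \<in> A \<Longrightarrow> j \<in> A \<Longrightarrow> k \<in> A \<Longrightarrow> i \<noteq> j \<Longrightarrow> i \<noteq> k \<Longrightarrow> k \<noteq> j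
      \<Longrightarrow> Fx i k \<Longrightarrow> Fx k j \<Longrightarrow> Fx i j"
    and fixed: "\<And>i j k l. M i j \<Longrightarrow> k \<in> A \<Longrightarrow> l \<in> A \<Longrightarrow> k \<notin> {i, j} \<Longrightarrow> l \<noteq> i \<Longrightarrow> l \<noteq> k \<Longrightarrow> Fx k l"
    and row: "\<And>i j l. M i j \<Longrightarrow> M i l \<Longrightarrow> j = l"
    and ij: "M i j" and kl: "M k l"
  shows "{i, j} = {k, l}"
proof -
  note n = ne [OF ij] ne [OF kl]
  consider "k = i" | "k = j" "l = i" | "k = j" "l \<noteq> i" | "k \<notin> {i, j}" "l = i" | "k \<notin> {i, j}" "l \<noteq> i"
    by blast
  then show ?thesis
  proof cases
    case 1
    then show ?thesis using row ij kl by blast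
  next
    case 2
    then show ?thesis by blast
  next
    case 3
    have "Fx l j" by (rule fixed [OF ij]) (use 3 n in auto)
    moreover have "Fx i l" by (rule fixed [OF kl]) (use 3 n in auto)
    ultimately have "Fx i j" by (intro comp [of i j l]) (use 3 n in auto)
    then show ?thesis using moved [OF ij] by blast
  next
    case 4
    have "Fx k j" by (rule fixed [OF ij]) (use 4 n in auto)
    moreover have "Fx j l" by (rule fixed [OF kl]) (use 4 n in auto)
    ultimately have "Fx k l" by (intro comp [of k l j]) (use 4 n in auto)
    then show ?thesis using moved [OF kl] by blast
  next
    case 5
    then have "Fx k l" by (intro fixed [OF ij]) (use n in auto)
    then show ?thesis using moved [OF kl] by blast
  qed
qed

text \<open>
  The maps \<open>\<Psi> \<alpha>\<close> are defined on the whole type, so that the relations between automorphisms become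
  equations of functions.
\<close>
locale aut_action = finite_free_automorphisms A for A :: "'a set" +
  fixes S :: "'s set" and \<Psi> :: "('a letter list \<Rightarrow> 'a letter list) \<Rightarrow> 's \<Rightarrow> 's"
  assumes finite_S: "finite S"
    and closed: "\<alpha> \<in> auto F \<Longrightarrow> s \<in> S \<Longrightarrow> \<Psi> \<alpha> s \<in> S"
    and \<Psi>_mult: "\<alpha> \<in> auto F \<Longrightarrow> \<beta> \<in> auto F \<Longrightarrow> \<Psi> (\<alpha> \<otimes>\<^bsub>AF\<^esub> \<beta>) s = \<Psi> \<alpha> (\<Psi> \<beta> s)"
    and \<Psi>_one: "\<Psi> \<one>\<^bsub>AF\<^esub> s = s"
    and rank: "6 \<le> card A"
    and small: "card S \<le> Suc (card A) choose 2"
begin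

definition t :: "'a letter \<Rightarrow> 'a letter \<Rightarrow> 's \<Rightarrow> 's" where "t x y = \<Psi> (transvection x y)"
definition g :: "('a letter \<Rightarrow> 'a letter) \<Rightarrow> 's \<Rightarrow> 's" where "g w = \<Psi> (relabel w)"

definition admissible :: "'a letter \<Rightarrow> 'a letter \<Rightarrow> bool"
  where "admissible x y \<longleftrightarrow> x \<in> L \<and> y \<in> L \<and> fst x \<noteq> fst y"

lemma t_closed: "admissible x y \<Longrightarrow> s \<in> S \<Longrightarrow> t x y s \<in> S"
  by (simp add: t_def closed transvection_auto admissible_def)

lemma g_closed: "w \<in> signed_perms \<Longrightarrow> s \<in> S \<Longrightarrow> g w s \<in> S"
  by (simp add: g_def closed relabel_auto)

lemma admissible_inv [simp]:
  "admissible x (inv_letter y) \<longleftrightarrow> admissible x y" "admissible (inv_letter x) y \<longleftrightarrow> admissible x y"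
  by (auto simp: admissible_def simp del: mem_Sigma_iff)

lemma t_inv:
  assumes "admissible x y"
  shows "t x y (t x (inv_letter y) s) = s" "t x (inv_letter y) (t x y s) = s"
proof -
  have *: "t x y (t x (inv_letter y) s) = s" if "admissible x y" for y
    using that \<Psi>_mult [of "transvection x y" "transvection x (inv_letter y)" s]
    by (simp add: t_def admissible_def transvection_auto transvection_inv_mult \<Psi>_one)
  from *[of y] * [of "inv_letter y"] assms
  show "t x y (t x (inv_letter y) s) = s" "t x (inv_letter y) (t x y s) = s" by simp_all
qed

lemma t_inj: "admissible x y \<Longrightarrow> t x y s = t x y s' \<longleftrightarrow> s = s'"
  using t_inv(2) by metis

lemma t_commute:
  assumes "admissible x y" "admissible z u" "z \<noteq> x" "fst z \<noteq> fst y" "fst u \<noteq> fst x"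
  shows "t x y (t z u s) = t z u (t x y s)"
  using \<Psi>_mult [of "transvection x y" "transvection z u" s]
    \<Psi>_mult [of "transvection z u" "transvection x y" s]
    transvection_commute [of x y z u] assms
  by (simp add: t_def admissible_def transvection_auto)

lemma t_commutator:
  assumes "admissible x y" "admissible y z" "admissible x z"
  shows "t y z (t x y s) = t x y (t y z (t x z s))"
  using \<Psi>_mult [of "transvection y z" "transvection x y" s]
    \<Psi>_mult [of "transvection x y" "transvection y z \<otimes>\<^bsub>AF\<^esub> transvection x z" s]
    \<Psi>_mult [of "transvection y z" "transvection x z" s]
    transvection_commutator [of x y z] assms
  by (simp add: t_def admissible_def transvection_auto AF_mult_closed)

lemma g_comp: "v \<in> signed_perms \<Longrightarrow> w \<in> signed_perms \<Longrightarrow> g v (g w s) = g (v \<circ> w) s"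
  by (simp add: g_def relabel_comp \<Psi>_mult relabel_auto)

lemma g_id: "g id s = s"
proof -
  have "id \<in> signed_perms" by (simp add: signed_perms_def permutes_id)
  then have "relabel id = \<one>\<^bsub>AF\<^esub>"
    by (intro auto_eqI) (auto simp: relabel_auto AF_one_closed relabel_letter AF_one)
  then show ?thesis by (simp add: g_def \<Psi>_one)
qed

lemma g_t:
  assumes "w \<in> signed_perms" "admissible x y"
  shows "g w (t x y s) = t (w x) (w y) (g w s)"
proof -
  have "w x \<in> L" "w y \<in> L" "fst (w x) \<noteq> fst (w y)"
    using assms signed_permsD [OF assms(1)] by (auto simp: admissible_def)
  then show ?thesis
    using \<Psi>_mult [of "relabel w" "transvection x y" s]
      \<Psi>_mult [of "transvection (w x) (w y)" "relabel w" s] relabel_transvection [of w x y] assms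
    by (simp add: t_def g_def admissible_def transvection_auto relabel_auto)
qed

lemma g_weyl:
  assumes "admissible x y"
  shows "g (letter_swap x y \<circ> letter_swap y (inv_letter y)) s
    = t x y (t y (inv_letter x) (t (inv_letter x) (inv_letter y) s))"
proof -
  have xy: "x \<in> L" "y \<in> L" "fst x \<noteq> fst y" using assms by (auto simp: admissible_def)
  have a: "transvection x y \<in> auto F" "transvection y (inv_letter x) \<in> auto F"
    "transvection (inv_letter x) (inv_letter y) \<in> auto F"
    using xy by (auto intro!: transvection_auto simp del: mem_Sigma_iff)
  show ?thesis
    using \<Psi>_mult [OF a(1) AF_mult_closed [OF a(2,3)], of s] \<Psi>_mult [OF a(2,3), of s]
    by (simp add: t_def g_def weyl_relation [OF xy])
qed

definition flip :: "'a \<Rightarrow> 'a letter \<Rightarrow> 'a letter"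
  where "flip j x = (if fst x = j then inv_letter x else x)"

definition e :: "'a \<Rightarrow> 's \<Rightarrow> 's" where "e j = g (flip j)"

lemma flip_eq: "flip (fst y) = letter_swap y (inv_letter y)"
proof
  fix x
  show "flip (fst y) x = letter_swap y (inv_letter y) x"
  proof (cases "fst x = fst y")
    case True
    then consider "x = y" | "x = inv_letter y" using fst_eq_cases by blast
    then show ?thesis by cases (simp_all add: flip_def letter_swap_def)
  next
    case False
    then have "x \<noteq> y" "x \<noteq> inv_letter y" by auto
    then show ?thesis using False by (simp add: flip_def letter_swap_def)
  qed
qed

lemma flip_signed: "j \<in> A \<Longrightarrow> flip j \<in> signed_perms"
  using flip_eq [of "(j, True)"] letter_swap_signed [of "(j, True)" "inv_letter (j, True)"] by simp

lemma fst_flip [simp]: "fst (flip j x) = fst x"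
  by (simp add: flip_def)

lemma flip_flip: "flip j (flip j x) = x"
  by (simp add: flip_def)

lemma e_e: "j \<in> A \<Longrightarrow> e j (e j s) = s"
proof -
  assume j: "j \<in> A"
  have "flip j \<circ> flip j = id" by (simp add: fun_eq_iff flip_flip)
  then show "e j (e j s) = s" using flip_signed [OF j] by (simp add: e_def g_comp g_id)
qed

lemma e_commute: "j \<in> A \<Longrightarrow> k \<in> A \<Longrightarrow> e j (e k s) = e k (e j s)"
proof -
  assume jk: "j \<in> A" "k \<in> A"
  have "flip j \<circ> flip k = flip k \<circ> flip j" by (simp add: fun_eq_iff flip_def)
  then show "e j (e k s) = e k (e j s)" using jk flip_signed by (simp add: e_def g_comp)
qed

lemma e_closed: "j \<in> A \<Longrightarrow> s \<in> S \<Longrightarrow> e j s \<in> S"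
  by (simp add: e_def g_closed flip_signed)

lemma admissible_flip [simp]: "admissible (flip j x) (flip k y) \<longleftrightarrow> admissible x y"
  by (simp add: flip_def)

lemma e_t: "j \<in> A \<Longrightarrow> admissible x y \<Longrightarrow> e j (t x y s) = t (flip j x) (flip j y) (e j s)"
  by (simp add: e_def g_t flip_signed)

definition lift :: "('a \<Rightarrow> 'a) \<Rightarrow> 'a letter \<Rightarrow> 'a letter" where "lift \<pi> x = (\<pi> (fst x), snd x)"

lemma lift_signed:
  assumes "\<pi> permutes A"
  shows "lift \<pi> \<in> signed_perms"
proof -
  have "bij_betw (lift \<pi>) L L"
    by (rule bij_betwI [where g = "lift (Hilbert_Choice.inv \<pi>)"])
      (use assms permutes_in_image [OF assms] permutes_in_image [OF permutes_inv [OF assms]]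
        permutes_inverses [OF assms] in \<open>auto simp: lift_def\<close>)
  moreover have "lift \<pi> x = x" if "x \<notin> L" for x
    using that assms by (cases x) (auto simp: lift_def permutes_not_in)
  ultimately have "lift \<pi> permutes L" by (rule bij_imp_permutes)
  then show ?thesis by (auto simp: signed_perms_def lift_def inv_letter_def)
qed

lemma lift_flip: "\<pi> permutes A \<Longrightarrow> lift \<pi> \<circ> flip j = flip (\<pi> j) \<circ> lift \<pi>"
  by (auto simp: fun_eq_iff lift_def flip_def inv_letter_def dest: permutes_inj injD)

lemma g_lift_e: "\<pi> permutes A \<Longrightarrow> j \<in> A \<Longrightarrow> g (lift \<pi>) (e j s) = e (\<pi> j) (g (lift \<pi>) s)"
  by (simp add: e_def g_comp lift_signed flip_signed lift_flip permutes_in_image)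

lemma g_inj:
  assumes "w \<in> signed_perms" "g w s = g w s'"
  shows "s = s'"
proof -
  have w: "Hilbert_Choice.inv w \<in> signed_perms" by (rule signed_perms_inv [OF assms(1)])
  have "Hilbert_Choice.inv w \<circ> w = id"
    using permutes_inv_o(2) [OF signed_permsD(1) [OF assms(1)]] .
  then have "g (Hilbert_Choice.inv w) (g w s) = s" for s
    by (simp add: g_comp w assms(1) g_id)
  then show ?thesis using assms(2) by metis
qed

sublocale E: symmetric_involutions A S e
proof
  show "finite A" by (rule finite_A)
  show "finite S" by (rule finite_S)
  fix \<pi> assume \<pi>: "\<pi> permutes A"
  show "\<exists>g. inj_on g S \<and> g ` S \<subseteq> S \<and> (\<forall>j\<in>A. \<forall>s\<in>S. g (e j s) = e (\<pi> j) (g s))"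
    using g_inj [OF lift_signed [OF \<pi>]] g_closed [OF lift_signed [OF \<pi>]] g_lift_e [OF \<pi>]
    by (intro exI [of _ "g (lift \<pi>)"]) (auto simp: inj_on_def)
qed (simp_all add: e_e e_commute e_closed)

definition d :: "'a \<Rightarrow> 'a \<Rightarrow> 's \<Rightarrow> 's" where "d j k s = e j (e k s)"

text \<open>
  The points on whose orbit under sign changes a weight \<open>{i}\<close> or \<open>A - {i}\<close> occurs.
\<close>
definition isotypic :: "'a \<Rightarrow> 's set"
  where "isotypic i = {s \<in> S. \<forall>j\<in>A. \<forall>k\<in>A. j \<noteq> k \<longrightarrow> (d j k s = s \<longleftrightarrow> i \<notin> {j, k})}"

definition trivial_part :: "'s set"
  where "trivial_part = {s \<in> S. \<forall>j\<in>A. \<forall>k\<in>A. j \<noteq> k \<longrightarrow> d j k s = s}"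

lemma parts: "s \<in> S \<Longrightarrow> s \<in> trivial_part \<or> (\<exists>i\<in>A. s \<in> isotypic i)"
  using E.involution_dichotomy [OF rank small, of s] by (auto simp: trivial_part_def isotypic_def d_def)

lemma isotypic_S: "s \<in> isotypic i \<Longrightarrow> s \<in> S"
  by (simp add: isotypic_def)

lemma trivial_S: "s \<in> trivial_part \<Longrightarrow> s \<in> S"
  by (simp add: trivial_part_def)

lemma fresh:
  assumes "length xs < 6"
  shows "\<exists>k\<in>A. k \<notin> set xs"
proof (rule ccontr)
  assume "\<not> ?thesis"
  then have "card A \<le> card (set xs)" by (intro card_mono) auto
  then show False using card_length [of xs] assms rank by linarith
qed

lemma d_moves: "s \<in> isotypic i \<Longrightarrow> i \<in> A \<Longrightarrow> k \<in> A \<Longrightarrow> k \<noteq> i \<Longrightarrow> d i k s \<noteq> s"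
  by (simp add: isotypic_def)

lemma d_fixes: "s \<in> isotypic i \<Longrightarrow> j \<in> A \<Longrightarrow> k \<in> A \<Longrightarrow> j \<noteq> k \<Longrightarrow> j \<noteq> i \<Longrightarrow> k \<noteq> i \<Longrightarrow> d j k s = s"
  by (simp add: isotypic_def)

lemma d_trivial: "s \<in> trivial_part \<Longrightarrow> j \<in> A \<Longrightarrow> k \<in> A \<Longrightarrow> j \<noteq> k \<Longrightarrow> d j k s = s"
  by (simp add: trivial_part_def)

lemma isotypic_unique:
  assumes "s \<in> isotypic i" "s \<in> isotypic j" "i \<in> A" "j \<in> A"
  shows "i = j"
proof (rule ccontr)
  assume ij: "i \<noteq> j"
  obtain k where k: "k \<in> A" "k \<notin> {i, j}" using fresh [of "[i, j]"] by auto
  then show False using d_moves [OF assms(1,3)] d_fixes [OF assms(2), of i k] assms ij by blast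
qed

lemma isotypic_not_trivial:
  assumes "s \<in> isotypic i" "i \<in> A"
  shows "s \<notin> trivial_part"
proof
  assume s: "s \<in> trivial_part"
  obtain k where k: "k \<in> A" "k \<notin> {i}" using fresh [of "[i]"] by auto
  then show False using d_moves [OF assms] d_trivial [OF s assms(2), of k] by blast
qed

lemma e_d: "i \<in> A \<Longrightarrow> j \<in> A \<Longrightarrow> k \<in> A \<Longrightarrow> e i (d j k s) = d j k (e i s)"
  by (simp add: d_def) (metis e_commute)

lemma e_inj: "j \<in> A \<Longrightarrow> e j s = e j s' \<longleftrightarrow> s = s'"
  using e_e by metis

lemma e_isotypic: "s \<in> isotypic i \<Longrightarrow> j \<in> A \<Longrightarrow> e j s \<in> isotypic i"
  by (simp add: isotypic_def e_closed e_inj flip: e_d)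

lemma d_isotypic: "s \<in> isotypic i \<Longrightarrow> j \<in> A \<Longrightarrow> k \<in> A \<Longrightarrow> d j k s \<in> isotypic i"
  by (simp add: d_def e_isotypic)

lemma g_d: "\<pi> permutes A \<Longrightarrow> j \<in> A \<Longrightarrow> k \<in> A \<Longrightarrow> g (lift \<pi>) (d j k s) = d (\<pi> j) (\<pi> k) (g (lift \<pi>) s)"
  by (simp add: d_def g_lift_e)

lemma g_d_iff:
  assumes "\<pi> permutes A" "j \<in> A" "k \<in> A"
  shows "d (\<pi> j) (\<pi> k) (g (lift \<pi>) s) = g (lift \<pi>) s \<longleftrightarrow> d j k s = s"
  using g_d [OF assms, of s] g_inj [OF lift_signed [OF assms(1)]] by metis

lemma g_parts:
  assumes \<pi>: "\<pi> permutes A" and s: "s \<in> S"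
  shows "s \<in> isotypic i \<Longrightarrow> i \<in> A \<Longrightarrow> g (lift \<pi>) s \<in> isotypic (\<pi> i)"
    "s \<in> trivial_part \<Longrightarrow> g (lift \<pi>) s \<in> trivial_part"
proof -
  have pre: "\<exists>j'\<in>A. j = \<pi> j'" if "j \<in> A" for j
    using that permutes_image [OF \<pi>] by (metis imageE)
  have inj: "\<pi> a = \<pi> b \<longleftrightarrow> a = b" for a b using permutes_inj [OF \<pi>] by (simp add: inj_eq)
  have c: "g (lift \<pi>) s \<in> S" using s by (simp add: g_closed lift_signed \<pi>)
  show "g (lift \<pi>) s \<in> trivial_part" if "s \<in> trivial_part"
    unfolding trivial_part_def
  proof (intro CollectI conjI ballI impI c)
    fix j k assume jk: "j \<in> A" "k \<in> A" "j \<noteq> k"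
    obtain j' k' where *: "j' \<in> A" "k' \<in> A" "j = \<pi> j'" "k = \<pi> k'" using pre jk by metis
    have "j' \<noteq> k'" using * jk by auto
    then show "d j k (g (lift \<pi>) s) = g (lift \<pi>) s"
      using g_d_iff [OF \<pi> *(1,2)] d_trivial [OF that *(1,2)] * by simp
  qed
  show "g (lift \<pi>) s \<in> isotypic (\<pi> i)" if "s \<in> isotypic i" "i \<in> A"
    unfolding isotypic_def
  proof (intro CollectI conjI ballI impI c)
    fix j k assume jk: "j \<in> A" "k \<in> A" "j \<noteq> k"
    obtain j' k' where *: "j' \<in> A" "k' \<in> A" "j = \<pi> j'" "k = \<pi> k'" using pre jk by metis
    show "d j k (g (lift \<pi>) s) = g (lift \<pi>) s \<longleftrightarrow> \<pi> i \<notin> {j, k}"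
      using that * jk by (auto simp: g_d_iff [OF \<pi>] inj isotypic_def)
  qed
qed

lemma d_t_commute:
  assumes "admissible x y" "j \<in> A" "k \<in> A" "j \<notin> {fst x, fst y}" "k \<notin> {fst x, fst y}"
  shows "d j k (t x y s) = t x y (d j k s)"
proof -
  have "flip j x = x" "flip j y = y" "flip k x = x" "flip k y = y"
    using assms by (auto simp: flip_def)
  then show ?thesis using assms by (simp add: d_def e_t)
qed

text \<open>
  The transvection commutes with the products of two sign changes which avoid its generators. These suffice to
  recognize the part of \<open>k\<close>: for two further generators \<open>l\<close> and \<open>m\<close>, only there do both
  \<open>d k l\<close> and \<open>d k m\<close> move points.
\<close>
lemma t_isotypic_other:
  assumes xy: "admissible x y" and k: "k \<in> A" "k \<noteq> fst x" "k \<noteq> fst y" and s: "s \<in> isotypic k"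
  shows "t x y s \<in> isotypic k"
proof -
  obtain l where l: "l \<in> A" "l \<notin> {fst x, fst y, k}"
    using fresh [of "[fst x, fst y, k]"] by auto
  obtain m where m: "m \<in> A" "m \<notin> {fst x, fst y, k, l}"
    using fresh [of "[fst x, fst y, k, l]"] by auto
  have tS: "t x y s \<in> S" using xy isotypic_S [OF s] by (rule t_closed)
  have eq: "d k l (t x y s) = t x y (d k l s)" "d k m (t x y s) = t x y (d k m s)"
    using d_t_commute [OF xy k(1) l(1)] d_t_commute [OF xy k(1) m(1)] k l m by auto
  have ne: "d k l (t x y s) \<noteq> t x y s" "d k m (t x y s) \<noteq> t x y s"
    unfolding eq t_inj [OF xy] using d_moves [OF s k(1)] l m by auto
  have "t x y s \<notin> trivial_part"
    using ne(1) d_trivial [of "t x y s" k l] k(1) l by auto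
  then obtain i where i: "i \<in> A" "t x y s \<in> isotypic i" using parts [OF tS] by blast
  have "i \<in> {k, l}" "i \<in> {k, m}"
    using ne d_fixes [OF i(2), of k l] d_fixes [OF i(2), of k m] k(1) l m by auto
  then have "i = k" using m l by auto
  then show ?thesis using i by simp
qed

lemma t_sign_second:
  assumes xy: "admissible x y" and m: "m \<in> A" "m \<noteq> fst x" "m \<noteq> fst y"
  shows "d (fst y) m (t x y s) = t x (inv_letter y) (d (fst y) m s)"
proof -
  have y: "fst y \<in> A" "fst x \<noteq> fst y" using xy by (auto simp: admissible_def)
  have "flip (fst y) x = x" "flip (fst y) y = inv_letter y" "flip m x = x" "flip m y = y"
    using m y by (auto simp: flip_def)
  then show ?thesis using xy m y by (simp add: d_def e_t)
qed

lemma t_sign_first: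
  assumes xy: "admissible x y" and m: "m \<in> A" "m \<noteq> fst x" "m \<noteq> fst y"
  shows "d (fst x) m (t x y s) = t (inv_letter x) y (d (fst x) m s)"
proof -
  have y: "fst x \<in> A" "fst x \<noteq> fst y" using xy by (auto simp: admissible_def)
  have "flip (fst x) x = inv_letter x" "flip (fst x) y = y" "flip m x = x" "flip m y = y"
    using m y by (auto simp: flip_def)
  then show ?thesis using xy m y by (simp add: d_def e_t)
qed

lemma card_isotypic_le:
  assumes i: "i \<in> A"
  shows "card A * card (isotypic i) \<le> card S"
proof -
  have le: "card (isotypic i) \<le> card (isotypic j)" if j: "j \<in> A" for j
  proof -
    have p: "transpose i j permutes A" by (rule permutes_swap_id [OF i j])
    have "inj_on (g (lift (transpose i j))) (isotypic i)"
      using g_inj [OF lift_signed [OF p]] by (auto simp: inj_on_def)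
    moreover have "g (lift (transpose i j)) ` isotypic i \<subseteq> isotypic j"
      using g_parts(1) [OF p isotypic_S _ i] by (auto simp: isotypic_S)
    moreover have "finite (isotypic j)" using finite_S by (simp add: isotypic_def)
    ultimately show ?thesis by (rule card_inj_on_le)
  qed
  have "card A * card (isotypic i) = (\<Sum>j\<in>A. card (isotypic i))" by simp
  also have "\<dots> \<le> (\<Sum>j\<in>A. card (isotypic j))" by (rule sum_mono) (rule le)
  also have "\<dots> = card (\<Union>j\<in>A. isotypic j)"
  proof (rule card_UN_disjoint [symmetric, OF finite_A])
    show "\<forall>j\<in>A. finite (isotypic j)" using finite_S by (simp add: isotypic_def)
    show "\<forall>i\<in>A. \<forall>j\<in>A. i \<noteq> j \<longrightarrow> isotypic i \<inter> isotypic j = {}"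
      using isotypic_unique by blast
  qed
  also have "\<dots> \<le> card S" by (rule card_mono) (auto simp: finite_S isotypic_S)
  finally show ?thesis .
qed

definition u :: "'a \<Rightarrow> 'a \<Rightarrow> 's \<Rightarrow> 's" where "u i j = t (i, True) (j, True)"

lemma adm: "i \<in> A \<Longrightarrow> j \<in> A \<Longrightarrow> i \<noteq> j \<Longrightarrow> admissible (i, b) (j, c)"
  by (simp add: admissible_def)

lemma admissibleD:
  assumes "admissible x y"
  shows "fst x \<in> A" "fst y \<in> A" "fst x \<noteq> fst y"
  using assms by (auto simp: admissible_def)

text \<open>
  Where the signs of the letters do not matter, transvections are involutions and satisfy the relations of
  elementary matrices over the field with two elements.
\<close>
lemma t_trivial_if_unsigned:
  assumes B: "B \<subseteq> A" and R: "finite R" "card R < 2 ^ (card B - 1)"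
    and closed: "\<And>x y r. admissible x y \<Longrightarrow> fst x \<in> B \<Longrightarrow> fst y \<in> B \<Longrightarrow> r \<in> R \<Longrightarrow> t x y r \<in> R"
    and unsigned: "\<And>x y r. admissible x y \<Longrightarrow> fst x \<in> B \<Longrightarrow> fst y \<in> B \<Longrightarrow> r \<in> R
      \<Longrightarrow> t x (inv_letter y) r = t x y r \<and> t (inv_letter x) y r = t x y r"
    and xy: "admissible x y" "fst x \<in> B" "fst y \<in> B" and r: "r \<in> R"
  shows "t x y r = r"
proof -
  have tu: "t x y r = u (fst x) (fst y) r" if "admissible x y" "fst x \<in> B" "fst y \<in> B" "r \<in> R" for x y r
  proof -
    have "t x y r = t (fst x, True) y r"
      using unsigned [OF that] letter_eq [of x] by (cases "snd x") auto
    also have "\<dots> = u (fst x) (fst y) r"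
      using unsigned [of "(fst x, True)" y r] that letter_eq [of y]
      by (cases "snd y") (auto simp: u_def admissible_def)
    finally show ?thesis .
  qed
  have a: "admissible (i, b) (j, c)" if "i \<in> B" "j \<in> B" "i \<noteq> j" for i j b c
    using that B by (auto simp: admissible_def)
  have uR: "u i j p \<in> R" if "i \<in> B" "j \<in> B" "i \<noteq> j" "p \<in> R" for i j p
    unfolding u_def by (rule closed [OF a]) (use that in auto)
  have "u (fst x) (fst y) r = r"
  proof (rule steinberg_mod2_trivial [where A = B and S = R and x = u])
    show "finite B" using B finite_A finite_subset by blast
    fix i j p assume ij: "i \<in> B" "j \<in> B" "i \<noteq> j" and p: "p \<in> R"
    show "u i j p \<in> R" by (rule uR [OF ij p])
    have "u i j (u i j p) = t (i, True) (inv_letter (j, True)) (u i j p)"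
      using tu [of "(i, True)" "inv_letter (j, True)" "u i j p"] uR [OF ij p] a [OF ij] ij by simp
    then show "u i j (u i j p) = p"
      using t_inv(2) [OF a [OF ij]] by (simp add: u_def)
  next
    fix i j l m p assume ij: "i \<in> B" "j \<in> B" "l \<in> B" "m \<in> B" "i \<noteq> j" "l \<noteq> m" "i \<noteq> m" "j \<noteq> l"
      and p: "p \<in> R"
    \<comment> \<open>Right multiplications of the same generator, \<open>l = i\<close>, need not commute as automorphisms; a left
      and a right one do.\<close>
    have *: "u l m p = t (l, False) (m, True) p" if "p \<in> R" for p
      using tu [of "(l, False)" "(m, True)" p] ij that a [of l m False True] by simp
    have "t (i, True) (j, True) (t (l, False) (m, True) p) = t (l, False) (m, True) (t (i, True) (j, True) p)"
      by (rule t_commute) (use ij a in auto)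
    then show "u i j (u l m p) = u l m (u i j p)"
      using * [OF p] * [OF uR [OF ij(1,2,5) p]] by (simp add: u_def)
  next
    fix i j l p assume "i \<in> B" "j \<in> B" "l \<in> B" "i \<noteq> j" "j \<noteq> l" "i \<noteq> l" "p \<in> R"
    then show "u j l (u i j p) = u i j (u j l (u i l p))"
      unfolding u_def by (intro t_commutator a)
  qed (use R xy r admissibleD in auto)
  then show ?thesis using tu [OF xy r] by simp
qed

text \<open>
  On the part of \<open>k\<close> the products of two sign changes other than that of \<open>k\<close> act trivially, so the signs of
  \<open>x\<close> and \<open>y\<close> do not matter there. As the parts of all generators have the same size, this one has at
  most \<open>card A + 1\<close> points, too few for a nontrivial action.
\<close>
lemma t_fixes_isotypic_other:
  assumes xy: "admissible x y" and k: "k \<in> A" "k \<noteq> fst x" "k \<noteq> fst y" and s: "s \<in> isotypic k"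
  shows "t x y s = s"
proof (rule t_trivial_if_unsigned [of "A - {k}" "isotypic k", OF _ _ _ _ _ xy _ _ s])
  show "finite (isotypic k)" using finite_S by (simp add: isotypic_def)
  show "card (isotypic k) < 2 ^ (card (A - {k}) - 1)"
  proof -
    have "card A * card (isotypic k) \<le> Suc (card A) choose 2"
      using card_isotypic_le [OF k(1)] small by linarith
    also have "\<dots> = (Suc (card A) * card A) div 2" by (simp add: choose_two)
    also have "\<dots> \<le> card A * (card A + 1)" by (simp add: mult.commute)
    finally have "card (isotypic k) \<le> card A + 1"
      using rank mult_le_cancel1 [of "card A" "card (isotypic k)" "card A + 1"] by auto
    also have "\<dots> < 2 ^ (card A - 2)" by (rule Suc_less_power [OF rank])
    also have "card A - 2 = card (A - {k}) - 1" using finite_A k(1) by simp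
    finally show ?thesis .
  qed
  fix x y r assume xy: "admissible x y" "fst x \<in> A - {k}" "fst y \<in> A - {k}" and r: "r \<in> isotypic k"
  show tr: "t x y r \<in> isotypic k" using t_isotypic_other [OF xy(1) k(1) _ _ r] xy by auto
  obtain m where m: "m \<in> A" "m \<noteq> fst x" "m \<noteq> fst y" "m \<noteq> k" using fresh [of "[fst x, fst y, k]"] by auto
  have "d (fst y) m r = r" "d (fst y) m (t x y r) = t x y r"
    "d (fst x) m r = r" "d (fst x) m (t x y r) = t x y r"
    using d_fixes [OF r] d_fixes [OF tr] m xy by auto
  then show "t x (inv_letter y) r = t x y r \<and> t (inv_letter x) y r = t x y r"
    using t_sign_second [OF xy(1) m(1-3), of r] t_sign_first [OF xy(1) m(1-3), of r] by simp
qed (use k admissibleD [OF xy] in auto)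

section \<open>Triviality of the transvections\<close>
lemma t_fix_comp:
  assumes "admissible x z" "admissible z y" "admissible x y" "t x z p = p" "t z y p = p"
  shows "t x y p = p"
proof -
  have "t x z (t z y (t x y p)) = t x z (t z y p)"
    using t_commutator [OF assms(1-3), of p] assms(4,5) by simp
  then show ?thesis using assms(1,2) by (simp add: t_inj)
qed

lemma third:
  assumes "admissible x y"
  obtains z where "admissible x z" "admissible z y" "admissible z x" "fst z \<noteq> fst x" "fst z \<noteq> fst y" "fst z \<in> A"
proof -
  obtain k where "k \<in> A" "k \<noteq> fst x" "k \<noteq> fst y" using fresh [of "[fst x, fst y]"] by auto
  then show ?thesis using assms that [of "(k, True)"] by (simp add: admissible_def)
qed

text \<open>
  With a third generator \<open>z\<close>, both \<open>T x z\<close> and \<open>T z y\<close> would fix the image point, hence so would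
  \<open>T x y\<close>.
\<close>
lemma t_not_first_to_second:
  assumes xy: "admissible x y" and s: "s \<in> isotypic (fst x)"
  shows "t x y s \<notin> isotypic (fst y)"
proof
  assume s': "t x y s \<in> isotypic (fst y)"
  note D = admissibleD [OF xy]
  obtain z where z: "admissible x z" "admissible z y" "fst z \<noteq> fst x" "fst z \<noteq> fst y" using third [OF xy] .
  have "t z y s = s"
    by (rule t_fixes_isotypic_other [OF z(2) D(1) _ _ s]) (use z D in auto)
  then have "t z y (t x y s) = t x y s"
    using t_commute [OF z(2) xy, of s] z D by auto
  moreover have "t x z (t x y s) = t x y s"
    by (rule t_fixes_isotypic_other [OF z(1) D(2) _ _ s']) (use z D in auto)
  ultimately have "t x y (t x y s) = t x y s" by (intro t_fix_comp [OF z(1,2) xy])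
  then have "t x y s = s" using t_inj [OF xy] by blast
  then show False using isotypic_unique [OF s _ D(1,2)] s' D(3) by simp
qed

lemma t_not_second_to_first:
  assumes xy: "admissible x y" and s: "s \<in> isotypic (fst y)"
  shows "t x y s \<notin> isotypic (fst x)"
proof
  assume s': "t x y s \<in> isotypic (fst x)"
  have "admissible x (inv_letter y)" using xy by simp
  from t_not_first_to_second [OF this s'] show False using s t_inv(2) [OF xy] by simp
qed

text \<open>
  Conjugation by a product of two sign changes, which fixes \<open>q\<close>, changes the sign of either letter.
\<close>
lemma t_sign:
  assumes q: "q \<in> trivial_part" and xy: "admissible x y"
    and R: "\<And>j k r. j \<in> A \<Longrightarrow> k \<in> A \<Longrightarrow> j \<noteq> k \<Longrightarrow> r \<in> R \<Longrightarrow> d j k r \<in> R"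
  shows "t x y q \<in> R \<longleftrightarrow> u (fst x) (fst y) q \<in> R"
proof -
  have sec: "t x (inv_letter y) q \<in> R" and fst: "t (inv_letter x) y q \<in> R"
    if "admissible x y" "t x y q \<in> R" for x y
  proof -
    note D = admissibleD [OF that(1)]
    obtain m where m: "m \<in> A" "m \<noteq> fst x" "m \<noteq> fst y" using fresh [of "[fst x, fst y]"] by auto
    have "d (fst y) m q = q" "d (fst x) m q = q" using d_trivial [OF q] D m by auto
    then show "t x (inv_letter y) q \<in> R" "t (inv_letter x) y q \<in> R"
      using t_sign_second [OF that(1) m, of q] t_sign_first [OF that(1) m, of q]
        R [OF D(2) m(1) _ that(2)] R [OF D(1) m(1) _ that(2)] m by auto
  qed
  have 1: "t x y q \<in> R \<longleftrightarrow> t (fst x, True) y q \<in> R"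
    using fst [of x y] fst [of "inv_letter x" y] xy letter_eq [of x] by (cases "snd x") auto
  have xy': "admissible (fst x, True) y" using xy by (auto simp: admissible_def)
  have 2: "t (fst x, True) y q \<in> R \<longleftrightarrow> u (fst x) (fst y) q \<in> R"
    using sec [of "(fst x, True)" y] sec [of "(fst x, True)" "inv_letter y"] xy' letter_eq [of y]
    by (cases "snd y") (auto simp: u_def)
  show ?thesis using 1 2 by simp
qed

lemma t_sign_fix:
  assumes q: "q \<in> trivial_part" and xy: "admissible x y"
  shows "t x y q = q \<longleftrightarrow> u (fst x) (fst y) q = q"
  using t_sign [OF q xy, of "{q}"] d_trivial [OF q] by simp

lemma t_sign_isotypic:
  assumes q: "q \<in> trivial_part" and xy: "admissible x y"
  shows "t x y q \<in> isotypic i \<longleftrightarrow> u (fst x) (fst y) q \<in> isotypic i"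
  by (rule t_sign [OF q xy]) (rule d_isotypic)

lemma u_fix_comp:
  assumes "i \<in> A" "j \<in> A" "k \<in> A" "i \<noteq> j" "i \<noteq> k" "k \<noteq> j" "u i k q = q" "u k j q = q"
  shows "u i j q = q"
  using t_fix_comp [of "(i, True)" "(k, True)" "(j, True)" q] assms by (simp add: u_def adm)

lemma u_fixes_other:
  assumes "k \<in> A" "l \<in> A" "k \<noteq> l" "i \<in> A" "i \<noteq> k" "i \<noteq> l" "s \<in> isotypic i"
  shows "u k l s = s"
  unfolding u_def by (rule t_fixes_isotypic_other [OF adm assms(4)]) (use assms in auto)

lemma u_inj: "i \<in> A \<Longrightarrow> j \<in> A \<Longrightarrow> i \<noteq> j \<Longrightarrow> u i j s = u i j s' \<longleftrightarrow> s = s'"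
  by (simp add: u_def t_inj adm)

text \<open>
  \<open>out1\<close> and \<open>out2\<close> describe transvections that take the point \<open>q\<close> of the trivial part into the part of
  their first or of their second generator. The arguments of \<open>out2\<close> are exchanged so that \<open>same_pair\<close>
  applies to both: transposing indices preserves its assumptions.
\<close>
definition out1 :: "'s \<Rightarrow> 'a \<Rightarrow> 'a \<Rightarrow> bool"
  where "out1 q i j \<longleftrightarrow> i \<in> A \<and> j \<in> A \<and> i \<noteq> j \<and> u i j q \<in> isotypic i"

definition out2 :: "'s \<Rightarrow> 'a \<Rightarrow> 'a \<Rightarrow> bool"
  where "out2 q i j \<longleftrightarrow> i \<in> A \<and> j \<in> A \<and> i \<noteq> j \<and> u j i q \<in> isotypic i"

lemma out1_same_pair:
  assumes q: "q \<in> trivial_part" and ij: "out1 q i j" and kl: "out1 q k l"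
  shows "{i, j} = {k, l}"
proof (rule same_pair [of "out1 q" A "\<lambda>i j. u i j q = q", OF _ _ _ _ _ ij kl])
  fix i j assume M: "out1 q i j"
  then have D: "i \<in> A" "j \<in> A" "i \<noteq> j" "u i j q \<in> isotypic i" by (auto simp: out1_def)
  show "i \<noteq> j \<and> i \<in> A \<and> j \<in> A" using D by blast
  have ne: "u i j q \<noteq> q" using isotypic_not_trivial [OF D(4,1)] q by metis
  then show "u i j q \<noteq> q" .
  show "u k l q = q" if kl: "k \<in> A" "l \<in> A" "k \<notin> {i, j}" "l \<noteq> i" "l \<noteq> k" for k l
  proof -
    have "u k l (u i j q) = u i j (u k l q)"
      unfolding u_def by (rule t_commute) (use D kl in \<open>auto simp: admissible_def\<close>)
    moreover have "u k l (u i j q) = u i j q"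
      by (rule u_fixes_other [OF kl(1,2) _ D(1) _ _ D(4)]) (use kl in auto)
    ultimately show ?thesis using u_inj [OF D(1-3)] by metis
  qed
  show "j = l" if M': "out1 q i l" for l
  proof (rule ccontr)
    assume jl: "j \<noteq> l"
    have D': "l \<in> A" "i \<noteq> l" "u i l q \<in> isotypic i" using M' by (auto simp: out1_def)
    have "u l j (u i l q) = u i l (u l j (u i j q))"
      unfolding u_def by (rule t_commutator) (use D D' jl in \<open>auto simp: admissible_def\<close>)
    moreover have "u l j (u i l q) = u i l q" "u l j (u i j q) = u i j q"
      using u_fixes_other [OF D'(1) D(2) _ D(1)] D D' jl by auto
    ultimately have "u i l q = u i l (u i j q)" by simp
    then show False using u_inj [OF D(1) D'(1,2)] ne by metis
  qed
qed (use u_fix_comp in blast)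

lemma out2_same_pair:
  assumes q: "q \<in> trivial_part" and ij: "out2 q i j" and kl: "out2 q k l"
  shows "{i, j} = {k, l}"
proof (rule same_pair [of "out2 q" A "\<lambda>i j. u j i q = q", OF _ _ _ _ _ ij kl])
  fix i j assume M: "out2 q i j"
  then have D: "i \<in> A" "j \<in> A" "j \<noteq> i" "u j i q \<in> isotypic i" by (auto simp: out2_def)
  show "i \<noteq> j \<and> i \<in> A \<and> j \<in> A" using D by blast
  have ne: "u j i q \<noteq> q" using isotypic_not_trivial [OF D(4,1)] q by metis
  then show "u j i q \<noteq> q" .
  have fixed: "u l k q = q" if kl: "k \<in> A" "l \<in> A" "k \<notin> {i, j}" "l \<noteq> i" "l \<noteq> k" for k l
  proof -
    have a: "admissible (l, False) (k, True)" using kl by (simp add: admissible_def)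
    have "t (l, False) (k, True) (u j i q) = u j i (t (l, False) (k, True) q)"
      unfolding u_def by (rule t_commute) (use D kl in \<open>auto simp: admissible_def\<close>)
    moreover have "t (l, False) (k, True) (u j i q) = u j i q"
      by (rule t_fixes_isotypic_other [OF a D(1) _ _ D(4)]) (use kl in auto)
    ultimately have "t (l, False) (k, True) q = q" using u_inj [OF D(2,1,3)] by metis
    then show ?thesis using t_sign_fix [OF q a] by simp
  qed
  then show "u l k q = q" if "k \<in> A" "l \<in> A" "k \<notin> {i, j}" "l \<noteq> i" "l \<noteq> k" for k l
    using that by blast
  show "j = l" if M': "out2 q i l" for l
  proof (rule ccontr)
    assume jl: "j \<noteq> l"
    have D': "l \<in> A" "l \<noteq> i" "u l i q \<in> isotypic i" using M' by (auto simp: out2_def)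
    have "u l i (u j l q) = u j l (u l i (u j i q))"
      unfolding u_def by (rule t_commutator) (use D D' jl in \<open>auto simp: admissible_def\<close>)
    moreover have jlq: "u j l q = q" by (rule fixed) (use D D' jl in auto)
    moreover have "u j l (u l i q) = u l i q"
      using u_fixes_other [OF D(2) D'(1) jl D(1) _ _ D'(3)] D D' by auto
    ultimately have "u j l (u l i q) = u j l (u l i (u j i q))" by metis
    then show False using u_inj [OF D(2) D'(1) jl] u_inj [OF D'(1) D(1) D'(2)] ne by metis
  qed
qed (use u_fix_comp in blast)

lemma isotypic_nonempty_card:
  assumes i: "i \<in> A" and s: "s \<in> isotypic i" and k: "k \<in> A"
  shows "2 \<le> card (isotypic k)"
proof -
  have p: "transpose i k permutes A" by (rule permutes_swap_id [OF i k])
  let ?r = "g (lift (transpose i k)) s"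
  have r: "?r \<in> isotypic k" using g_parts(1) [OF p isotypic_S [OF s] s i] by simp
  obtain m where m: "m \<in> A" "m \<noteq> k" using fresh [of "[k]"] by auto
  have "{?r, d k m ?r} \<subseteq> isotypic k" using r d_isotypic [OF r k m(1)] by blast
  moreover have "finite (isotypic k)" using finite_S by (simp add: isotypic_def)
  moreover have "card {?r, d k m ?r} = 2" using d_moves [OF r k m] by simp
  ultimately show ?thesis using card_mono by metis
qed

text \<open>
  Distinct pairs of generators are realized by distinct points of the trivial part, so it has at least
  \<open>card A choose 2\<close> points; the parts of the generators, with two points or more each, add \<open>2 * card A\<close>
  to this.
\<close>
lemma too_many_pairs:
  assumes i: "i \<in> A" and s: "s \<in> isotypic i"
    and ex: "\<And>i j. i \<in> A \<Longrightarrow> j \<in> A \<Longrightarrow> i \<noteq> j \<Longrightarrow> \<exists>q\<in>trivial_part. M q i j"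
    and same: "\<And>q i j k l. q \<in> trivial_part \<Longrightarrow> M q i j \<Longrightarrow> M q k l \<Longrightarrow> {i, j} = {k, l}"
  shows False
proof -
  let ?C = "{p. p \<subseteq> A \<and> card p = 2}"
  have "\<forall>p\<in>?C. \<exists>q. q \<in> trivial_part \<and> (\<exists>i j. p = {i, j} \<and> M q i j)"
  proof
    fix p assume "p \<in> ?C"
    then have "p \<subseteq> A" "card p = 2" by auto
    then obtain i j where ij: "p = {i, j}" "i \<noteq> j" by (auto simp: card_2_iff)
    then show "\<exists>q. q \<in> trivial_part \<and> (\<exists>i j. p = {i, j} \<and> M q i j)"
      using ex [of i j] \<open>p \<subseteq> A\<close> by blast
  qed
  from bchoice [OF this] obtain h where
    h: "\<forall>p\<in>?C. h p \<in> trivial_part \<and> (\<exists>i j. p = {i, j} \<and> M (h p) i j)" ..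
  have "inj_on h ?C"
  proof (rule inj_onI)
    fix p p' assume pp: "p \<in> ?C" "p' \<in> ?C" "h p = h p'"
    note hp = bspec [OF h pp(1)] bspec [OF h pp(2)]
    obtain i j where ij: "p = {i, j}" "M (h p) i j" using hp(1) by blast
    obtain k l where kl: "p' = {k, l}" "M (h p') k l" using hp(2) by blast
    have "h p \<in> trivial_part" using hp(1) by blast
    from same [OF this ij(2) kl(2) [folded pp(3)]] show "p = p'" by (simp only: ij(1) kl(1))
  qed
  moreover have "h ` ?C \<subseteq> trivial_part"
    by (rule image_subsetI) (rule conjunct1 [OF bspec [OF h]])
  moreover have fin: "finite trivial_part" using finite_S by (simp add: trivial_part_def)
  ultimately have "card ?C \<le> card trivial_part" by (rule card_inj_on_le)
  then have 1: "card A choose 2 \<le> card trivial_part" using n_subsets [OF finite_A, of 2] by simp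
  have "(\<Sum>k\<in>A. 2) \<le> (\<Sum>k\<in>A. card (isotypic k))"
    by (rule sum_mono) (rule isotypic_nonempty_card [OF i s])
  also have "\<dots> = card (\<Union>k\<in>A. isotypic k)"
  proof (rule card_UN_disjoint [symmetric, OF finite_A])
    show "\<forall>j\<in>A. finite (isotypic j)" using finite_S by (simp add: isotypic_def)
    show "\<forall>i\<in>A. \<forall>j\<in>A. i \<noteq> j \<longrightarrow> isotypic i \<inter> isotypic j = {}"
      using isotypic_unique by blast
  qed
  finally have 2: "2 * card A \<le> card (\<Union>k\<in>A. isotypic k)" by simp
  have finU: "finite (\<Union>k\<in>A. isotypic k)"
    by (rule finite_subset [OF _ finite_S]) (use isotypic_S in blast)
  have "trivial_part \<inter> (\<Union>k\<in>A. isotypic k) = {}" using isotypic_not_trivial by blast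
  then have "card trivial_part + card (\<Union>k\<in>A. isotypic k) = card (trivial_part \<union> (\<Union>k\<in>A. isotypic k))"
    by (rule card_Un_disjoint [symmetric, OF fin finU])
  also have "\<dots> \<le> card S"
    by (rule card_mono [OF finite_S]) (use isotypic_S trivial_S in blast)
  finally show False using 1 2 small choose_Suc_two [of "card A"] rank by linarith
qed

lemma g_u: "\<pi> permutes A \<Longrightarrow> i \<in> A \<Longrightarrow> j \<in> A \<Longrightarrow> i \<noteq> j \<Longrightarrow> g (lift \<pi>) (u i j s) = u (\<pi> i) (\<pi> j) (g (lift \<pi>) s)"
  unfolding u_def using g_t [OF lift_signed adm] by (simp add: lift_def)

lemma move_pair:
  assumes "i \<in> A" "j \<in> A" "i \<noteq> j" "i' \<in> A" "j' \<in> A" "i' \<noteq> j'"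
  obtains \<pi> where "\<pi> permutes A" "\<pi> i = i'" "\<pi> j = j'"
proof -
  let ?p = "(\<lambda>_. i')(j := j')"
  have "inj_on ?p {i, j}" "?p ` {i, j} \<subseteq> A" "{i, j} \<subseteq> A" using assms by (auto simp: inj_on_def)
  then obtain \<pi> where \<pi>: "\<pi> permutes A" "\<And>b. b \<in> {i, j} \<Longrightarrow> \<pi> b = ?p b"
    using permutation_extending [OF finite_A] by metis
  then have "\<pi> i = i'" "\<pi> j = j'" using assms(3) by auto
  then show ?thesis using that \<pi>(1) by blast
qed

text \<open>
  The permutations of the generators move one transvection leaving the part of its first generator for the
  trivial part to all pairs of generators.
\<close>
lemma t_first_not_trivial:
  assumes xy: "admissible x y" and s: "s \<in> isotypic (fst x)"
  shows "t x y s \<notin> trivial_part"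
proof
  assume q: "t x y s \<in> trivial_part"
  let ?q = "t x y s"
  note D = admissibleD [OF xy]
  have "t x (inv_letter y) ?q \<in> isotypic (fst x)" using s t_inv(2) [OF xy] by simp
  then have uq: "u (fst x) (fst y) ?q \<in> isotypic (fst x)"
    using t_sign_isotypic [OF q, of x "inv_letter y"] xy by simp
  show False
  proof (rule too_many_pairs [OF D(1) s, of out1])
    fix i j assume ij: "i \<in> A" "j \<in> A" "i \<noteq> j"
    obtain \<pi> where \<pi>: "\<pi> permutes A" "\<pi> (fst x) = i" "\<pi> (fst y) = j"
      using move_pair [OF D ij] .
    have "u i j (g (lift \<pi>) ?q) = g (lift \<pi>) (u (fst x) (fst y) ?q)"
      using g_u [OF \<pi>(1) D] \<pi> by simp
    also have "\<dots> \<in> isotypic i" using g_parts(1) [OF \<pi>(1) isotypic_S [OF uq] uq D(1)] \<pi> by simp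
    finally show "\<exists>q\<in>trivial_part. out1 q i j"
      using g_parts(2) [OF \<pi>(1) trivial_S [OF q] q] ij by (auto simp: out1_def)
  qed (rule out1_same_pair)
qed

lemma t_second_not_trivial:
  assumes xy: "admissible x y" and s: "s \<in> isotypic (fst y)"
  shows "t x y s \<notin> trivial_part"
proof
  assume q: "t x y s \<in> trivial_part"
  let ?q = "t x y s"
  note D = admissibleD [OF xy]
  have "t x (inv_letter y) ?q \<in> isotypic (fst y)" using s t_inv(2) [OF xy] by simp
  then have uq: "u (fst x) (fst y) ?q \<in> isotypic (fst y)"
    using t_sign_isotypic [OF q, of x "inv_letter y"] xy by simp
  show False
  proof (rule too_many_pairs [OF D(2) s, of out2])
    fix i j assume ij: "i \<in> A" "j \<in> A" "i \<noteq> j"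
    obtain \<pi> where \<pi>: "\<pi> permutes A" "\<pi> (fst x) = j" "\<pi> (fst y) = i"
      using move_pair [OF D ij(2,1)] ij(3) by metis
    have "u j i (g (lift \<pi>) ?q) = g (lift \<pi>) (u (fst x) (fst y) ?q)"
      using g_u [OF \<pi>(1) D] \<pi> by simp
    also have "\<dots> \<in> isotypic i" using g_parts(1) [OF \<pi>(1) isotypic_S [OF uq] uq D(2)] \<pi> by simp
    finally show "\<exists>q\<in>trivial_part. out2 q i j"
      using g_parts(2) [OF \<pi>(1) trivial_S [OF q] q] ij by (auto simp: out2_def)
  qed (rule out2_same_pair)
qed

lemma t_isotypic_cases:
  assumes xy: "admissible x y" and i: "i \<in> A" and s: "s \<in> isotypic i" and tr: "t x y s \<notin> trivial_part"
  shows "t x y s \<in> isotypic i \<or> (\<exists>j\<in>{fst x, fst y}. t x y s \<in> isotypic j)"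
proof -
  obtain j where j: "j \<in> A" "t x y s \<in> isotypic j"
    using parts [OF t_closed [OF xy isotypic_S [OF s]]] tr by blast
  show ?thesis
  proof (cases "j \<in> {fst x, fst y}")
    case False
    have "t x (inv_letter y) (t x y s) \<in> isotypic j"
      by (rule t_isotypic_other [OF _ j(1) _ _ j(2)]) (use False xy in auto)
    then have "i = j" using isotypic_unique [OF s _ i j(1)] t_inv(2) [OF xy] by simp
    then show ?thesis using j by simp
  qed (use j in blast)
qed

lemma t_isotypic_first: "admissible x y \<Longrightarrow> s \<in> isotypic (fst x) \<Longrightarrow> t x y s \<in> isotypic (fst x)"
  using t_isotypic_cases [OF _ admissibleD(1)] t_first_not_trivial t_not_first_to_second by blast

lemma t_isotypic_second: "admissible x y \<Longrightarrow> s \<in> isotypic (fst y) \<Longrightarrow> t x y s \<in> isotypic (fst y)"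
  using t_isotypic_cases [OF _ admissibleD(2)] t_second_not_trivial t_not_second_to_first by blast

text \<open>
  If \<open>i\<close> is the generator of \<open>x\<close> or \<open>y\<close>, consider the commutator relation for \<open>T x y\<close> with a third
  generator \<open>z\<close>: one of \<open>T x z\<close> and \<open>T z y\<close> avoids \<open>i\<close>, so it acts trivially on the part of
  \<open>i\<close>, which the others preserve.
\<close>
lemma t_fixes_isotypic:
  assumes xy: "admissible x y" and i: "i \<in> A" and s: "s \<in> isotypic i"
  shows "t x y s = s"
proof -
  note D = admissibleD [OF xy]
  obtain z where z: "admissible x z" "admissible z y" "fst z \<noteq> fst x" "fst z \<noteq> fst y" "fst z \<in> A"
    using third [OF xy] .
  note law = t_commutator [OF z(1,2) xy, of s]
  consider "i = fst x" | "i = fst y" | "i \<noteq> fst x" "i \<noteq> fst y" by blast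
  then show ?thesis
  proof cases
    case 1
    have fx: "t z y r = r" if "r \<in> isotypic i" for r
      by (rule t_fixes_isotypic_other [OF z(2) i _ _ that]) (use 1 z D in auto)
    have "t x z s \<in> isotypic i" "t x y s \<in> isotypic i"
      using t_isotypic_first z(1) xy s 1 by blast+
    then have "t x z s = t x z (t x y s)" using law fx by simp
    then show ?thesis using t_inj [OF z(1)] by simp
  next
    case 2
    have fx: "t x z r = r" if "r \<in> isotypic i" for r
      by (rule t_fixes_isotypic_other [OF z(1) i _ _ that]) (use 2 z D in auto)
    have ty: "t x y s \<in> isotypic i" using t_isotypic_second xy s 2 by blast
    then have "t z y (t x y s) \<in> isotypic i" using t_isotypic_second z(2) 2 by blast
    then have "t z y s = t z y (t x y s)" using law fx s by simp
    then show ?thesis using t_inj [OF z(2)] by simp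
  next
    case 3
    then show ?thesis using t_fixes_isotypic_other [OF xy i] s by blast
  qed
qed

text \<open>
  The product of the sign changes of \<open>i\<close> and \<open>k\<close> is a product of transvections by the relation for a
  signed swap, so it would have to fix the points that it moves.
\<close>
lemma isotypic_empty:
  assumes i: "i \<in> A"
  shows "isotypic i = {}"
proof (rule ccontr)
  assume "isotypic i \<noteq> {}"
  then obtain s where s: "s \<in> isotypic i" by blast
  obtain k where k: "k \<in> A" "k \<noteq> i" using fresh [of "[i]"] by auto
  let ?x = "(i, True)" and ?y = "(k, True)"
  let ?w = "letter_swap ?x ?y \<circ> letter_swap ?y (inv_letter ?y)"
  have a: "admissible ?x ?y" "admissible ?y (inv_letter ?x)" "admissible (inv_letter ?x) (inv_letter ?y)"
    using i k by (auto simp: adm)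
  have w: "?w \<in> signed_perms"
    using i k by (intro signed_perms_comp letter_swap_signed) auto
  have "g ?w s = s"
    by (simp only: g_weyl [OF a(1)] t_fixes_isotypic [OF _ i s] a)
  then have "g (?w \<circ> ?w) s = s" using g_comp [OF w w, of s] by simp
  moreover have "?w \<circ> ?w = flip i \<circ> flip k"
    using k by (auto simp: fun_eq_iff letter_swap_def flip_def inv_letter_def)
  ultimately have "d i k s = s"
    using g_comp [OF flip_signed [OF i] flip_signed [OF k(1)], of s] by (simp add: d_def e_def)
  then show False using d_moves [OF s i k] by simp
qed

lemma S_trivial: "s \<in> S \<Longrightarrow> s \<in> trivial_part"
  using parts isotypic_empty by blast

theorem transvection_trivial:
  assumes xy: "admissible x y" and s: "s \<in> S"
  shows "t x y s = s"
proof (rule t_trivial_if_unsigned [of A S, OF _ finite_S _ _ _ xy _ _ s])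
  show "card S < 2 ^ (card A - 1)" using small choose_two_less_power [OF rank] by linarith
  fix x y r assume xy: "admissible x y" and r: "r \<in> S"
  show tr: "t x y r \<in> S" by (rule t_closed [OF xy r])
  obtain m where m: "m \<in> A" "m \<noteq> fst x" "m \<noteq> fst y" using fresh [of "[fst x, fst y]"] by auto
  have "d (fst y) m r = r" "d (fst y) m (t x y r) = t x y r"
    "d (fst x) m r = r" "d (fst x) m (t x y r) = t x y r"
    using d_trivial [OF S_trivial [OF r]] d_trivial [OF S_trivial [OF tr]] m admissibleD [OF xy] by auto
  then show "t x (inv_letter y) r = t x y r \<and> t (inv_letter x) y r = t x y r"
    using t_sign_second [OF xy m, of r] t_sign_first [OF xy m, of r] by simp
qed (use admissibleD [OF xy] in auto)

lemma e_all_equal: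
  assumes "a \<in> A" "b \<in> A" "s \<in> S"
  shows "e b s = e a s"
proof (cases "a = b")
  case False
  then have "e a (e b s) = s" using d_trivial [OF S_trivial [OF assms(3)] assms(1,2)] by (simp add: d_def)
  then show ?thesis using e_e [OF assms(1), of "e b s"] by simp
qed simp

lemma g_swap:
  assumes a: "a \<in> A" and xy: "x \<in> L" "y \<in> L" "x \<noteq> y" and s: "s \<in> S"
  shows "g (letter_swap x y) s = e a s"
proof (cases "fst x = fst y")
  case True
  then have "y = inv_letter x" using fst_eq_cases [of x y] xy(3) by auto
  then have "g (letter_swap x y) s = e (fst x) s" by (simp add: e_def flip_eq)
  then show ?thesis using e_all_equal [OF a _ s, of "fst x"] xy by auto
next
  case False
  then have adm: "admissible x y" using xy by (simp add: admissible_def)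
  have yA: "fst y \<in> A" using xy by auto
  let ?s = "e (fst y) s"
  have s': "?s \<in> S" by (rule e_closed [OF yA s])
  have fx: "t p q r = r" if "admissible p q" "r \<in> S" for p q r by (rule transvection_trivial [OF that])
  have adm': "admissible y (inv_letter x)" "admissible (inv_letter x) (inv_letter y)"
    using adm by (auto simp: admissible_def simp del: mem_Sigma_iff)
  have "g (letter_swap x y \<circ> letter_swap y (inv_letter y)) ?s = ?s"
    using fx s' by (simp only: g_weyl [OF adm] adm adm')
  moreover have "g (letter_swap x y \<circ> letter_swap y (inv_letter y)) ?s
    = g (letter_swap x y) (e (fst y) ?s)"
    unfolding e_def flip_eq [symmetric]
    by (rule g_comp [OF letter_swap_signed [OF xy(1,2)] flip_signed [OF yA], symmetric])
  ultimately have "g (letter_swap x y) s = ?s" by (simp add: e_e [OF yA])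
  then show ?thesis using e_all_equal [OF a yA s] by simp
qed

text \<open>
  A signed permutation is a product of letter swaps, each of which acts as the sign change of \<open>a\<close> by
  \<open>g_swap\<close>; swapping \<open>x\<close> with its image leaves fewer letters to be moved.
\<close>
lemma g_sign:
  assumes a: "a \<in> A"
  shows "w \<in> signed_perms \<Longrightarrow> (\<forall>s\<in>S. g w s = s) \<or> (\<forall>s\<in>S. g w s = e a s)"
proof (induction "card {x \<in> L. w x \<noteq> x}" arbitrary: w rule: less_induct)
  case less
  have finL: "finite L" using finite_A by simp
  show ?case
  proof (cases "\<exists>x\<in>L. w x \<noteq> x")
    case False
    have "w = id"
    proof
      fix x show "w x = id x"
        using False permutes_not_in [OF signed_permsD(1) [OF less.prems], of x] by (cases "x \<in> L") auto
    qed
    then show ?thesis by (simp add: g_id)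
  next
    case True
    then obtain x where x: "x \<in> L" "w x \<noteq> x" by blast
    define y where "y = w x"
    note W = signed_permsD [OF less.prems]
    have y: "y \<in> L" "y \<noteq> x" using W(3) x by (simp_all add: y_def)
    define v where "v = letter_swap x y \<circ> w"
    have sw: "letter_swap x y \<in> signed_perms" by (rule letter_swap_signed [OF x(1) y(1)])
    have v: "v \<in> signed_perms" unfolding v_def by (rule signed_perms_comp [OF sw less.prems])
    have vx: "v x = x" using y by (auto simp: v_def letter_swap_def y_def [symmetric])
    have fixed: "v z = z" if "w z = z" for z
    proof -
      have "z \<noteq> x" using that x by auto
      moreover have "z \<noteq> inv_letter x"
      proof
        assume "z = inv_letter x"
        then have "inv_letter (w x) = inv_letter x" using that W(2) by metis
        then show False using x(2) by (metis inv_letter_inv_letter)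
      qed
      moreover have "z \<noteq> y" using that W(6) [of z x] \<open>z \<noteq> x\<close> by (auto simp: y_def)
      moreover have "z \<noteq> inv_letter y"
        using that W(6) [of z "inv_letter x"] W(2) [of x] \<open>z \<noteq> inv_letter x\<close> by (auto simp: y_def)
      ultimately show ?thesis using that by (simp add: v_def letter_swap_def)
    qed
    have "{z \<in> L. v z \<noteq> z} \<subset> {z \<in> L. w z \<noteq> z}" using fixed vx x by blast
    then have "card {z \<in> L. v z \<noteq> z} < card {z \<in> L. w z \<noteq> z}"
      using finL by (intro psubset_card_mono) auto
    from less.hyps [OF this v]
    have v': "(\<forall>s\<in>S. g v s = s) \<or> (\<forall>s\<in>S. g v s = e a s)" .
    have "w = letter_swap x y \<circ> v" by (simp add: v_def fun_eq_iff)
    then have gw: "g w s = g (letter_swap x y) (g v s)" for s using g_comp [OF sw v] by metis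
    have "g w s = e a (g v s)" if "s \<in> S" for s
      using gw g_swap [OF a x(1) y(1) _ g_closed [OF v that]] y(2) by metis
    then show ?thesis using v' e_e [OF a] by auto
  qed
qed

theorem action_sign:
  assumes a: "a \<in> A" and \<alpha>: "\<alpha> \<in> auto F"
  shows "(\<forall>s\<in>S. \<Psi> \<alpha> s = s) \<or> (\<forall>s\<in>S. \<Psi> \<alpha> s = e a s)"
  using \<alpha>
proof (induction \<alpha> rule: nielsen_induct)
  case (relabel w)
  then show ?case using g_sign [OF a relabel] by (simp add: g_def)
next
  case (transvection \<beta> x y)
  have "\<Psi> (\<beta> \<otimes>\<^bsub>AF\<^esub> transvection x y) s = \<Psi> \<beta> s" if "s \<in> S" for s
    using transvection_trivial [of x y s] transvection that \<Psi>_mult [of \<beta> "transvection x y" s]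
    by (simp add: t_def admissible_def transvection_auto)
  then show ?case using transvection by simp
qed

end

section \<open>Actions on small sets\<close>
lemma factors_through_Z2_if_sign:
  assumes act: "group_action G S \<phi>"
    and \<epsilon>: "\<epsilon> \<in> carrier (BijGroup S)" "\<epsilon> \<otimes>\<^bsub>BijGroup S\<^esub> \<epsilon> = \<one>\<^bsub>BijGroup S\<^esub>"
    and sign: "\<And>g. g \<in> carrier G \<Longrightarrow> \<phi> g = \<one>\<^bsub>BijGroup S\<^esub> \<or> \<phi> g = \<epsilon>"
  shows "factors_through_Z2 G S \<phi>"
proof -
  interpret group_action G S \<phi> by (rule act)
  interpret B: group "BijGroup S" by (rule group_BijGroup)
  define \<alpha> where "\<alpha> g = (if \<phi> g = \<one>\<^bsub>BijGroup S\<^esub> then 0 else 1 :: int)" for g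
  define \<beta> where "\<beta> k = (if k = 0 then \<one>\<^bsub>BijGroup S\<^esub> else \<epsilon>)" for k :: int
  have Z: "carrier (integer_mod_group 2) = {0, 1}"
    by (auto simp: carrier_integer_mod_group)
  have "\<phi> (x \<otimes>\<^bsub>G\<^esub> y) = \<phi> x \<otimes>\<^bsub>BijGroup S\<^esub> \<phi> y" if "x \<in> carrier G" "y \<in> carrier G" for x y
    using group_hom that by (simp add: group_hom.hom_mult)
  note mult = this
  have "\<alpha> \<in> hom G (integer_mod_group 2)"
  proof (rule homI)
    fix x y assume xy: "x \<in> carrier G" "y \<in> carrier G"
    consider "\<phi> x = \<one>\<^bsub>BijGroup S\<^esub>" "\<phi> y = \<one>\<^bsub>BijGroup S\<^esub>" | "\<phi> x = \<one>\<^bsub>BijGroup S\<^esub>" "\<phi> y = \<epsilon>"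
      | "\<phi> x = \<epsilon>" "\<phi> y = \<one>\<^bsub>BijGroup S\<^esub>" | "\<phi> x = \<epsilon>" "\<phi> y = \<epsilon>"
      using sign xy by blast
    then show "\<alpha> (x \<otimes>\<^bsub>G\<^esub> y) = \<alpha> x \<otimes>\<^bsub>integer_mod_group 2\<^esub> \<alpha> y"
      using mult [OF xy] \<epsilon> by cases (simp_all add: \<alpha>_def mult_integer_mod_group)
  qed (simp add: \<alpha>_def Z)
  moreover have "\<beta> \<in> hom (integer_mod_group 2) (BijGroup S)"
    using \<epsilon> by (intro homI) (auto simp: \<beta>_def Z mult_integer_mod_group)
  moreover have "\<phi> g = \<beta> (\<alpha> g)" if "g \<in> carrier G" for g
    using sign [OF that] by (auto simp: \<alpha>_def \<beta>_def)
  ultimately show ?thesis unfolding factors_through_Z2_def by blast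
qed

theorem theorem2p28:
  fixes n m :: nat and S :: "'s set"
    and \<phi> :: "(nat letter list \<Rightarrow> nat letter list) set \<Rightarrow> 's \<Rightarrow> 's"
  assumes "n \<ge> 6"
    and "m \<le> (n + 1) choose 2"
    and "finite S"
    and "card S = m"
    and "group_action (Out (free_group {..<n})) S \<phi>"
  shows "factors_through_Z2 (Out (free_group {..<n})) S \<phi>"
proof -
  let ?F = "free_group {..<n}"
  let ?N = "Inn ?F"
  interpret finite_free_automorphisms "{..<n}" by unfold_locales simp
  interpret N: normal ?N AF by (rule F.Inn_normal)
  interpret act: group_action "Out ?F" S \<phi> by (rule assms(5))
  interpret B: group "BijGroup S" by (rule group_BijGroup)
  define q where "q \<alpha> = ?N #>\<^bsub>AF\<^esub> \<alpha>" for \<alpha>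
  have q_hom: "q \<in> hom AF (Out ?F)"
    unfolding q_def Out_def by (rule N.r_coset_hom_Mod)
  have \<phi>_hom: "\<phi> \<in> hom (Out ?F) (BijGroup S)"
    using act.group_hom by (simp add: group_hom.homh)
  define \<Psi> where "\<Psi> \<alpha> s = (if s \<in> S then \<phi> (q \<alpha>) s else s)" for \<alpha> s
  have bij: "\<phi> (q \<alpha>) \<in> Bij S" if "\<alpha> \<in> auto ?F" for \<alpha>
    using hom_in_carrier [OF \<phi>_hom hom_in_carrier [OF q_hom]] that
    by (simp add: F.carrier_AutoGroup BijGroup_def)
  interpret aut_action "{..<n}" S \<Psi>
  proof
    show "finite S" by (rule assms(3))
    show "6 \<le> card {..<n}" "card S \<le> Suc (card {..<n}) choose 2" using assms by simp_all
    show cl: "\<Psi> \<alpha> s \<in> S" if "\<alpha> \<in> auto ?F" "s \<in> S" for \<alpha> s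
      using bij [OF that(1)] that(2) by (auto simp: \<Psi>_def Bij_def bij_betw_def)
    show "\<Psi> (\<alpha> \<otimes>\<^bsub>AF\<^esub> \<beta>) s = \<Psi> \<alpha> (\<Psi> \<beta> s)" if \<alpha>: "\<alpha> \<in> auto ?F" and \<beta>: "\<beta> \<in> auto ?F" for \<alpha> \<beta> s
    proof -
      have "\<phi> (q (\<alpha> \<otimes>\<^bsub>AF\<^esub> \<beta>)) = \<phi> (q \<alpha>) \<otimes>\<^bsub>BijGroup S\<^esub> \<phi> (q \<beta>)"
        using \<alpha> \<beta> hom_mult [OF q_hom] hom_mult [OF \<phi>_hom] hom_in_carrier [OF q_hom]
        by (simp add: F.carrier_AutoGroup)
      then show ?thesis using cl [OF \<beta>, of s] bij [OF \<alpha>] bij [OF \<beta>]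
        by (simp add: \<Psi>_def BijGroup_def compose_def)
    qed
    show "\<Psi> \<one>\<^bsub>AF\<^esub> s = s" for s
    proof -
      have "q \<one>\<^bsub>AF\<^esub> = \<one>\<^bsub>Out ?F\<^esub>"
        using hom_one [OF q_hom AF.is_group F.group_Out] .
      moreover have "\<phi> \<one>\<^bsub>Out ?F\<^esub> = \<one>\<^bsub>BijGroup S\<^esub>"
        using hom_one [OF \<phi>_hom F.group_Out B.is_group] .
      ultimately show ?thesis by (simp add: \<Psi>_def BijGroup_def)
    qed
  qed
  have z: "0 \<in> {..<n}" using assms(1) by simp
  define \<epsilon> where "\<epsilon> = \<phi> (q (relabel (flip 0)))"
  have \<epsilon>B: "\<epsilon> \<in> Bij S" unfolding \<epsilon>_def by (rule bij [OF relabel_auto [OF flip_signed [OF z]]])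
  have \<epsilon>e: "\<epsilon> s = e 0 s" if "s \<in> S" for s
    using that by (simp add: \<epsilon>_def e_def g_def \<Psi>_def)
  have ext: "f = h" if "f \<in> Bij S" "h \<in> Bij S" "\<And>s. s \<in> S \<Longrightarrow> f s = h s" for f h
    using that by (intro extensionalityI [of f S h]) (auto simp: Bij_def)
  have oneB: "(\<lambda>s\<in>S. s) \<in> Bij S" using B.one_closed by (simp add: BijGroup_def)
  show ?thesis
  proof (rule factors_through_Z2_if_sign [OF assms(5)])
    show "\<epsilon> \<in> carrier (BijGroup S)" using \<epsilon>B by (simp add: BijGroup_def)
    have "compose S \<epsilon> \<epsilon> = (\<lambda>s\<in>S. s)"
      using e_e [OF z] e_closed [OF z] \<epsilon>e by (auto simp: compose_def fun_eq_iff restrict_def)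
    then show "\<epsilon> \<otimes>\<^bsub>BijGroup S\<^esub> \<epsilon> = \<one>\<^bsub>BijGroup S\<^esub>"
      using \<epsilon>B by (simp add: BijGroup_def)
    fix x assume "x \<in> carrier (Out ?F)"
    then obtain \<alpha> where \<alpha>: "\<alpha> \<in> auto ?F" "x = q \<alpha>"
      by (auto simp: Out_def FactGroup_def RCOSETS_def q_def F.carrier_AutoGroup)
    from action_sign [OF z \<alpha>(1)]
    show "\<phi> x = \<one>\<^bsub>BijGroup S\<^esub> \<or> \<phi> x = \<epsilon>"
    proof
      assume "\<forall>s\<in>S. \<Psi> \<alpha> s = s"
      then have "\<phi> x = (\<lambda>s\<in>S. s)" using bij [OF \<alpha>(1)] oneB \<alpha>(2) by (intro ext) (auto simp: \<Psi>_def)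
      then show ?thesis by (simp add: BijGroup_def)
    next
      assume "\<forall>s\<in>S. \<Psi> \<alpha> s = e 0 s"
      then have "\<phi> x = \<epsilon>" using bij [OF \<alpha>(1)] \<epsilon>B \<alpha>(2) \<epsilon>e by (intro ext) (auto simp: \<Psi>_def)
      then show ?thesis by simp
    qed
  qed
qed

end
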